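(* There exist a finite set $\mathcal A$ and a subset $D\subset \mathrm{Diff}^\omega(\mathbb R/\mathbb Z)^{\mathcal A}$ such that: (1) every $(g^a)_{a\in\mathcal A}\in D$ spans a semi-group $\langle g^a: a\in\mathcal A\rangle$ which contains parabolic maps and smooth rotations; (2) for every $2\le r\le\infty$ and for $r=\omega$, the set $D$ is $C^r$-locally dense: the closure of $D$ in $\mathrm{Diff}^r(\mathbb R/\mathbb Z)^{\mathcal A}$ has nonempty interior.
   Context: $\mathrm{Diff}^r(\mathbb R/\mathbb Z)$ is the group of circle diffeomorphisms of class $C^r$ ($r=\omega$: real analytic). For $r=\infty$ the topology is the one generated by the $C^s$-topologies, $s<\infty$; for $r=\omega$ it is the usual (inductive limit) analytic topology. The semi-group spanned by $(g^a)_{a\in\mathcal A}$ is $$\langle g^a: a\in \mathcal A\rangle=\{g^{m_n}\circ\cdots\circ g^{m_1}: n\ge 0,\ (m_1,\dots,m_n)\in \mathcal A^n\}.$$ A $C^2$-diffeomorphism $g$ of the circle is parabolic if it has a unique fixed point $c$, and $D_cg=1$, $D^2_cg\neq0$. A smooth rotation is a circle diffeomorphism which is conjugate to a rotation $R_\alpha: x\mapsto x+\alpha$ via a smooth ($C^\infty$) diffeomorphism. *)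

theory Defs
  imports "HOL-Complex_Analysis.Complex_Analysis" "HOL-Library.Extended_Nat"
begin

section \<open>The circle and lifts of its maps\<close>

quotient_type circle = real / "\<lambda>x y :: real. x - y \<in> \<int>"
proof (rule equivpI)
  show "reflp (\<lambda>x y :: real. x - y \<in> \<int>)"
    by (simp add: reflp_def)
  show "symp (\<lambda>x y :: real. x - y \<in> \<int>)"
    by (auto simp: symp_def dest: minus_in_Ints_iff[THEN iffD2])
  show "transp (\<lambda>x y :: real. x - y \<in> \<int>)"
    unfolding transp_def by (metis Ints_add add_diff_eq diff_add_cancel)
qed

lift_definition rotation :: "real \<Rightarrow> circle \<Rightarrow> circle" is "\<lambda>\<alpha> x. x + \<alpha>"
  by simp

text \<open>Two continuous lifts of the same map differ by an integer constant, so nothing below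
  depends on which lift is used.\<close>

definition is_lift :: "(real \<Rightarrow> real) \<Rightarrow> (circle \<Rightarrow> circle) \<Rightarrow> bool" where
  "is_lift F g \<longleftrightarrow> continuous_on UNIV F \<and> (\<forall>x. abs_circle (F x) = g (abs_circle x))"

section \<open>Circle diffeomorphisms\<close>

definition class_C :: "enat \<Rightarrow> (real \<Rightarrow> real) \<Rightarrow> bool" where
  "class_C r F \<longleftrightarrow>
     (\<forall>k. enat k < r \<longrightarrow> (\<forall>x. (deriv ^^ k) F differentiable (at x))) \<and>
     (\<forall>k. enat k \<le> r \<longrightarrow> continuous_on UNIV ((deriv ^^ k) F))"

definition real_analytic :: "(real \<Rightarrow> real) \<Rightarrow> bool" where
  "real_analytic F \<longleftrightarrow>
     (\<forall>x. \<exists>a. \<exists>e>0. \<forall>y. \<bar>y - x\<bar> < e \<longrightarrow> (\<lambda>n. a n * (y - x) ^ n) sums F y)"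

text \<open>Orientation-reversing diffeomorphisms are included.\<close>

definition circle_diffeos :: "((real \<Rightarrow> real) \<Rightarrow> bool) \<Rightarrow> (circle \<Rightarrow> circle) set" where
  "circle_diffeos P =
     {g. bij g \<and> (\<exists>F. is_lift F g \<and> P F) \<and> (\<exists>F. is_lift F (inv g) \<and> P F)}"

definition Diff :: "enat \<Rightarrow> (circle \<Rightarrow> circle) set" where
  "Diff r = circle_diffeos (class_C r)"

definition Diff_omega :: "(circle \<Rightarrow> circle) set" where
  "Diff_omega = circle_diffeos real_analytic"

section \<open>Topologies on the groups of diffeomorphisms\<close>

definition close_C :: "nat \<Rightarrow> real \<Rightarrow> (circle \<Rightarrow> circle) \<Rightarrow> (circle \<Rightarrow> circle) \<Rightarrow> bool" where
  "close_C s e f g \<longleftrightarrow>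
     (\<exists>F G. is_lift F f \<and> is_lift G g \<and>
        (\<forall>k\<le>s. \<forall>x. \<bar>(deriv ^^ k) F x - (deriv ^^ k) G x\<bar> < e))"

definition C_topology :: "nat \<Rightarrow> (circle \<Rightarrow> circle) topology" where
  "C_topology s = topology (\<lambda>U. U \<subseteq> Diff (enat s) \<and>
     (\<forall>f\<in>U. \<exists>e>0. \<forall>g\<in>Diff (enat s). close_C s e f g \<longrightarrow> g \<in> U))"

definition Diff_topology :: "enat \<Rightarrow> (circle \<Rightarrow> circle) topology" where
  "Diff_topology r = (case r of
       enat s \<Rightarrow> C_topology s
     | \<infinity> \<Rightarrow> topology_generated_by
             (\<Union>s. {U. openin (subtopology (C_topology s) (Diff \<infinity>)) U}))"

definition strip :: "real \<Rightarrow> complex set" where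
  "strip \<rho> = {z. \<bar>Im z\<bar> < \<rho>}"

text \<open>The difference of suitable lifts belongs to the Banach space
  \<open>H\<^sub>\<rho>\<close> of bounded holomorphic functions on the strip
  \<open>\<bar>Im z\<bar> < \<rho>\<close>, real and 1-periodic on the real line, and is small there.
  Periodicity need not be required: a bounded difference of lifts of two homeomorphisms
  of the circle is automatically periodic.\<close>

definition close_omega ::
    "real \<Rightarrow> real \<Rightarrow> (circle \<Rightarrow> circle) \<Rightarrow> (circle \<Rightarrow> circle) \<Rightarrow> bool" where
  "close_omega \<rho> e f g \<longleftrightarrow>
     (\<exists>F G \<Phi>. is_lift F f \<and> is_lift G g \<and> \<Phi> holomorphic_on strip \<rho> \<and>
        (\<forall>x. \<Phi> (of_real x) = of_real (G x - F x)) \<and>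
        (\<forall>z\<in>strip \<rho>. norm (\<Phi> z) < e))"

text \<open>The inductive limit topology: the space of analytic functions on the circle is the union of
  the Banach spaces \<open>H\<^sub>\<rho>\<close>, and near a diffeomorphism \<open>f\<close> the group is
  charted by \<open>\<phi> \<mapsto> f + \<phi>\<close>. A set is open iff for every
  \<open>\<rho>\<close> its trace on each \<open>f + H\<^sub>\<rho>\<close> is open for the norm of
  \<open>H\<^sub>\<rho>\<close>. Since the inclusions \<open>H\<^sub>\<rho> \<subseteq> H\<^sub>\<sigma>\<close>
  (\<open>\<sigma> < \<rho>\<close>) are compact, this final topology coincides with the locally convex
  inductive limit topology. Note that \<open>e\<close> depends on \<open>\<rho>\<close>.\<close>

definition Diff_omega_topology :: "(circle \<Rightarrow> circle) topology" where
  "Diff_omega_topology = topology (\<lambda>U. U \<subseteq> Diff_omega \<and>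
     (\<forall>f\<in>U. \<forall>\<rho>>0. \<exists>e>0. \<forall>g\<in>Diff_omega. close_omega \<rho> e f g \<longrightarrow> g \<in> U))"

lemma close_C_mono: "close_C s d f g \<Longrightarrow> d \<le> e \<Longrightarrow> close_C s e f g"
  unfolding close_C_def by (meson less_le_trans)

lemma close_omega_mono: "close_omega \<rho> d f g \<Longrightarrow> d \<le> e \<Longrightarrow> close_omega \<rho> e f g"
  unfolding close_omega_def by (meson less_le_trans)

lemma openin_C_topology:
  "openin (C_topology s) U \<longleftrightarrow> U \<subseteq> Diff (enat s) \<and>
     (\<forall>f\<in>U. \<exists>e>0. \<forall>g\<in>Diff (enat s). close_C s e f g \<longrightarrow> g \<in> U)"
proof -
  let ?O = "\<lambda>U. U \<subseteq> Diff (enat s) \<and>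
     (\<forall>f\<in>U. \<exists>e>0. \<forall>g\<in>Diff (enat s). close_C s e f g \<longrightarrow> g \<in> U)"
  have "?O (S \<inter> T)" if S: "?O S" and T: "?O T" for S T
  proof (intro conjI ballI)
    show "S \<inter> T \<subseteq> Diff (enat s)" using S by blast
    fix f assume f: "f \<in> S \<inter> T"
    obtain d where d: "d > 0" "\<forall>g\<in>Diff (enat s). close_C s d f g \<longrightarrow> g \<in> S"
      using S f by blast
    obtain e where e: "e > 0" "\<forall>g\<in>Diff (enat s). close_C s e f g \<longrightarrow> g \<in> T"
      using T f by blast
    show "\<exists>e>0. \<forall>g\<in>Diff (enat s). close_C s e f g \<longrightarrow> g \<in> S \<inter> T"
      using d e close_C_mono[of s "min d e" f]
      by (intro exI[of _ "min d e"]) auto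
  qed
  moreover have "?O (\<Union>\<K>)" if K: "\<forall>K\<in>\<K>. ?O K" for \<K>
  proof (intro conjI ballI)
    show "\<Union>\<K> \<subseteq> Diff (enat s)" using K by blast
    fix f assume "f \<in> \<Union>\<K>"
    then obtain K where K': "K \<in> \<K>" "f \<in> K" by blast
    then obtain e where "e > 0" "\<forall>g\<in>Diff (enat s). close_C s e f g \<longrightarrow> g \<in> K"
      using K by meson
    then show "\<exists>e>0. \<forall>g\<in>Diff (enat s). close_C s e f g \<longrightarrow> g \<in> \<Union>\<K>"
      using K'(1) by blast
  qed
  ultimately have "istopology ?O"
    unfolding istopology_def by blast
  then show ?thesis
    unfolding C_topology_def by (simp add: topology_inverse')
qed

lemma topspace_C_topology: "topspace (C_topology s) = Diff (enat s)"
proof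
  show "topspace (C_topology s) \<subseteq> Diff (enat s)"
    using openin_topspace openin_C_topology by blast
  have "openin (C_topology s) (Diff (enat s))"
    unfolding openin_C_topology by (auto intro: exI[of _ 1])
  then show "Diff (enat s) \<subseteq> topspace (C_topology s)"
    by (rule openin_subset)
qed

lemma topspace_Diff_topology: "topspace (Diff_topology r) = Diff r"
proof (cases r)
  case (enat s)
  then show ?thesis by (simp add: Diff_topology_def topspace_C_topology)
next
  case infinity
  have sub: "Diff \<infinity> \<subseteq> Diff (enat s)" for s
    unfolding Diff_def circle_diffeos_def class_C_def by auto
  have "openin (subtopology (C_topology 0) (Diff \<infinity>)) (Diff \<infinity>)"
    using openin_topspace[of "subtopology (C_topology 0) (Diff \<infinity>)"] sub[of 0]
    by (simp add: topspace_subtopology topspace_C_topology Int_absorb1)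
  moreover have "U \<subseteq> Diff \<infinity>" if "openin (subtopology (C_topology s) (Diff \<infinity>)) U" for s U
    using openin_subset[OF that] by (simp add: topspace_subtopology)
  ultimately show ?thesis
    using infinity by (auto simp: Diff_topology_def topology_generated_by_topspace)
qed

lemma openin_Diff_omega_topology:
  "openin Diff_omega_topology U \<longleftrightarrow> U \<subseteq> Diff_omega \<and>
     (\<forall>f\<in>U. \<forall>\<rho>>0. \<exists>e>0. \<forall>g\<in>Diff_omega. close_omega \<rho> e f g \<longrightarrow> g \<in> U)"
proof -
  let ?O = "\<lambda>U. U \<subseteq> Diff_omega \<and>
     (\<forall>f\<in>U. \<forall>\<rho>>0. \<exists>e>0. \<forall>g\<in>Diff_omega. close_omega \<rho> e f g \<longrightarrow> g \<in> U)"
  have "?O (S \<inter> T)" if S: "?O S" and T: "?O T" for S T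
  proof (intro conjI ballI allI impI)
    show "S \<inter> T \<subseteq> Diff_omega" using S by blast
    fix f \<rho> assume f: "f \<in> S \<inter> T" and \<rho>: "(\<rho>::real) > 0"
    obtain d where d: "d > 0" "\<forall>g\<in>Diff_omega. close_omega \<rho> d f g \<longrightarrow> g \<in> S"
      using S f \<rho> by blast
    obtain e where e: "e > 0" "\<forall>g\<in>Diff_omega. close_omega \<rho> e f g \<longrightarrow> g \<in> T"
      using T f \<rho> by blast
    show "\<exists>e>0. \<forall>g\<in>Diff_omega. close_omega \<rho> e f g \<longrightarrow> g \<in> S \<inter> T"
      using d e close_omega_mono[of \<rho> "min d e" f]
      by (intro exI[of _ "min d e"]) auto
  qed
  moreover have "?O (\<Union>\<K>)" if K: "\<forall>K\<in>\<K>. ?O K" for \<K>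
  proof (intro conjI ballI allI impI)
    show "\<Union>\<K> \<subseteq> Diff_omega" using K by blast
    fix f \<rho> assume "f \<in> \<Union>\<K>" and \<rho>: "(\<rho>::real) > 0"
    then obtain K where K': "K \<in> \<K>" "f \<in> K" by blast
    then obtain e where "e > 0" "\<forall>g\<in>Diff_omega. close_omega \<rho> e f g \<longrightarrow> g \<in> K"
      using K \<rho> by meson
    then show "\<exists>e>0. \<forall>g\<in>Diff_omega. close_omega \<rho> e f g \<longrightarrow> g \<in> \<Union>\<K>"
      using K'(1) by blast
  qed
  ultimately have "istopology ?O"
    unfolding istopology_def by blast
  then show ?thesis
    unfolding Diff_omega_topology_def by (simp add: topology_inverse')
qed

lemma topspace_Diff_omega_topology: "topspace Diff_omega_topology = Diff_omega"
proof
  show "topspace Diff_omega_topology \<subseteq> Diff_omega"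
    using openin_topspace openin_Diff_omega_topology by blast
  have "openin Diff_omega_topology Diff_omega"
    unfolding openin_Diff_omega_topology by (auto intro: exI[of _ 1])
  then show "Diff_omega \<subseteq> topspace Diff_omega_topology"
    by (rule openin_subset)
qed

section \<open>Semigroups, parabolic maps and smooth rotations\<close>

definition semigroup_span :: "'i set \<Rightarrow> ('i \<Rightarrow> circle \<Rightarrow> circle) \<Rightarrow> (circle \<Rightarrow> circle) set" where
  "semigroup_span A g = {fold (\<lambda>a f. g a \<circ> f) ms id | ms. ms \<in> lists A}"

definition parabolic :: "(circle \<Rightarrow> circle) \<Rightarrow> bool" where
  "parabolic g \<longleftrightarrow> g \<in> Diff 2 \<and>
     (\<exists>c. g c = c \<and> (\<forall>c'. g c' = c' \<longrightarrow> c' = c) \<and>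
        (\<exists>F x. is_lift F g \<and> abs_circle x = c \<and> deriv F x = 1 \<and> (deriv ^^ 2) F x \<noteq> 0))"

definition smooth_rotation :: "(circle \<Rightarrow> circle) \<Rightarrow> bool" where
  "smooth_rotation g \<longleftrightarrow> (\<exists>h\<in>Diff \<infinity>. \<exists>\<alpha>. g = h \<circ> rotation \<alpha> \<circ> inv h)"

definition locally_dense :: "'a topology \<Rightarrow> 'a set \<Rightarrow> bool" where
  "locally_dense X D \<longleftrightarrow> X interior_of (X closure_of D) \<noteq> {}"

end

theory Submission
  imports Defs "HOL-Number_Theory.Fib"
begin

text \<open>Take five generators: on an interval \<open>I\<close> around the attracting fixed point of the first one,
  the first three contract and their images cover \<open>I\<close>, so the orbit of this point under the first
  three is dense in \<open>I\<close>; the last two carry \<open>I\<close> across the repelling fixed point of the first one.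
  All of this is \<open>C\<^sup>1\<close>-robust. Hence in a word ending with one of the last two letters, an
  arbitrarily small translation of that letter moves the displacement (map minus identity) from
  taking negative values to taking values above 1. In between, the displacement has minimum 0, and
  adding a small multiple of \<open>1 - cos\<close> to the letter turns a minimum point into a unique
  nondegenerate fixed point; also in between, the rotation number is the golden mean.

  A smooth diffeomorphism \<open>f\<close> with golden rotation number is smoothly conjugate to the rotation.
  Write \<open>m\<^sub>n\<close> for the displacement of \<open>f\<close> iterated \<open>q\<^sub>n\<close> times, modulo integers. Denjoy's distortion
  estimate makes the \<open>m\<^sub>n\<close> decay geometrically; the Schwarzian derivatives of the iterates are then
  small relative to \<open>m\<^sub>n\<^sup>-\<^sup>2\<close>, and a Riccati comparison bounds the nonlinearity, so that the first
  derivatives of all iterates are bounded. It follows that the \<open>(k + 1)\<close>-st derivatives of the \<open>N\<close>-th iterate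
  are \<open>O(N\<^sup>k\<^sup>/\<^sup>2)\<close>, and interpolation against the smallness of \<open>m\<^sub>n\<close> gives geometric decay of all
  derivatives of \<open>m\<^sub>n\<close>. The averages of the first \<open>q\<^sub>n\<close> iterates therefore converge smoothly, to the
  linearizing coordinate.\<close>

section \<open>Smooth functions of one real variable\<close>

text \<open>Letters 3 and 4 are distinct because the two perturbations must not interfere: each is
  modified for one purpose and occurs once in its word, as the last letter, while the rest of the
  word uses the untouched letters 0, 1, 2. Translating the letter therefore translates the whole
  word. An arbitrarily small translation suffices because of a long initial power of the letter 0,
  which carries the two sides of its repelling point to consecutive lifts of the attracting point.
  No rotation number is defined; comparison of orbits with the golden mean replaces it. The
  square-root bound on the iterates does not by itself give decay of all derivatives of
  \<open>m_n\<close>: interpolated against \<open>O(1 / q_n)\<close> it handles the first order but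
  not the second. It serves to make the composition of return maps nearly additive, so that the
  derivatives of each fixed order grow at most like \<open>3 ^ n\<close>, a rate independent of the
  order; interpolation with a high order then gives decay. The conditions on the generators are C^1,
  so one set of tuples serves all topologies; only the search for analytic tuples in an open set
  depends on the topology.\<close>

fun diffk :: "nat \<Rightarrow> (real \<Rightarrow> real) \<Rightarrow> bool" where
  "diffk 0 u = True"
| "diffk (Suc k) u = ((\<forall>x. u differentiable (at x)) \<and> diffk k (deriv u))"

definition smooth :: "(real \<Rightarrow> real) \<Rightarrow> bool" where
  "smooth u \<longleftrightarrow> (\<forall>k. diffk k u)"

text \<open>The recursion in \<open>diffk\<close> differentiates the argument itself, so that
  products and compositions pass through one induction generalized over the functions; this
  equivalence links it to iterated derivatives.\<close>

lemma diffk_iff: "diffk k u \<longleftrightarrow> (\<forall>j<k. \<forall>x. (deriv ^^ j) u differentiable (at x))"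
proof (induction k arbitrary: u)
  case (Suc k)
  then show ?case
    by (auto simp: less_Suc_eq_0_disj funpow_swap1 simp del: funpow.simps)
      (auto simp: funpow_swap1)
qed simp

lemma diffk_Suc_imp: "diffk (Suc k) u \<Longrightarrow> diffk k u"
  by (simp add: diffk_iff del: diffk.simps)

lemma smooth_DERIV: "smooth u \<Longrightarrow> (u has_real_derivative deriv u x) (at x)"
  unfolding smooth_def
  by (metis diffk.simps(2) DERIV_deriv_iff_real_differentiable)

lemma smooth_deriv: "smooth u \<Longrightarrow> smooth (deriv u)"
  unfolding smooth_def by (metis diffk.simps(2))

lemma smooth_derivs: "smooth u \<Longrightarrow> smooth ((deriv ^^ k) u)"
  by (induction k) (auto intro: smooth_deriv)

lemma smooth_isCont: "smooth u \<Longrightarrow> isCont u x"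
  using smooth_DERIV DERIV_isCont by blast

lemma smooth_continuous: "smooth u \<Longrightarrow> continuous_on A u"
  using smooth_isCont continuous_at_imp_continuous_on by blast

lemma smooth_class_C: "smooth u \<longleftrightarrow> class_C \<infinity> u"
proof
  assume u: "smooth u"
  have "(deriv ^^ k) u differentiable (at x)" for k x
    using smooth_DERIV[OF smooth_derivs[OF u]] real_differentiable_def by blast
  then show "class_C \<infinity> u"
    unfolding class_C_def using smooth_continuous[OF smooth_derivs[OF u]] by simp
next
  assume "class_C \<infinity> u"
  then show "smooth u"
    unfolding class_C_def smooth_def diffk_iff by simp
qed

lemma smooth_class_C': "smooth u \<Longrightarrow> class_C r u"
  using smooth_class_C unfolding class_C_def by auto

lemma diffk_const [simp]: "diffk k (\<lambda>x. c)"
  by (induction k arbitrary: c) auto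

lemma diffk_ident [simp]: "diffk k (\<lambda>x. x)"
  by (cases k) auto

lemma diffk_add: "diffk k u \<Longrightarrow> diffk k v \<Longrightarrow> diffk k (\<lambda>x. u x + v x)"
proof (induction k arbitrary: u v)
  case (Suc k)
  then have "deriv (\<lambda>x. u x + v x) = (\<lambda>x. deriv u x + deriv v x)"
    by (intro ext DERIV_imp_deriv DERIV_add) (auto simp: DERIV_deriv_iff_real_differentiable)
  with Suc show ?case by auto
qed simp

lemma diffk_mult: "diffk k u \<Longrightarrow> diffk k v \<Longrightarrow> diffk k (\<lambda>x. u x * v x)"
proof (induction k arbitrary: u v)
  case (Suc k)
  then have "deriv (\<lambda>x. u x * v x) = (\<lambda>x. deriv u x * v x + u x * deriv v x)"
    by (intro ext DERIV_imp_deriv DERIV_cong[OF DERIV_mult[OF DERIV_deriv_iff_real_differentiable[THEN iffD2]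
        DERIV_deriv_iff_real_differentiable[THEN iffD2]]]) auto
  moreover have "diffk k u" "diffk k v" using Suc.prems[THEN diffk_Suc_imp] by blast+
  ultimately show ?case using Suc by (auto intro!: diffk_add)
qed simp

lemma diffk_comp: "diffk k u \<Longrightarrow> diffk k v \<Longrightarrow> diffk k (\<lambda>x. u (v x))"
proof (induction k arbitrary: u v)
  case (Suc k)
  then have d: "((\<lambda>x. u (v x)) has_real_derivative deriv u (v x) * deriv v x) (at x)" for x
    by (intro DERIV_chain2[of u]) (auto simp: DERIV_deriv_iff_real_differentiable)
  then have "deriv (\<lambda>x. u (v x)) = (\<lambda>x. deriv u (v x) * deriv v x)"
    by (auto intro: DERIV_imp_deriv)
  moreover have "diffk k v" using Suc.prems(2) by (rule diffk_Suc_imp)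
  ultimately show ?case using Suc d by (auto intro!: diffk_mult simp: real_differentiable_def)
qed simp

lemma diffk_inverse: "diffk k u \<Longrightarrow> (\<And>x. u x \<noteq> 0) \<Longrightarrow> diffk k (\<lambda>x. inverse (u x))"
proof (induction k)
  case (Suc k)
  then have d: "((\<lambda>x. inverse (u x)) has_real_derivative
      - 1 * (inverse (u x) * (inverse (u x) * deriv u x))) (at x)" for x
    by (auto intro!: derivative_eq_intros simp: DERIV_deriv_iff_real_differentiable)
  then have "deriv (\<lambda>x. inverse (u x)) = (\<lambda>x. - 1 * (inverse (u x) * (inverse (u x) * deriv u x)))"
    by (auto intro: DERIV_imp_deriv)
  moreover have "diffk k (\<lambda>x. inverse (u x))"
    using Suc.IH[OF diffk_Suc_imp[OF Suc.prems(1)] Suc.prems(2)] .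
  moreover have "diffk k (deriv u)" using Suc by auto
  ultimately show ?case using d
    by (auto intro!: diffk_mult[of k "\<lambda>x. -1", simplified] diffk_mult simp: real_differentiable_def)
qed simp

lemma smooth_const [simp]: "smooth (\<lambda>x. c)"
  and smooth_ident [simp]: "smooth (\<lambda>x. x)"
  and smooth_add: "smooth u \<Longrightarrow> smooth v \<Longrightarrow> smooth (\<lambda>x. u x + v x)"
  and smooth_mult: "smooth u \<Longrightarrow> smooth v \<Longrightarrow> smooth (\<lambda>x. u x * v x)"
  and smooth_comp: "smooth u \<Longrightarrow> smooth v \<Longrightarrow> smooth (\<lambda>x. u (v x))"
  and smooth_inverse: "smooth u \<Longrightarrow> (\<And>x. u x \<noteq> 0) \<Longrightarrow> smooth (\<lambda>x. inverse (u x))"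
  by (auto simp: smooth_def intro: diffk_add diffk_mult diffk_comp diffk_inverse)

lemma smooth_o: "smooth u \<Longrightarrow> smooth v \<Longrightarrow> smooth (u \<circ> v)"
  using smooth_comp by (simp add: comp_def)

lemma smooth_minus: "smooth u \<Longrightarrow> smooth (\<lambda>x. - u x)"
  using smooth_mult[of "\<lambda>x. -1" u] by simp

lemma smooth_diff: "smooth u \<Longrightarrow> smooth v \<Longrightarrow> smooth (\<lambda>x. u x - v x)"
  using smooth_add[of u "\<lambda>x. - v x"] smooth_minus by simp

lemma smooth_divide: "smooth u \<Longrightarrow> smooth v \<Longrightarrow> (\<And>x. v x \<noteq> 0) \<Longrightarrow> smooth (\<lambda>x. u x / v x)"
  by (simp add: divide_inverse smooth_mult smooth_inverse)

lemma smooth_sum: "(\<And>i. i \<in> I \<Longrightarrow> smooth (u i)) \<Longrightarrow> smooth (\<lambda>x. \<Sum>i\<in>I. u i x)"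
  by (induction I rule: infinite_finite_induct) (auto intro: smooth_add)

lemma smooth_power: "smooth u \<Longrightarrow> smooth (\<lambda>x. u x ^ n)"
  by (induction n) (auto intro: smooth_mult)

lemma smooth_funpow: "smooth f \<Longrightarrow> smooth (f ^^ n)"
  by (induction n) (auto intro!: smooth_o simp: id_def)

lemmas smooth_intros = smooth_const smooth_ident smooth_add smooth_mult smooth_minus
  smooth_diff smooth_divide smooth_sum smooth_power smooth_deriv smooth_derivs

lemma deriv_add_smooth: "smooth u \<Longrightarrow> smooth v \<Longrightarrow> deriv (\<lambda>x. u x + v x) = (\<lambda>x. deriv u x + deriv v x)"
  and deriv_diff_smooth: "smooth u \<Longrightarrow> smooth v \<Longrightarrow> deriv (\<lambda>x. u x - v x) = (\<lambda>x. deriv u x - deriv v x)"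
  and deriv_mult_smooth: "smooth u \<Longrightarrow> smooth v \<Longrightarrow> deriv (\<lambda>x. u x * v x) = (\<lambda>x. deriv u x * v x + u x * deriv v x)"
  by (auto intro!: ext DERIV_imp_deriv derivative_eq_intros smooth_DERIV)

lemma deriv_comp_smooth: "smooth u \<Longrightarrow> smooth v \<Longrightarrow> deriv (\<lambda>x. u (v x)) = (\<lambda>x. deriv u (v x) * deriv v x)"
  by (intro ext DERIV_imp_deriv DERIV_chain2[of u] smooth_DERIV)

lemma derivs_add: "smooth u \<Longrightarrow> smooth v \<Longrightarrow>
    (deriv ^^ k) (\<lambda>x. u x + v x) = (\<lambda>x. (deriv ^^ k) u x + (deriv ^^ k) v x)"
  by (induction k) (auto simp: deriv_add_smooth smooth_derivs)

lemma derivs_diff: "smooth u \<Longrightarrow> smooth v \<Longrightarrow>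
    (deriv ^^ k) (\<lambda>x. u x - v x) = (\<lambda>x. (deriv ^^ k) u x - (deriv ^^ k) v x)"
  by (induction k) (auto simp: deriv_diff_smooth smooth_derivs)

lemma derivs_cmult: "smooth u \<Longrightarrow> (deriv ^^ k) (\<lambda>x. c * u x) = (\<lambda>x. c * (deriv ^^ k) u x)"
proof (induction k)
  case (Suc k)
  then show ?case using deriv_mult_smooth[of "\<lambda>x. c" "(deriv ^^ k) u"] by (simp add: smooth_derivs)
qed simp

lemma derivs_sum: "(\<And>i. i \<in> I \<Longrightarrow> smooth (u i)) \<Longrightarrow>
    (deriv ^^ k) (\<lambda>x. \<Sum>i\<in>I. u i x) = (\<lambda>x. \<Sum>i\<in>I. (deriv ^^ k) (u i) x)"
proof (induction I rule: infinite_finite_induct)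
  case (insert i I)
  then show ?case using derivs_add[of "u i" "\<lambda>x. \<Sum>i\<in>I. u i x" k]
    by (simp add: smooth_sum)
next
  case (infinite A)
  show ?case using infinite by (induction k) (simp_all add: fun_eq_iff)
next
  case empty
  show ?case by (induction k) (simp_all add: fun_eq_iff)
qed

lemma derivs_const: "(deriv ^^ Suc k) (\<lambda>x::real. c) = (\<lambda>x. 0)"
  by (induction k) (simp_all add: fun_eq_iff)

lemma derivs_shift: "smooth u \<Longrightarrow> (deriv ^^ k) (\<lambda>x. u (x + c)) = (\<lambda>x. (deriv ^^ k) u (x + c))"
proof (induction k)
  case (Suc k)
  have "deriv (\<lambda>x. (deriv ^^ k) u (x + c)) = (\<lambda>x. deriv ((deriv ^^ k) u) (x + c) * deriv (\<lambda>x. x + c) x)"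
    using Suc.prems by (intro deriv_comp_smooth smooth_intros)
  with Suc show ?case by simp
qed simp

text \<open>Bootstrapping: the formula \<open>inverse (deriv f (g y))\<close> for the derivative of
  \<open>g\<close> is \<open>k\<close> times differentiable as soon as \<open>g\<close> is, which
  makes \<open>g\<close> itself \<open>k + 1\<close> times differentiable.\<close>

lemma smooth_inv:
  fixes f g :: "real \<Rightarrow> real"
  assumes f: "smooth f" and pos: "\<And>x. deriv f x > 0" and fg: "\<And>x. f (g x) = x" and gf: "\<And>x. g (f x) = x"
  shows "smooth g" and "deriv g x = inverse (deriv f (g x))"
proof -
  have d: "(g has_real_derivative inverse (deriv f (g y))) (at y)" for y
  proof (rule DERIV_inverse_function[of f _ g _ "y - 1" "y + 1"])
    have "isCont g (f (g y))"
      by (rule isCont_inverse_function[of 1]) (auto simp: gf smooth_isCont f)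
    then show "isCont g y" by (simp add: fg)
  qed (use pos[of "g y"] in \<open>auto simp: fg intro: smooth_DERIV f\<close>)
  then have e: "deriv g = (\<lambda>y. inverse (deriv f (g y)))" by (auto intro!: ext DERIV_imp_deriv)
  show "deriv g x = inverse (deriv f (g x))" by (simp add: e)
  have "diffk k g" for k
  proof (induction k)
    case (Suc k)
    have "diffk k (\<lambda>y. deriv f (g y))" using diffk_comp[OF _ Suc] f smooth_deriv smooth_def by blast
    then have "diffk k (\<lambda>y. inverse (deriv f (g y)))"
      using diffk_inverse[of k "\<lambda>y. deriv f (g y)"] pos by (metis less_irrefl)
    with d show ?case by (auto simp: e real_differentiable_def)
  qed simp
  then show "smooth g" by (simp add: smooth_def)
qed

subsection \<open>Scaled bounds on derivatives\<close>

text \<open>\<open>P\<close> is a size and \<open>L\<close> an inverse length. At fixed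
  \<open>L\<close> this shape survives sums, products and compositions, with only \<open>P\<close>
  multiplied by factors that depend on the order.\<close>

definition bd :: "nat \<Rightarrow> (real \<Rightarrow> real) \<Rightarrow> real \<Rightarrow> real \<Rightarrow> bool" where
  "bd k u P L \<longleftrightarrow> (\<forall>j\<le>k. \<forall>x. \<bar>(deriv ^^ j) u x\<bar> \<le> P * L ^ j)"

lemma bd_Suc: "bd (Suc k) u P L \<longleftrightarrow> (\<forall>x. \<bar>u x\<bar> \<le> P) \<and> bd k (deriv u) (P * L) L"
proof
  assume r: "bd (Suc k) u P L"
  have "\<bar>u x\<bar> \<le> P" for x using r unfolding bd_def by (metis zero_le funpow_0 mult.right_neutral power_0)
  moreover have "\<bar>(deriv ^^ j) (deriv u) x\<bar> \<le> P * L * L ^ j" if "j \<le> k" for j x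
    using r[unfolded bd_def, rule_format, of "Suc j" x] that by (simp add: funpow_swap1 mult.assoc)
  ultimately show "(\<forall>x. \<bar>u x\<bar> \<le> P) \<and> bd k (deriv u) (P * L) L" by (simp add: bd_def)
next
  assume r: "(\<forall>x. \<bar>u x\<bar> \<le> P) \<and> bd k (deriv u) (P * L) L"
  show "bd (Suc k) u P L"
    unfolding bd_def
  proof (intro allI impI)
    fix j x assume "j \<le> Suc k"
    then show "\<bar>(deriv ^^ j) u x\<bar> \<le> P * L ^ j"
      using r by (cases j) (auto simp: bd_def funpow_swap1 mult.assoc)
  qed
qed

lemma bd_0: "bd 0 u P L \<longleftrightarrow> (\<forall>x. \<bar>u x\<bar> \<le> P)"
  by (simp add: bd_def)

lemma bd_D: "bd k u P L \<Longrightarrow> j \<le> k \<Longrightarrow> \<bar>(deriv ^^ j) u x\<bar> \<le> P * L ^ j"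
  by (simp add: bd_def)

lemma bd_D0: "bd k u P L \<Longrightarrow> \<bar>u x\<bar> \<le> P"
  using bd_D[of k u P L 0 x] by simp

lemma bd_le: "bd k u P L \<Longrightarrow> j \<le> k \<Longrightarrow> bd j u P L"
  by (simp add: bd_def)

lemma bd_mono: "bd k u P L \<Longrightarrow> P \<le> P' \<Longrightarrow> L \<le> L' \<Longrightarrow> 0 \<le> L \<Longrightarrow> 0 \<le> P' \<Longrightarrow> bd k u P' L'"
  unfolding bd_def by (meson mult_mono order_trans power_mono zero_le_power)

lemma bd_add:
  "smooth u \<Longrightarrow> smooth v \<Longrightarrow> bd k u P L \<Longrightarrow> bd k v Q L \<Longrightarrow> bd k (\<lambda>x. u x + v x) (P + Q) L"
  unfolding bd_def by (auto simp: derivs_add distrib_right intro!: order_trans[OF abs_triangle_ineq] add_mono)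

lemma bd_cmult:
  "smooth u \<Longrightarrow> bd k u P L \<Longrightarrow> bd k (\<lambda>x. c * u x) (\<bar>c\<bar> * P) L"
  unfolding bd_def by (auto simp: derivs_cmult abs_mult mult.assoc intro: mult_left_mono)

lemma bd_sum:
  assumes "\<And>i. i \<in> I \<Longrightarrow> smooth (u i)" "\<And>i. i \<in> I \<Longrightarrow> bd k (u i) P L"
  shows "bd k (\<lambda>x. \<Sum>i\<in>I. u i x) (of_nat (card I) * P) L"
  unfolding bd_def
proof (intro allI impI)
  fix j x assume "j \<le> k"
  then have "\<bar>\<Sum>i\<in>I. (deriv ^^ j) (u i) x\<bar> \<le> (\<Sum>i\<in>I. P * L ^ j)"
    using assms(2) by (intro order_trans[OF sum_abs] sum_mono) (auto simp: bd_def)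
  with assms(1) show "\<bar>(deriv ^^ j) (\<lambda>x. \<Sum>i\<in>I. u i x) x\<bar> \<le> of_nat (card I) * P * L ^ j"
    by (simp add: derivs_sum mult.assoc)
qed

lemma bd_mult:
  assumes "smooth u" "smooth v" "bd k u P L" "bd k v Q L" "0 \<le> L"
  shows "bd k (\<lambda>x. u x * v x) (2 ^ k * P * Q) L"
  using assms
proof (induction k arbitrary: u v P Q)
  case 0
  then show ?case by (simp add: bd_0 abs_mult) (meson abs_ge_zero mult_mono order_trans)
next
  case (Suc k)
  have P: "0 \<le> P" "0 \<le> Q" using Suc.prems bd_D0 abs_ge_zero order_trans by meson+
  have u: "\<forall>x. \<bar>u x\<bar> \<le> P" "bd k (deriv u) (P * L) L" and v: "\<forall>x. \<bar>v x\<bar> \<le> Q" "bd k (deriv v) (Q * L) L"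
    using Suc.prems by (simp_all add: bd_Suc)
  have 1: "bd k (\<lambda>x. deriv u x * v x) (2 ^ k * (P * L) * Q) L"
    using Suc.prems u by (intro Suc.IH) (auto intro: smooth_intros bd_le)
  have 2: "bd k (\<lambda>x. u x * deriv v x) (2 ^ k * P * (Q * L)) L"
    using Suc.prems v by (intro Suc.IH) (auto intro: smooth_intros bd_le)
  have "bd k (\<lambda>x. deriv u x * v x + u x * deriv v x) (2 ^ k * (P * L) * Q + 2 ^ k * P * (Q * L)) L"
    using Suc.prems by (intro bd_add 1 2 smooth_intros)
  moreover have "\<bar>u x * v x\<bar> \<le> 2 ^ Suc k * P * Q" for x
  proof -
    have "\<bar>u x * v x\<bar> \<le> P * Q" using u v P by (auto simp: abs_mult intro: mult_mono)
    also have "\<dots> \<le> 2 ^ Suc k * (P * Q)"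
      using P mult_right_mono[of 1 "2 ^ Suc k" "P * Q"] one_le_power[of "2::real" "Suc k"] by simp
    finally show ?thesis by (simp add: mult.assoc)
  qed
  ultimately show ?case
    using Suc.prems by (simp add: bd_Suc deriv_mult_smooth algebra_simps)
qed

fun comp_const :: "nat \<Rightarrow> real \<Rightarrow> real" where
  "comp_const 0 Q = 1"
| "comp_const (Suc k) Q = 2 ^ k * comp_const k Q * Q"

lemma comp_const_ge_1: "1 \<le> Q \<Longrightarrow> 1 \<le> comp_const k Q"
proof (induction k)
  case (Suc k)
  have "1 \<le> 2 ^ k * comp_const k Q"
    using Suc mult_mono[of 1 "2 ^ k" 1 "comp_const k Q"] by simp
  with Suc.prems show ?case using mult_mono[of 1 "2 ^ k * comp_const k Q" 1 Q] by simp
qed simp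

text \<open>Induction along the chain rule; applying \<open>bd_mult\<close> to
  \<open>deriv u (F x) * deriv F x\<close> produces the recursion of \<open>comp_const\<close>. Only
  \<open>deriv F\<close> is bounded, because \<open>F\<close> will be an iterate of a lift.\<close>

lemma bd_comp:
  assumes "smooth u" "smooth F" "bd k u P L" "bd k (deriv F) Q L" "0 \<le> L" "1 \<le> Q"
  shows "bd k (\<lambda>x. u (F x)) (comp_const k Q * P) L"
  using assms
proof (induction k arbitrary: u P)
  case 0
  then show ?case by (simp add: bd_0)
next
  case (Suc k)
  have P: "0 \<le> P" using Suc.prems bd_D0 abs_ge_zero order_trans by meson
  have "bd k (\<lambda>x. deriv u (F x)) (comp_const k Q * (P * L)) L"
    using Suc.prems by (intro Suc.IH) (auto simp: bd_Suc[of _ u] intro: smooth_intros bd_le)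
  then have "bd k (\<lambda>x. deriv u (F x) * deriv F x) (2 ^ k * (comp_const k Q * (P * L)) * Q) L"
    using Suc.prems smooth_comp[OF smooth_deriv, of u F] by (intro bd_mult) (auto intro: smooth_intros bd_le)
  moreover have "\<bar>u (F x)\<bar> \<le> comp_const (Suc k) Q * P" for x
  proof -
    have "1 * P \<le> comp_const (Suc k) Q * P"
      using comp_const_ge_1[OF \<open>1 \<le> Q\<close>, of "Suc k"] P by (intro mult_right_mono)
    with bd_D0[OF Suc.prems(3), of "F x"] show ?thesis by linarith
  qed
  ultimately show ?case
    using Suc.prems by (simp add: bd_Suc deriv_comp_smooth algebra_simps)
qed

fun near_const :: "nat \<Rightarrow> real" where
  "near_const 0 = 0"
| "near_const (Suc k) = near_const k + 2 ^ k * (1 + near_const k)"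

lemma near_const_nonneg: "0 \<le> near_const k"
  by (induction k) auto

text \<open>In the chain rule the factor \<open>1 + deriv \<psi> x\<close> splits off a product that
  carries \<open>L * N\<close>, so composing with a map near the identity costs only a relative
  error of that size. The bounds start at order 1 because \<open>u\<close> may be an iterate, which
  is unbounded.\<close>

lemma comp_near_id:
  assumes "smooth u" "smooth \<psi>" "0 \<le> L" "0 \<le> N" "0 \<le> P" "L * N \<le> 1"
    and u: "\<And>j x. 1 \<le> j \<Longrightarrow> j \<le> k \<Longrightarrow> \<bar>(deriv ^^ j) u x\<bar> \<le> P * L ^ j"
    and psi: "\<And>j x. 1 \<le> j \<Longrightarrow> j \<le> k \<Longrightarrow> \<bar>(deriv ^^ j) \<psi> x\<bar> \<le> N * L ^ j"
    and "j \<le> k"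
  shows "\<bar>(deriv ^^ j) (\<lambda>x. u (x + \<psi> x)) x - (deriv ^^ j) u (x + \<psi> x)\<bar>
           \<le> near_const k * P * L ^ j * (L * N)"
  using assms
proof (induction k arbitrary: u P j x)
  case (Suc k)
  show ?case
  proof (cases j)
    case 0
    then show ?thesis using Suc.prems near_const_nonneg[of "Suc k"] by (simp del: near_const.simps)
  next
    case (Suc i)
    define v where "v = (\<lambda>x. deriv u (x + \<psi> x))"
    have sv: "smooth v" unfolding v_def
      using Suc.prems by (intro smooth_comp[OF smooth_deriv smooth_add]) auto
    have LN: "0 \<le> L * N" using Suc.prems by simp
    have IH: "\<bar>(deriv ^^ i) v x - (deriv ^^ i) (deriv u) (x + \<psi> x)\<bar>
        \<le> near_const k * (P * L) * L ^ i * (L * N)" if "i \<le> k" for i x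
      unfolding v_def
    proof (rule Suc.IH)
      fix j x assume "1 \<le> j" "j \<le> k"
      then show "\<bar>(deriv ^^ j) (deriv u) x\<bar> \<le> P * L * L ^ j"
        using Suc.prems(7)[of "Suc j" x] by (simp add: funpow_swap1 mult.assoc)
    qed (use Suc.prems that in \<open>auto intro: smooth_intros\<close>)
    have bv: "bd k v ((1 + near_const k) * (P * L)) L"
      unfolding bd_def
    proof (intro allI impI)
      fix i x assume i: "i \<le> k"
      have "\<bar>(deriv ^^ i) (deriv u) (x + \<psi> x)\<bar> \<le> P * L * L ^ i"
        using Suc.prems(7)[of "Suc i" "x + \<psi> x"] i by (simp add: funpow_swap1 mult.assoc)
      moreover have "near_const k * (P * L) * L ^ i * (L * N) \<le> near_const k * (P * L) * L ^ i"
        using Suc.prems near_const_nonneg[of k] by (intro mult_left_le) auto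
      ultimately show "\<bar>(deriv ^^ i) v x\<bar> \<le> (1 + near_const k) * (P * L) * L ^ i"
        using IH[OF i, of x] by (simp add: algebra_simps)
    qed
    have bp: "bd k (deriv \<psi>) (N * L) L"
      unfolding bd_def
    proof (intro allI impI)
      fix i x assume i: "i \<le> k"
      then show "\<bar>(deriv ^^ i) (deriv \<psi>) x\<bar> \<le> N * L * L ^ i"
        using Suc.prems(8)[of "Suc i" x] by (simp add: funpow_swap1 mult.assoc)
    qed
    have i: "i \<le> k" using Suc Suc.prems by simp
    have "deriv (\<lambda>x. u (x + \<psi> x)) = (\<lambda>x. deriv u (x + \<psi> x) * deriv (\<lambda>x. x + \<psi> x) x)"
      using Suc.prems by (intro deriv_comp_smooth smooth_intros)
    also have "\<dots> = (\<lambda>x. v x + v x * deriv \<psi> x)"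
      using Suc.prems by (simp add: v_def deriv_add_smooth algebra_simps)
    finally have "(deriv ^^ j) (\<lambda>x. u (x + \<psi> x)) x
        = (deriv ^^ i) v x + (deriv ^^ i) (\<lambda>x. v x * deriv \<psi> x) x"
      unfolding \<open>j = Suc i\<close> funpow_Suc_right o_apply
      using sv Suc.prems by (simp add: derivs_add smooth_intros)
    moreover have "\<bar>(deriv ^^ i) (\<lambda>x. v x * deriv \<psi> x) x\<bar>
        \<le> 2 ^ k * ((1 + near_const k) * (P * L)) * (N * L) * L ^ i"
      using bd_D[OF bd_mult[OF sv smooth_deriv bv bp] i] Suc.prems by blast
    moreover have "(deriv ^^ j) u (x + \<psi> x) = (deriv ^^ i) (deriv u) (x + \<psi> x)"
      by (simp add: Suc funpow_swap1)
    ultimately have "\<bar>(deriv ^^ j) (\<lambda>x. u (x + \<psi> x)) x - (deriv ^^ j) u (x + \<psi> x)\<bar>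
        \<le> near_const k * (P * L) * L ^ i * (L * N) + 2 ^ k * ((1 + near_const k) * (P * L)) * (N * L) * L ^ i"
      using IH[OF i, of x] by linarith
    also have "\<dots> = near_const (Suc k) * P * L ^ j * (L * N)"
      by (simp add: Suc algebra_simps)
    finally show ?thesis .
  qed
qed simp

subsection \<open>Periodic functions and interpolation of derivatives\<close>

definition periodic :: "(real \<Rightarrow> real) \<Rightarrow> bool" where
  "periodic u \<longleftrightarrow> (\<forall>x. u (x + 1) = u x)"

text \<open>Serves periodic functions (\<open>d = 0\<close>) and lifts of degree one
  (\<open>d = 1\<close>) at once.\<close>

lemma shift_int:
  fixes u :: "real \<Rightarrow> real"
  assumes "\<And>x. u (x + 1) = u x + d"
  shows "u (x + of_int k) = u x + of_int k * d"
proof (induction k rule: int_induct[where k = 0])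
  case (step1 i)
  then show ?case using assms[of "x + of_int i"] by (simp add: algebra_simps)
next
  case (step2 i)
  then show ?case using assms[of "x + of_int i - 1"] by (simp add: algebra_simps)
qed simp

lemma periodic_int: "periodic u \<Longrightarrow> u (x + of_int k) = u x"
  using shift_int[of u 0] by (simp add: periodic_def)

lemma periodic_frac: "periodic u \<Longrightarrow> u x = u (frac x)"
  using periodic_int[of u x "- \<lfloor>x\<rfloor>"] by (simp add: frac_def)

lemma periodic_deriv: "smooth u \<Longrightarrow> periodic u \<Longrightarrow> periodic (deriv u)"
  using derivs_shift[of u 1 1] by (auto simp: periodic_def fun_eq_iff)

lemma periodic_derivs: "smooth u \<Longrightarrow> periodic u \<Longrightarrow> periodic ((deriv ^^ k) u)"
  by (induction k) (auto intro: periodic_deriv smooth_derivs)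

lemma periodic_attains:
  assumes "periodic u" "continuous_on UNIV u"
  obtains z where "\<And>x. \<bar>u x\<bar> \<le> \<bar>u z\<bar>"
proof -
  have "continuous_on {0..1} (\<lambda>x. \<bar>u x\<bar>)"
    using assms(2) by (intro continuous_intros) (auto intro: continuous_on_subset)
  then obtain z where "\<forall>y\<in>{0..1}. \<bar>u y\<bar> \<le> \<bar>u z\<bar>"
    using continuous_attains_sup[of "{0..1::real}" "\<lambda>x. \<bar>u x\<bar>"] by auto
  then have "\<bar>u x\<bar> \<le> \<bar>u z\<bar>" for x
    using periodic_frac[OF assms(1), of x] frac_ge_0[of x] frac_lt_1[of x]
    by (metis atLeastAtMost_iff less_imp_le)
  then show ?thesis using that by blast
qed

definition nrm :: "(real \<Rightarrow> real) \<Rightarrow> real" where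
  "nrm u = (SUP x. \<bar>u x\<bar>)"

lemma nrm_ge: "smooth u \<Longrightarrow> periodic u \<Longrightarrow> \<bar>u x\<bar> \<le> nrm u"
  unfolding nrm_def
  by (rule cSUP_upper) (metis UNIV_I bdd_aboveI2 periodic_attains smooth_continuous)+

lemma nrm_le: "(\<And>x. \<bar>u x\<bar> \<le> c) \<Longrightarrow> nrm u \<le> c"
  unfolding nrm_def by (rule cSUP_least) auto

lemma nrm_nonneg: "smooth u \<Longrightarrow> periodic u \<Longrightarrow> 0 \<le> nrm u"
  using nrm_ge[of u 0] by linarith

text \<open>Landau's inequality. On a window of length \<open>t\<close> some value of the derivative
  is a difference quotient, and the second derivative carries it to \<open>x\<close> at cost
  \<open>t * b\<close>; then \<open>t\<close> is chosen.\<close>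

lemma landau:
  assumes u: "smooth u" and a: "\<And>x. \<bar>u x\<bar> \<le> a" and b: "\<And>x. \<bar>deriv (deriv u) x\<bar> \<le> b"
  shows "\<bar>deriv u x\<bar>\<^sup>2 \<le> 8 * a * b"
proof -
  define d where "d = deriv u x"
  have key: "t * \<bar>d\<bar> \<le> 2 * a + b * t\<^sup>2" if t: "t > 0" for t
  proof -
    have "\<exists>z. x < z \<and> z < x + t \<and> u (x + t) - u x = (x + t - x) * deriv u z"
      using t by (intro MVT2 smooth_DERIV u) auto
    then obtain z where z: "x < z" "z < x + t" "u (x + t) - u x = t * deriv u z" by auto
    have "\<exists>w. x < w \<and> w < z \<and> deriv u z - deriv u x = (z - x) * deriv (deriv u) w"
      using z by (intro MVT2 smooth_DERIV smooth_deriv u) auto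
    then obtain w where w: "deriv u z - deriv u x = (z - x) * deriv (deriv u) w" by blast
    have "\<bar>deriv u z - d\<bar> \<le> t * b"
      unfolding d_def w abs_mult using z b[of w] by (intro mult_mono) auto
    then have "t * \<bar>d\<bar> \<le> t * (\<bar>deriv u z\<bar> + t * b)" using t by (intro mult_left_mono) auto
    also have "\<dots> = \<bar>u (x + t) - u x\<bar> + b * t\<^sup>2"
      using t z by (simp add: abs_mult algebra_simps power2_eq_square)
    also have "\<dots> \<le> 2 * a + b * t\<^sup>2" using a[of x] a[of "x + t"] by linarith
    finally show ?thesis .
  qed
  have a0: "0 \<le> a" and b0: "0 \<le> b" using a[of 0] b[of 0] by linarith+
  show ?thesis
  proof (cases "d = 0 \<or> b = 0")
    case True
    have "d = 0"
    proof (rule ccontr)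
      assume d: "d \<noteq> 0"
      then have "b = 0" using True by simp
      with key[of "(2 * a + 1) / \<bar>d\<bar>"] a0 d show False by simp
    qed
    then show ?thesis using a0 b0 by (simp add: d_def)
  next
    case False
    then have "b > 0" using b0 by simp
    \<comment> \<open>This length makes the quadratic term half of the left side.\<close>
    have "\<bar>d\<bar> / (2 * b) * \<bar>d\<bar> \<le> 2 * a + b * (\<bar>d\<bar> / (2 * b))\<^sup>2"
      using False \<open>b > 0\<close> by (intro key) auto
    then have "\<bar>d\<bar>\<^sup>2 / (2 * b) \<le> 2 * a + \<bar>d\<bar>\<^sup>2 / (4 * b)"
      using \<open>b > 0\<close> by (simp add: power2_eq_square field_simps)
    then show ?thesis unfolding d_def[symmetric] using \<open>b > 0\<close> by (simp add: field_simps)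
  qed
qed

text \<open>Landau's inequality to the power \<open>Suc m\<close>, combined with the induction
  hypothesis for \<open>deriv u\<close>, has \<open>nrm (deriv u) ^ m\<close> on both sides;
  cancelling it gives the next case.\<close>

lemma nrm_interp_1:
  "\<exists>c\<ge>0. \<forall>u. smooth u \<and> periodic u \<longrightarrow>
     nrm (deriv u) ^ Suc m \<le> c * nrm u ^ m * nrm ((deriv ^^ Suc m) u)"
proof (induction m)
  case 0
  show ?case by (intro exI[of _ 1]) auto
next
  case (Suc m)
  then obtain c where c: "0 \<le> c" "\<And>u. smooth u \<Longrightarrow> periodic u \<Longrightarrow>
     nrm (deriv u) ^ Suc m \<le> c * nrm u ^ m * nrm ((deriv ^^ Suc m) u)" by blast
  have "nrm (deriv u) ^ Suc (Suc m) \<le> 8 ^ Suc m * c * nrm u ^ Suc m * nrm ((deriv ^^ Suc (Suc m)) u)"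
    if u: "smooth u" "periodic u" for u
  proof -
    define a where "a = nrm u"
    define b where "b = nrm (deriv u)"
    define d where "d = nrm (deriv (deriv u))"
    define e where "e = nrm ((deriv ^^ Suc (Suc m)) u)"
    have su: "smooth (deriv u)" "periodic (deriv u)" "smooth (deriv (deriv u))" "periodic (deriv (deriv u))"
      using u smooth_deriv periodic_deriv by auto
    have nn: "0 \<le> a" "0 \<le> b" "0 \<le> d" "0 \<le> e"
      unfolding a_def b_def d_def e_def using u su nrm_nonneg smooth_derivs periodic_derivs by blast+
    have "d ^ Suc m \<le> c * b ^ m * e"
      using c(2)[OF su(1,2)] by (simp add: b_def d_def e_def funpow_swap1)
    note dm = this
    have "b\<^sup>2 \<le> 8 * a * d"
    proof -
      obtain z where z: "\<And>x. \<bar>deriv u x\<bar> \<le> \<bar>deriv u z\<bar>"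
        using periodic_attains[OF su(2) smooth_continuous[OF su(1)]] by blast
      then have "b \<le> \<bar>deriv u z\<bar>" unfolding b_def by (rule nrm_le)
      moreover have "\<bar>deriv u z\<bar>\<^sup>2 \<le> 8 * a * d"
        unfolding a_def d_def using u su by (intro landau nrm_ge)
      ultimately show ?thesis using nn(2) by (meson order_trans power_mono)
    qed
    then have "(b\<^sup>2) ^ Suc m \<le> (8 * a * d) ^ Suc m" by (intro power_mono) auto
    also have "\<dots> = 8 ^ Suc m * a ^ Suc m * d ^ Suc m" by (simp only: power_mult_distrib)
    also have "\<dots> \<le> 8 ^ Suc m * a ^ Suc m * (c * b ^ m * e)"
      using nn dm by (intro mult_left_mono) auto
    finally have "b ^ m * b ^ Suc (Suc m) \<le> b ^ m * (8 ^ Suc m * c * a ^ Suc m * e)"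
      by (simp add: power2_eq_square power_mult_distrib mult_ac)
    then show ?thesis
      unfolding a_def[symmetric] b_def[symmetric] e_def[symmetric]
      using nn c(1) by (cases "b = 0") auto
  qed
  then show ?case using c(1) by (intro exI[of _ "8 ^ Suc m * c"]) auto
qed

text \<open>The Hadamard-Kolmogorov inequality in scaled form. \<open>nrm_interp_1\<close> bounds
  the first derivative by a multiple of \<open>P * L\<close>; then \<open>deriv u\<close> satisfies
  the same hypotheses one order lower, with this multiple in place of \<open>P\<close>.\<close>

lemma interpolation:
  "\<exists>C\<ge>1. \<forall>u P L. smooth u \<and> periodic u \<and> 0 \<le> P \<and> 0 \<le> L \<and> (\<forall>x. \<bar>u x\<bar> \<le> P)
     \<and> (\<forall>x. \<bar>(deriv ^^ m) u x\<bar> \<le> P * L ^ m) \<longrightarrow> bd m u (C * P) L"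
proof (induction m)
  case 0
  show ?case by (intro exI[of _ 1]) (auto simp: bd_0)
next
  case (Suc m)
  then obtain C where C: "1 \<le> C" "\<And>u P L. smooth u \<Longrightarrow> periodic u \<Longrightarrow> 0 \<le> P \<Longrightarrow> 0 \<le> L \<Longrightarrow>
     (\<And>x. \<bar>u x\<bar> \<le> P) \<Longrightarrow> (\<And>x. \<bar>(deriv ^^ m) u x\<bar> \<le> P * L ^ m) \<Longrightarrow> bd m u (C * P) L" by blast
  obtain c where c: "0 \<le> c" "\<And>u. smooth u \<Longrightarrow> periodic u \<Longrightarrow>
     nrm (deriv u) ^ Suc m \<le> c * nrm u ^ m * nrm ((deriv ^^ Suc m) u)"
    using nrm_interp_1 by blast
  define c' where "c' = max 1 c"
  have "bd (Suc m) u (C * c' * P) L"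
    if u: "smooth u" "periodic u" and P: "0 \<le> P" "0 \<le> L" "\<And>x. \<bar>u x\<bar> \<le> P"
      "\<And>x. \<bar>(deriv ^^ Suc m) u x\<bar> \<le> P * L ^ Suc m" for u P L
  proof -
    have su: "smooth (deriv u)" "periodic (deriv u)" using u smooth_deriv periodic_deriv by auto
    have "nrm (deriv u) ^ Suc m \<le> c * nrm u ^ m * nrm ((deriv ^^ Suc m) u)" using c u by blast
    also have "\<dots> \<le> c * P ^ m * (P * L ^ Suc m)"
      using P u c nrm_nonneg[OF u] nrm_nonneg[OF smooth_derivs periodic_derivs, of u "Suc m"]
      by (intro mult_mono power_mono nrm_le) auto
    also have "\<dots> = c * (P * L) ^ Suc m" by (simp add: power_mult_distrib algebra_simps)
    also have "\<dots> \<le> c' ^ Suc m * (P * L) ^ Suc m"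
    proof -
      have "c \<le> c'" "1 \<le> c'" by (auto simp: c'_def)
      then have "c \<le> c' ^ Suc m" using power_increasing[of 1 "Suc m" c'] by (simp del: power_Suc)
      then show ?thesis using P by (intro mult_right_mono) auto
    qed
    finally have "nrm (deriv u) ^ Suc m \<le> (c' * (P * L)) ^ Suc m" by (simp only: power_mult_distrib)
    then have "nrm (deriv u) \<le> c' * (P * L)"
      by (rule power_le_imp_le_base) (use P in \<open>auto simp: c'_def\<close>)
    then have d1: "\<bar>deriv u x\<bar> \<le> c' * (P * L)" for x using nrm_ge[OF su, of x] by linarith
    have "P * L * L ^ m \<le> c' * (P * L) * L ^ m"
      using P mult_right_mono[of 1 c' "P * L * L ^ m"] by (simp add: c'_def mult.assoc)
    then have "bd m (deriv u) (C * (c' * (P * L))) L"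
      using P(4) P d1 su by (intro C(2)) (auto simp: c'_def funpow_swap1 mult.assoc intro: order_trans)
    moreover have "P \<le> C * c' * P"
      using mult_right_mono[of 1 "C * c'" P] C(1) P mult_mono[of 1 C 1 c'] by (simp add: c'_def)
    ultimately show ?thesis using P(3) by (auto simp: bd_Suc mult.assoc intro: order_trans)
  qed
  then show ?case using C(1) mult_mono[of 1 C 1 c'] by (intro exI[of _ "C * c'"]) (auto simp: c'_def)
qed

subsection \<open>Riccati equation\<close>

text \<open>At the first time \<open>z\<close> with \<open>y z \<le> c\<close> the function would
  have been increasing on the whole interval before \<open>z\<close>, although it started above
  \<open>c\<close>.\<close>

lemma stays_above:
  fixes y y' :: "real \<Rightarrow> real"
  assumes d: "\<And>x. x \<in> {a..b} \<Longrightarrow> (y has_real_derivative y' x) (at x)"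
    and s: "y a > c" and p: "\<And>x. x \<in> {a..b} \<Longrightarrow> y x \<ge> c \<Longrightarrow> y' x > 0" and x: "x \<in> {a..b}"
  shows "y x > c"
proof (rule ccontr)
  assume "\<not> y x > c"
  define S where "S = {z \<in> {a..x}. y z \<le> c}"
  have cont: "continuous_on {a..x} y"
    using DERIV_isCont[OF d] x by (auto intro!: continuous_at_imp_continuous_on)
  then have "closed S" unfolding S_def
    by (rule continuous_on_closed_Collect_le) (auto intro: continuous_on_const)
  have "x \<in> S" using x \<open>\<not> y x > c\<close> by (auto simp: S_def)
  define z where "z = Inf S"
  have bb: "bdd_below S" by (auto simp: S_def intro: bdd_belowI[of _ a])
  have "z \<in> S" unfolding z_def using \<open>closed S\<close> \<open>x \<in> S\<close> bb by (intro closed_contains_Inf) auto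
  then have z: "a \<le> z" "z \<le> x" "y z \<le> c" by (auto simp: S_def)
  then have "a < z" using s by (cases "a = z") auto
  have "y a < y z"
  proof (rule DERIV_pos_imp_increasing_open[OF \<open>a < z\<close>])
    fix w assume w: "a < w" "w < z"
    then have "w \<notin> S" using cInf_lower[OF _ bb, of w] by (auto simp: z_def)
    with w z x show "\<exists>D. (y has_real_derivative D) (at w) \<and> D > 0"
      using d[of w] p[of w] by (intro exI[of _ "y' w"]) (auto simp: S_def)
  next
    show "continuous_on {a..z} y" using cont z by (auto intro: continuous_on_subset)
  qed
  with s z show False by linarith
qed

text \<open>Above \<open>4 / L\<close> the term \<open>y\<^sup>2 / 2\<close> dominates the error, so
  \<open>1 / y\<close> falls at rate at least \<open>1 / 4\<close> and would reach 0 within the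
  length \<open>L\<close>: the solution would blow up.\<close>

lemma riccati_pos:
  fixes y y' :: "real \<Rightarrow> real"
  assumes d: "\<And>x. (y has_real_derivative y' x) (at x)" and L: "L > 0"
    and r: "\<And>x. x \<in> {a..a + L} \<Longrightarrow> \<bar>y' x - (y x)\<^sup>2 / 2\<bar> \<le> 1 / L\<^sup>2"
  shows "y a \<le> 4 / L"
proof (rule ccontr)
  assume "\<not> y a \<le> 4 / L"
  then have ya: "y a > 4 / L" by simp
  have *: "y' x \<ge> (y x)\<^sup>2 / 4 \<and> y' x > 0" if "x \<in> {a..a + L}" "y x \<ge> 4 / L" for x
  proof -
    have "16 / L\<^sup>2 \<le> (y x)\<^sup>2" using power_mono[OF that(2), of 2] L by (simp add: power_divide)
    then have "(y x)\<^sup>2 \<ge> 16 * (1 / L\<^sup>2)" by simp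
    moreover have "1 / L\<^sup>2 > 0" using L by simp
    ultimately show ?thesis using r[OF that(1)] unfolding abs_le_iff by linarith
  qed
  have above: "y x > 4 / L" if "x \<in> {a..a + L}" for x
  proof (rule stays_above[of a "a + L" y y'])
    show "y' z > 0" if "z \<in> {a..a + L}" "4 / L \<le> y z" for z using *[OF that] by blast
  qed (rule d ya that)+
  have pos: "y x > 0" if "x \<in> {a..a + L}" for x using above[OF that] divide_pos_pos[of 4 L] L by linarith
  define g where "g x = 1 / y x + (x - a) / 4" for x
  have "g (a + L) \<le> g a"
  proof (rule DERIV_nonpos_imp_nonincreasing[of a "a + L" g])
    fix x assume x: "a \<le> x" "x \<le> a + L"
    then have y: "y x > 0" "y' x \<ge> (y x)\<^sup>2 / 4" using pos[of x] *[of x] above[of x] by auto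
    have "(g has_real_derivative - (y' x) / (y x)\<^sup>2 + 1 / 4) (at x)"
      unfolding g_def using y(1) by (auto intro!: derivative_eq_intros d simp: power2_eq_square)
    moreover have "- (y' x) / (y x)\<^sup>2 + 1 / 4 \<le> 0" using y by (simp add: field_simps)
    ultimately show "\<exists>z. (g has_real_derivative z) (at x) \<and> z \<le> 0" by blast
  qed (use L in auto)
  then have "1 / y (a + L) + L / 4 \<le> 1 / y a" by (simp add: g_def)
  moreover have "1 / y a < L / 4" using ya L pos[of a] by (simp add: field_simps)
  moreover have "1 / y (a + L) > 0" using pos[of "a + L"] L by simp
  ultimately show False by linarith
qed

text \<open>The reflection \<open>- y (- x)\<close> satisfies the same inequality, which gives the
  bound from below.\<close>

lemma riccati:
  fixes y y' :: "real \<Rightarrow> real"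
  assumes d: "\<And>x. (y has_real_derivative y' x) (at x)" and L: "L > 0"
    and r: "\<And>x. \<bar>x - a\<bar> \<le> L \<Longrightarrow> \<bar>y' x - (y x)\<^sup>2 / 2\<bar> \<le> 1 / L\<^sup>2"
  shows "\<bar>y a\<bar> \<le> 4 / L"
proof -
  have "y a \<le> 4 / L" using L by (intro riccati_pos[OF d] r) auto
  moreover have "- y (- (- a)) \<le> 4 / L"
  proof (rule riccati_pos[of "\<lambda>x. - y (- x)" "\<lambda>x. y' (- x)" L "- a"])
    show "((\<lambda>x. - y (- x)) has_real_derivative y' (- x)) (at x)" for x
    proof -
      have "((\<lambda>x. y (- x)) has_real_derivative y' (- x) * - 1) (at x)"
        by (rule DERIV_chain2[of y]) (auto intro!: d derivative_eq_intros)
      then show ?thesis using DERIV_minus by fastforce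
    qed
    show "\<bar>y' (- x) - (- y (- x))\<^sup>2 / 2\<bar> \<le> 1 / L\<^sup>2" if "x \<in> {- a..- a + L}" for x
      using r[of "- x"] that by auto
  qed (use L in auto)
  ultimately show ?thesis by auto
qed

section \<open>Smooth linearization for the golden rotation number\<close>

text \<open>The quotients \<open>fib n / fib (n + 1)\<close> are the convergents of the golden mean, so the
  alternation of signs says that the rotation number is the golden mean.\<close>

locale golden =
  fixes f :: "real \<Rightarrow> real"
  assumes sm: "smooth f" and shift: "\<And>x. f (x + 1) = f x + 1" and pos: "\<And>x. deriv f x > 0"
    and alt: "\<And>n x. (-1) ^ n * ((f ^^ fib (Suc n)) x - real (fib n) - x) > 0"
begin

text \<open>The index is shifted so that \<open>ret 0 x = f x\<close> and
  \<open>ret 1 x = f x - 1\<close>, which lie on opposite sides of \<open>x\<close> at distances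
  adding up to 1.\<close>

definition q :: "nat \<Rightarrow> nat" where "q n = fib (Suc n)"

definition ret :: "nat \<Rightarrow> real \<Rightarrow> real" where
  "ret n x = (f ^^ q n) x - real (fib n)"

definition gap :: "nat \<Rightarrow> real \<Rightarrow> real" where
  "gap n x = \<bar>ret n x - x\<bar>"

lemma q_simps [simp]: "q 0 = 1" "q (Suc 0) = 1" "q (Suc (Suc n)) = q (Suc n) + q n"
  by (simp_all add: q_def)

lemma q_pos: "q n > 0"
  by (induction n rule: fib.induct) auto

lemma q_mono: "q n \<le> q (Suc n)"
  by (cases n) auto

lemma q_growth: "(3 / 2) ^ n \<le> 2 * real (q n)"
proof (induction n rule: fib.induct)
  case (3 n)
  have "(3 / 2) ^ Suc (Suc n) = 9 / 4 * (3 / 2 :: real) ^ n" by simp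
  also have "\<dots> \<le> (3 / 2) ^ n + (3 / 2) ^ Suc n" by simp
  finally show ?case using 3 by (simp del: power_Suc)
qed auto

lemma it_smooth: "smooth (f ^^ i)"
  by (rule smooth_funpow[OF sm])

lemma it_shift: "(f ^^ i) (x + of_int k) = (f ^^ i) x + of_int k"
proof (induction i)
  case (Suc i)
  then show ?case using shift_int[of f 1, OF shift] by simp
qed simp

lemma it_shift1: "(f ^^ i) (x + 1) = (f ^^ i) x + 1"
  using it_shift[of i x 1] by simp

lemma it_deriv_Suc: "deriv (f ^^ Suc i) x = deriv f ((f ^^ i) x) * deriv (f ^^ i) x"
proof -
  have "((f ^^ Suc i) has_real_derivative deriv f ((f ^^ i) x) * deriv (f ^^ i) x) (at x)"
    unfolding funpow.simps comp_def
    by (rule DERIV_chain2[of f]) (intro smooth_DERIV sm it_smooth)+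
  then show ?thesis by (rule DERIV_imp_deriv)
qed

lemma it_deriv_pos: "deriv (f ^^ i) x > 0"
proof (induction i)
  case 0
  have "((f ^^ 0) has_real_derivative 1) (at x)" by (simp add: id_def)
  then show ?case by (simp add: DERIV_imp_deriv)
next
  case (Suc i)
  then show ?case by (simp add: it_deriv_Suc pos del: funpow.simps)
qed

lemma it_mono: "x < y \<Longrightarrow> (f ^^ i) x < (f ^^ i) y"
  by (rule DERIV_pos_imp_increasing[of x y]) (use it_deriv_pos smooth_DERIV[OF it_smooth] in blast)+

lemma it_mono_le: "x \<le> y \<Longrightarrow> (f ^^ i) x \<le> (f ^^ i) y"
  using it_mono[of x y i] by (cases "x = y") auto

lemma deriv_it_int: "deriv (f ^^ i) (x + of_int k) = deriv (f ^^ i) x"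
proof -
  have "deriv (\<lambda>x. (f ^^ i) (x + of_int k)) = (\<lambda>x. deriv (f ^^ i) (x + of_int k))"
    using derivs_shift[OF it_smooth, of 1] by simp
  moreover have "(\<lambda>x. (f ^^ i) (x + of_int k)) = (\<lambda>x. (f ^^ i) x + of_int k)"
    by (rule ext) (rule it_shift)
  ultimately show ?thesis using deriv_add_smooth[OF it_smooth[of i] smooth_const[of "of_int k"]]
    by (metis add.right_neutral deriv_const)
qed

subsection \<open>Return maps and their gaps\<close>

lemma ret_comp: "ret (Suc (Suc n)) x = ret (Suc n) (ret n x)"
  using it_shift[of "q (Suc n)" "(f ^^ q n) x" "- int (fib n)"]
  by (simp add: ret_def funpow_add)

lemma it_ret: "(f ^^ i) (ret n x) = ret n ((f ^^ i) x)"
  using it_shift[of i "(f ^^ q n) x" "- int (fib n)"]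
  by (simp add: ret_def) (metis add.commute comp_apply funpow_add)

lemma ret_shift: "ret n (x + of_int k) = ret n x + of_int k"
  by (simp add: ret_def it_shift)

lemma ret_commute: "ret n (ret k x) = ret k (ret n x)"
  using it_ret[of "q n" k x] ret_shift[of k "(f ^^ q n) x" "- int (fib n)"]
  by (simp add: ret_def[of n])

lemma ret_mono_le: "x \<le> y \<Longrightarrow> ret n x \<le> ret n y"
  unfolding ret_def using it_mono_le by simp

lemma ret_alt: "(-1) ^ n * (ret n x - x) > 0"
  using alt[of n x] by (simp add: ret_def q_def)

lemma gap_eq: "gap n x = (-1) ^ n * (ret n x - x)"
  using ret_alt[of n x] by (cases "even n") (auto simp: gap_def)

lemma gap_pos: "gap n x > 0"
  using ret_alt by (simp add: gap_eq)

lemma gap_int: "gap n (x + of_int k) = gap n x"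
  by (simp add: gap_def ret_shift)

lemma gap_ret: "gap n (ret k x) = gap n ((f ^^ q k) x)"
  using gap_int[of n "(f ^^ q k) x" "- int (fib k)"] by (simp add: ret_def[of k])

text \<open>Since \<open>ret (n + 2)\<close> is composed of \<open>ret n\<close> and
  \<open>ret (n + 1)\<close>, the point \<open>ret (n + 2) x\<close> cuts the interval from
  \<open>x\<close> to \<open>ret n x\<close> into a gap of level \<open>n + 2\<close> at
  \<open>x\<close> and one of level \<open>n + 1\<close> at \<open>ret n x\<close>. The comparisons
  between levels below all rest on this identity.\<close>

lemma gap_split: "gap n x = gap (Suc (Suc n)) x + gap (Suc n) (ret n x)"
  by (simp add: gap_eq ret_comp algebra_simps)

lemma gap_it: "gap n ((f ^^ i) x) = \<bar>(f ^^ i) (ret n x) - (f ^^ i) x\<bar>"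
  by (simp add: gap_def it_ret)

text \<open>These intervals form the dynamical partition of the circle. Cutting each level
  \<open>n\<close> interval by \<open>gap_split\<close> and regrouping gives the partition of the
  next level, so the total length does not change.\<close>

lemma total_length:
  "(\<Sum>i<q (Suc n). gap n ((f ^^ i) x)) + (\<Sum>i<q n. gap (Suc n) ((f ^^ i) x)) = 1"
proof (induction n)
  case 0
  show ?case by (simp add: gap_eq ret_def)
next
  case (Suc n)
  have "gap n ((f ^^ i) x) = gap (Suc (Suc n)) ((f ^^ i) x) + gap (Suc n) ((f ^^ (i + q n)) x)" for i
    unfolding gap_split[of n] gap_ret by (metis add.commute comp_apply funpow_add)
  then have "(\<Sum>i<q (Suc n). gap n ((f ^^ i) x)) + (\<Sum>i<q n. gap (Suc n) ((f ^^ i) x))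
     = (\<Sum>i<q (Suc n). gap (Suc (Suc n)) ((f ^^ i) x))
       + ((\<Sum>i<q n. gap (Suc n) ((f ^^ i) x)) + (\<Sum>i<q (Suc n). gap (Suc n) ((f ^^ (i + q n)) x)))"
    by (simp add: sum.distrib)
  also have "(\<Sum>i<q n. gap (Suc n) ((f ^^ i) x)) + (\<Sum>i<q (Suc n). gap (Suc n) ((f ^^ (i + q n)) x))
      = (\<Sum>i<q (Suc (Suc n)). gap (Suc n) ((f ^^ i) x))"
    using sum.shift_bounds_nat_ivl[of "\<lambda>i. gap (Suc n) ((f ^^ i) x)" 0 "q n" "q (Suc n)"]
      sum.atLeastLessThan_concat[of 0 "q n" "q (Suc n) + q n" "\<lambda>i. gap (Suc n) ((f ^^ i) x)"]
    by (simp add: lessThan_atLeast0)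
  finally show ?case using Suc by simp
qed

lemma sum_gap_le: "(\<Sum>i<q (Suc n). gap n ((f ^^ i) x)) \<le> 1"
  using total_length[of n x] sum_nonneg[of "{..<q n}" "\<lambda>i. gap (Suc n) ((f ^^ i) x)"]
  by (simp add: less_imp_le[OF gap_pos])

definition seg :: "nat \<Rightarrow> real \<Rightarrow> real set" where
  "seg n x = {min x (ret n x)..max x (ret n x)}"

lemma seg_it: "z \<in> seg n x \<Longrightarrow> (f ^^ i) z \<in> {min ((f ^^ i) x) ((f ^^ i) (ret n x))..max ((f ^^ i) x) ((f ^^ i) (ret n x))}"
  unfolding seg_def using it_mono_le[of x z i] it_mono_le[of z x i]
    it_mono_le[of "ret n x" z i] it_mono_le[of z "ret n x" i] by (auto simp: min_def max_def split: if_splits)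

lemma seg_ends [simp]: "x \<in> seg n x" "ret n x \<in> seg n x"
  by (auto simp: seg_def)

lemma ret_surj_seg:
  assumes "y \<in> {min (ret n x) (ret n z)..max (ret n x) (ret n z)}"
  shows "\<exists>w \<in> {min x z..max x z}. ret n w = y"
proof -
  have c: "continuous_on A (ret n)" for A
    unfolding ret_def by (intro continuous_intros smooth_continuous it_smooth)
  show ?thesis
  proof (cases "x \<le> z")
    case True
    then show ?thesis using IVT'[of "ret n" x y z, OF _ _ True c] assms ret_mono_le[OF True, of n] by auto
  next
    case False
    then show ?thesis using IVT'[of "ret n" z y x, OF _ _ _ c] assms ret_mono_le[of z x n] by auto
  qed
qed

lemma seg_split:
  assumes "y \<in> seg n x"
  shows "y \<in> seg (Suc (Suc n)) x \<or> (\<exists>w\<in>seg (Suc n) x. y = ret n w)"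
proof -
  have e: "ret (Suc (Suc n)) x = ret n (ret (Suc n) x)"
    by (simp add: ret_comp ret_commute)
  show ?thesis
  proof (cases "y \<in> seg (Suc (Suc n)) x")
    case False
    have a: "(-1) ^ n * (ret (Suc (Suc n)) x - x) > 0" "(-1) ^ n * (ret n x - x) > 0"
      using ret_alt[of "Suc (Suc n)" x] ret_alt[of n x] by simp_all
    have "y \<in> {min (ret n x) (ret (Suc (Suc n)) x)..max (ret n x) (ret (Suc (Suc n)) x)}"
      using False assms a by (cases "even n") (auto simp: seg_def)
    then have "\<exists>w\<in>seg (Suc n) x. ret n w = y"
      unfolding e seg_def by (rule ret_surj_seg)
    then show ?thesis by auto
  qed simp
qed

text \<open>The same refinement of the dynamical partition, now followed for points instead of
  lengths.\<close>

lemma cover: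
  "(\<exists>i<q (Suc n). \<exists>y\<in>seg n z. \<exists>k::int. x = (f ^^ i) y + of_int k) \<or>
   (\<exists>i<q n. \<exists>y\<in>seg (Suc n) z. \<exists>k::int. x = (f ^^ i) y + of_int k)"
proof (induction n)
  case 0
  define k where "k = \<lfloor>x - (f z - 1)\<rfloor>"
  have "x - of_int k \<in> {f z - 1..f z}" unfolding k_def by (simp add: le_floor_iff) linarith
  moreover have "ret 0 z = f z" "ret (Suc 0) z = f z - 1" by (simp_all add: ret_def)
  moreover have "z < ret 0 z" "ret (Suc 0) z < z" using ret_alt[of 0 z] ret_alt[of 1 z] by auto
  ultimately have "x - of_int k \<in> seg 0 z \<or> x - of_int k \<in> seg (Suc 0) z" by (auto simp: seg_def)
  then show ?case by (auto intro!: exI[of _ k] bexI[of _ "x - of_int k"])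
next
  case (Suc n)
  then show ?case
  proof (elim disjE exE bexE conjE)
    fix i y k assume i: "i < q (Suc n)" and y: "y \<in> seg n z" and x: "x = (f ^^ i) y + real_of_int k"
    from seg_split[OF y] show ?thesis
    proof (elim disjE bexE)
      assume "y \<in> seg (Suc (Suc n)) z"
      then show ?thesis using i x by blast
    next
      fix w assume w: "w \<in> seg (Suc n) z" "y = ret n w"
      have "x = (f ^^ (i + q n)) w + of_int (k - int (fib n))"
        using it_shift[of i "(f ^^ q n) w" "- int (fib n)"] w x by (simp add: ret_def funpow_add)
      moreover have "i + q n < q (Suc (Suc n))" using i by simp
      ultimately show ?thesis using w by blast
    qed
  next
    fix i y k assume i: "i < q n" and y: "y \<in> seg (Suc n) z" and x: "x = (f ^^ i) y + real_of_int k"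
    then have "i < q (Suc (Suc n))" by simp
    then show ?thesis using x y by blast
  qed
qed

subsection \<open>Distortion\<close>

definition el :: "nat \<Rightarrow> real \<Rightarrow> real" where "el i x = ln (deriv (f ^^ i) x)"

lemma exp_el: "exp (el i x) = deriv (f ^^ i) x"
  by (simp add: el_def it_deriv_pos)

lemma el_0 [simp]: "el 0 x = 0"
proof -
  have "((f ^^ 0) has_real_derivative 1) (at x)" by (simp add: id_def)
  then show ?thesis by (simp add: el_def DERIV_imp_deriv)
qed

lemma el_Suc: "el (Suc i) x = el 1 ((f ^^ i) x) + el i x"
proof -
  have "el 1 y = ln (deriv f y)" for y by (simp add: el_def comp_def)
  then show ?thesis
    unfolding el_def[of "Suc i"] el_def[of i] it_deriv_Suc by (simp add: ln_mult_pos pos it_deriv_pos)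
qed

lemma el_sum: "el i x = (\<Sum>j<i. el 1 ((f ^^ j) x))"
  by (induction i) (simp_all add: el_Suc add.commute del: funpow.simps One_nat_def)

lemma el_add: "el (i + j) x = el i ((f ^^ j) x) + el j x"
proof (induction i)
  case (Suc i)
  have "el (Suc i + j) x = el 1 ((f ^^ (i + j)) x) + el (i + j) x" using el_Suc[of "i + j"] by simp
  then show ?case using Suc el_Suc[of i "(f ^^ j) x"] by (simp add: funpow_add)
qed simp

lemma el_int: "el i (x + of_int k) = el i x"
  by (simp add: el_def deriv_it_int)

text \<open>The chain rule for the iterate \<open>i + q n\<close> in both orders. It turns the
  change of \<open>el (q n)\<close> along an orbit into the change of \<open>el i\<close> across one
  gap, where distortion estimates apply.\<close>

lemma el_commute: "el i (ret n y) - el i y = el (q n) ((f ^^ i) y) - el (q n) y"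
proof -
  have "el i (ret n y) = el i ((f ^^ q n) y)"
    using el_int[of i "(f ^^ q n) y" "- int (fib n)"] by (simp add: ret_def)
  moreover have "el (i + q n) y = el (q n + i) y" by (simp add: add.commute)
  ultimately show ?thesis using el_add[of i "q n" y] el_add[of "q n" i y] by linarith
qed

text \<open>The nonlinearity, or pre-Schwarzian derivative, of the iterate.\<close>

definition yy :: "nat \<Rightarrow> real \<Rightarrow> real" where
  "yy i x = deriv (deriv (f ^^ i)) x / deriv (f ^^ i) x"

lemma el_deriv: "(el i has_real_derivative yy i x) (at x)"
  unfolding el_def yy_def using it_deriv_pos[of i x]
  by (auto intro!: derivative_eq_intros smooth_DERIV smooth_deriv it_smooth)

lemma yy_smooth: "smooth (yy i)"
  unfolding yy_def using less_imp_neq[OF it_deriv_pos[of i], symmetric]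
  by (intro smooth_divide smooth_deriv it_smooth)

lemma yy_periodic: "periodic (yy i)"
proof -
  have "periodic (deriv (f ^^ i))" using deriv_it_int[of i _ 1] by (simp add: periodic_def)
  then show ?thesis
    using periodic_deriv[of "deriv (f ^^ i)"] it_smooth smooth_deriv
    by (auto simp: yy_def periodic_def)
qed

definition V :: real where "V = max 1 (nrm (yy 1))"

lemma el_1_lip: "\<bar>el 1 x - el 1 y\<bar> \<le> V * \<bar>x - y\<bar>"
proof -
  have "norm (el 1 x - el 1 y) \<le> V * norm (x - y)"
  proof (rule field_differentiable_bound[of UNIV "el 1" "yy 1"])
    show "norm (yy 1 z) \<le> V" for z
      using nrm_ge[OF yy_smooth yy_periodic, of 1 z] by (simp add: V_def)
  qed (auto intro: el_deriv has_field_derivative_at_within)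
  then show ?thesis by simp
qed

text \<open>Denjoy's argument: the first \<open>q (Suc n)\<close> images of a level \<open>n\<close>
  interval have total length at most 1, so the Lipschitz constant \<open>V\<close> of the
  logarithmic derivative of \<open>f\<close> bounds the sum of its oscillations over them.\<close>

lemma distortion:
  assumes "i \<le> q (Suc n)" "z \<in> seg n x" "w \<in> seg n x"
  shows "\<bar>el i z - el i w\<bar> \<le> V"
proof -
  have "\<bar>el i z - el i w\<bar> \<le> (\<Sum>j<i. \<bar>el 1 ((f ^^ j) z) - el 1 ((f ^^ j) w)\<bar>)"
    unfolding el_sum[of i] sum_subtractf[symmetric] by (rule sum_abs)
  also have "\<dots> \<le> (\<Sum>j<i. V * gap n ((f ^^ j) x))"
  proof (rule sum_mono)
    fix j
    have "\<bar>(f ^^ j) z - (f ^^ j) w\<bar> \<le> gap n ((f ^^ j) x)"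
      using seg_it[OF assms(2), of j] seg_it[OF assms(3), of j] by (auto simp: gap_it)
    then have "V * \<bar>(f ^^ j) z - (f ^^ j) w\<bar> \<le> V * gap n ((f ^^ j) x)"
      by (intro mult_left_mono) (auto simp: V_def)
    then show "\<bar>el 1 ((f ^^ j) z) - el 1 ((f ^^ j) w)\<bar> \<le> V * gap n ((f ^^ j) x)"
      using el_1_lip[of "(f ^^ j) z" "(f ^^ j) w"] by linarith
  qed
  also have "\<dots> \<le> (\<Sum>j<q (Suc n). V * gap n ((f ^^ j) x))"
    using assms(1) less_imp_le[OF gap_pos] by (intro sum_mono2) (auto simp: V_def intro!: mult_nonneg_nonneg)
  also have "\<dots> \<le> V * 1"
    unfolding sum_distrib_left[symmetric] using sum_gap_le[of n x] by (intro mult_left_mono) (auto simp: V_def)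
  finally show ?thesis by simp
qed

lemma ret_deriv: "(ret n has_real_derivative deriv (f ^^ q n) x) (at x)"
  unfolding ret_def by (auto intro!: derivative_eq_intros smooth_DERIV it_smooth)

lemma el_q_zero: "\<exists>z. el (q n) z = 0"
proof -
  have "\<exists>z. 0 < z \<and> z < 1 \<and> ret n 1 - ret n 0 = (1 - 0) * deriv (f ^^ q n) z"
    by (intro MVT2 ret_deriv) auto
  then obtain z where "ret n 1 - ret n 0 = deriv (f ^^ q n) z" by auto
  moreover have "ret n 1 = ret n 0 + 1" using ret_shift[of n 0 1] by simp
  ultimately show ?thesis by (auto simp: el_def intro!: exI[of _ z])
qed

text \<open>Starting at a point \<open>z\<close> where \<open>el (q n)\<close> vanishes,
  \<open>cover\<close> reaches \<open>x\<close> in two moves, each at cost \<open>c\<close>: within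
  an interval adjacent to \<open>z\<close>, and then along an orbit by \<open>el_commute\<close>.
  Applied first with Denjoy's constant and later with a small one.\<close>

lemma el_q_spread:
  assumes c1: "\<And>i y. i < q (Suc n) \<Longrightarrow> \<bar>el i (ret n y) - el i y\<bar> \<le> c"
    and c2: "\<And>z y. y \<in> seg n z \<or> y \<in> seg (Suc n) z \<Longrightarrow> \<bar>el (q n) y - el (q n) z\<bar> \<le> c"
  shows "\<bar>el (q n) x\<bar> \<le> 2 * c"
proof -
  obtain z where z: "el (q n) z = 0" using el_q_zero by blast
  obtain i y k where i: "i < q (Suc n)" "y \<in> seg n z \<or> y \<in> seg (Suc n) z" "x = (f ^^ i) y + of_int k"
    using cover[of n z x] q_mono[of n] by (metis less_le_trans)
  have "el (q n) x = el (q n) ((f ^^ i) y)" using i(3) by (simp add: el_int)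
  then show ?thesis using el_commute[of i n y] c1[OF i(1), of y] c2[OF i(2)] z by linarith
qed

definition B :: real where "B = exp (2 * V)"

lemma V_ge: "V \<ge> 1" by (simp add: V_def)

lemma B_ge: "B \<ge> 1"
  using V_ge unfolding B_def by simp

lemma el_q_le: "\<bar>el (q n) x\<bar> \<le> 2 * V"
proof (rule el_q_spread)
  show "\<bar>el i (ret n y) - el i y\<bar> \<le> V" if "i < q (Suc n)" for i y
    using that by (intro distortion[of _ n _ y]) auto
  show "\<bar>el (q n) y - el (q n) z\<bar> \<le> V" if "y \<in> seg n z \<or> y \<in> seg (Suc n) z" for y z
    using that distortion[of "q n" n y z z] distortion[of "q n" "Suc n" y z z] q_mono[of n] by auto
qed

lemma ret_deriv_bounds: "deriv (f ^^ q n) x \<le> B" "1 / B \<le> deriv (f ^^ q n) x"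
  using el_q_le[of n x] exp_el[of "q n" x] unfolding B_def exp_minus[symmetric] inverse_eq_divide[symmetric]
  by (metis abs_le_iff exp_le_cancel_iff, metis abs_le_iff exp_le_cancel_iff minus_le_iff)

lemma ret_diff_bounds:
  assumes "x \<le> y"
  shows "ret n y - ret n x \<le> B * (y - x)" "(y - x) / B \<le> ret n y - ret n x"
proof -
  have "ret n y - ret n x \<le> B * (y - x) \<and> (y - x) / B \<le> ret n y - ret n x"
  proof (cases "x = y")
    case False
    then have "\<exists>z. x < z \<and> z < y \<and> ret n y - ret n x = (y - x) * deriv (f ^^ q n) z"
      using assms by (intro MVT2 ret_deriv) auto
    then obtain z where z: "ret n y - ret n x = (y - x) * deriv (f ^^ q n) z" by blast
    show ?thesis
      using mult_left_mono[OF ret_deriv_bounds(1)[of n z], of "y - x"]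
        mult_left_mono[OF ret_deriv_bounds(2)[of n z], of "y - x"] assms
      by (simp add: z mult.commute)
  qed simp
  then show "ret n y - ret n x \<le> B * (y - x)" "(y - x) / B \<le> ret n y - ret n x" by auto
qed

lemma gap_ret_bounds: "gap k (ret n x) \<le> B * gap k x" "gap k x / B \<le> gap k (ret n x)"
proof -
  have "gap k (ret n x) = \<bar>ret n (ret k x) - ret n x\<bar>" by (simp add: gap_def ret_commute)
  then show "gap k (ret n x) \<le> B * gap k x" "gap k x / B \<le> gap k (ret n x)"
    using ret_diff_bounds[of x "ret k x" n] ret_diff_bounds[of "ret k x" x n] ret_mono_le[of x "ret k x" n]
      ret_mono_le[of "ret k x" x n]
    unfolding gap_def by (auto simp: abs_if split: if_splits)
qed

lemma gap_Suc_le: "gap (Suc n) x \<le> B * gap n x"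
proof -
  have "gap (Suc n) x / B \<le> gap n x"
    using gap_ret_bounds(2)[of "Suc n" x n] gap_split[of n x] gap_pos[of "Suc (Suc n)" x] by linarith
  then show ?thesis using B_ge by (simp add: field_simps)
qed

text \<open>Bounded geometry. This reverse comparison needs that \<open>ret (n + 2)\<close> contains
  \<open>ret (n + 1)\<close> only once, that is, that the partial quotients of the golden mean are
  all 1.\<close>

lemma gap_le_Suc: "gap n x \<le> 2 * B * gap (Suc n) x"
  using gap_split[of n x] gap_ret_bounds(1)[of "Suc n" n x] gap_Suc_le[of "Suc n" x] by linarith

text \<open>In \<open>gap_split\<close> the piece cut off is at least \<open>1 / B\<^sup>2\<close>
  times the piece of level \<open>n + 2\<close> that is kept; \<open>\<kappa>\<close> is the
  resulting upper bound for the proportion kept.\<close>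

definition \<kappa> :: real where "\<kappa> = 1 / (1 + 1 / B\<^sup>2)"

lemma \<kappa>_pos: "\<kappa> > 0"
  using B_ge by (auto simp: \<kappa>_def intro!: divide_pos_pos add_pos_nonneg)

lemma \<kappa>_lt_1: "\<kappa> < 1"
proof -
  have "1 / B\<^sup>2 > 0" using B_ge by simp
  then have "0 < 1 + 1 / B\<^sup>2" "1 < 1 + 1 / B\<^sup>2" by linarith+
  then show ?thesis unfolding \<kappa>_def by (subst divide_less_eq_1_pos)
qed



lemma gap_decay: "gap (Suc (Suc n)) x \<le> \<kappa> * gap n x"
proof -
  have "gap (Suc (Suc n)) x / B \<le> gap (Suc n) x"
    using gap_Suc_le[of "Suc n" x] B_ge by (simp add: field_simps)
  then have "gap (Suc (Suc n)) x / B / B \<le> gap (Suc n) x / B"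
    using B_ge by (intro divide_right_mono) auto
  then have "gap (Suc (Suc n)) x + gap (Suc (Suc n)) x / B\<^sup>2 \<le> gap n x"
    using gap_split[of n x] gap_ret_bounds(2)[of "Suc n" x n] by (simp add: power2_eq_square)
  then have "gap (Suc (Suc n)) x * (1 + 1 / B\<^sup>2) \<le> gap n x" by (simp add: algebra_simps)
  moreover have "1 + 1 / B\<^sup>2 > 0" using B_ge by (simp add: add_pos_nonneg)
  ultimately show ?thesis by (simp add: \<kappa>_def field_simps)
qed

lemma gap_decay_iter: "gap (n + k) x \<le> \<kappa> ^ (k div 2) * (B * gap n x)"
proof (induction k rule: induct_nat_012)
  case 0
  then show ?case using B_ge gap_pos[of n x] mult_right_mono[of 1 B "gap n x"] by simp
next
  case 1
  then show ?case using gap_Suc_le[of n x] by simp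
next
  case (ge2 k)
  have "gap (n + Suc (Suc k)) x \<le> \<kappa> * gap (n + k) x" using gap_decay[of "n + k" x] by simp
  also have "\<dots> \<le> \<kappa> * (\<kappa> ^ (k div 2) * (B * gap n x))"
    using ge2(1) \<kappa>_pos by (intro mult_left_mono) auto
  finally show ?case by (simp add: mult.assoc)
qed

lemma gap_0_le: "gap 0 x \<le> 1"
  using total_length[of 0 x] gap_pos[of "Suc 0" x] by simp

lemma gap_le: "gap n x \<le> B * \<kappa> ^ (n div 2)"
proof -
  have "gap (0 + n) x \<le> \<kappa> ^ (n div 2) * (B * gap 0 x)" by (rule gap_decay_iter)
  also have "\<dots> \<le> \<kappa> ^ (n div 2) * (B * 1)"
    using gap_0_le[of x] \<kappa>_pos B_ge by (intro mult_left_mono) auto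
  finally show ?thesis by (simp add: mult.commute)
qed

lemma gap_le_iter: "gap n x \<le> (2 * B) ^ k * gap (n + k) x"
proof (induction k)
  case (Suc k)
  have "(2 * B) ^ k * gap (n + k) x \<le> (2 * B) ^ k * (2 * B * gap (Suc (n + k)) x)"
    using B_ge by (intro mult_left_mono gap_le_Suc) auto
  with Suc show ?case by (simp add: mult_ac)
qed simp

text \<open>Moving the base point from \<open>x\<close> to \<open>z\<close> replaces the piece
  between \<open>x\<close> and \<open>z\<close> by its image under \<open>ret n\<close>, comparable
  up to \<open>B\<close>; the piece between \<open>z\<close> and \<open>ret n x\<close> is common to
  both gaps.\<close>

lemma gap_seg:
  assumes "z \<in> seg n x"
  shows "gap n x \<le> B * gap n z"
proof -
  have "\<bar>z - x\<bar> / B \<le> \<bar>ret n z - ret n x\<bar>"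
    using ret_diff_bounds(2)[of x z n] ret_diff_bounds(2)[of z x n] ret_mono_le[of x z n] ret_mono_le[of z x n]
    by (cases "x \<le> z") auto
  then have 1: "\<bar>z - x\<bar> \<le> B * \<bar>ret n z - ret n x\<bar>" using B_ge by (simp add: field_simps)
  have s: "(-1) ^ n * (z - x) \<ge> 0" "(-1) ^ n * (ret n x - z) \<ge> 0"
    using assms ret_alt[of n x] by (cases "even n"; auto simp: seg_def)+
  have "gap n x = \<bar>z - x\<bar> + \<bar>ret n x - z\<bar>"
    using s gap_pos[of n x] unfolding gap_eq by (cases "even n") auto
  also have "\<dots> \<le> B * \<bar>ret n z - ret n x\<bar> + B * \<bar>ret n x - z\<bar>"
    using add_mono[OF 1 mult_right_mono[OF B_ge abs_ge_zero[of "ret n x - z"]]] by simp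
  also have "\<dots> = B * gap n z"
  proof -
    have "(-1) ^ n * (ret n z - ret n x) \<ge> 0"
      using s(1) ret_mono_le[of x z n] ret_mono_le[of z x n] by (cases "even n") auto
    then have "\<bar>ret n z - ret n x\<bar> + \<bar>ret n x - z\<bar> = gap n z"
      using s(2) unfolding gap_eq by (cases "even n") auto
    then show ?thesis by (simp add: distrib_left[symmetric])
  qed
  finally show ?thesis .
qed

text \<open>The displacement of \<open>ret n\<close> is \<open>B\<close>-Lipschitz, so it varies by
  at most half of \<open>gap n z\<close> over this distance.\<close>

lemma gap_near:
  assumes "\<bar>x - z\<bar> \<le> gap n z / (2 * B)"
  shows "gap n z \<le> 2 * gap n x"
proof -
  have "\<bar>(ret n x - x) - (ret n z - z)\<bar> \<le> B * \<bar>x - z\<bar>"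
  proof -
    have "\<bar>(ret n b - b) - (ret n a - a)\<bar> \<le> B * (b - a)" if "a \<le> b" for a b
    proof -
      have "b - a \<le> B * (b - a)" using that B_ge mult_right_mono[of 1 B "b - a"] by simp
      moreover have "0 \<le> ret n b - ret n a" using ret_mono_le[OF that, of n] by simp
      ultimately show ?thesis using ret_diff_bounds(1)[OF that, of n] that by linarith
    qed
    from this[of x z] this[of z x] show ?thesis by (cases "x \<le> z") auto
  qed
  also have "\<dots> \<le> gap n z / 2" using assms B_ge mult_left_mono[OF assms, of B] by simp
  finally have "\<bar>(ret n x - x) - (ret n z - z)\<bar> \<le> gap n z / 2" .
  moreover have "\<bar>b\<bar> \<le> \<bar>a - b\<bar> + \<bar>a\<bar>" for a b :: real by arith
  ultimately have "gap n z \<le> gap n z / 2 + gap n x" unfolding gap_def by (meson add_mono order_refl order_trans)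
  then show ?thesis by linarith
qed

end

lemma MVT_seg:
  fixes g g' :: "real \<Rightarrow> real"
  assumes "\<And>x. (g has_real_derivative g' x) (at x)"
  shows "\<exists>z. min x y \<le> z \<and> z \<le> max x y \<and> g y - g x = g' z * (y - x)"
proof -
  have *: "\<exists>z. a \<le> z \<and> z \<le> b \<and> g b - g a = g' z * (b - a)" if "a < b" for a b
    using MVT2[OF that, of g g'] assms by (metis less_imp_le mult.commute)
  consider "x < y" | "x = y" | "y < x" by linarith
  then show ?thesis
  proof cases
    case 3
    then obtain z where "y \<le> z" "z \<le> x" "g x - g y = g' z * (x - y)" using * by blast
    then show ?thesis by (intro exI[of _ z]) (auto simp: algebra_simps)
  qed (use *[of x y] in auto)
qed

text \<open>\<open>\<mu>\<close> is the \<open>R\<close>-th root of \<open>\<kappa>\<close>; the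
  factor \<open>1 / \<kappa>\<close> pays for the rounding in \<open>n div R\<close>.\<close>

lemma power_div_bound:
  fixes \<kappa> :: real
  assumes "0 < \<kappa>" "\<kappa> < 1" "0 < R"
  obtains \<mu> where "0 < \<mu>" "\<mu> < 1" "\<And>n. \<kappa> ^ (n div R) \<le> \<mu> ^ n / \<kappa>"
proof -
  define \<mu> where "\<mu> = \<kappa> powr (1 / R)"
  have "\<kappa> ^ (n div R) \<le> \<mu> ^ n / \<kappa>" for n
  proof -
    have "real n / R \<le> real (n div R) + 1"
      using assms(3) by (simp add: field_simps flip: of_nat_mult of_nat_add)
        (metis dividend_less_times_div less_imp_le mult.commute add.commute mult_Suc_right)
    then have "\<kappa> powr (real (n div R) + 1) \<le> \<kappa> powr (real n / R)"
      using assms by (intro powr_mono') auto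
    also have "\<dots> = \<mu> ^ n"
      using assms by (simp add: \<mu>_def powr_realpow[symmetric] powr_powr)
    finally show ?thesis using assms by (simp add: powr_add powr_realpow field_simps)
  qed
  moreover have "0 < \<mu>" using assms by (simp add: \<mu>_def)
  moreover have "\<mu> < 1" using assms powr_less_mono2[of "1 / real R" \<kappa> 1] by (simp add: \<mu>_def)
  ultimately show ?thesis using that by blast
qed

context golden
begin

subsection \<open>Schwarzian derivatives of the iterates\<close>

text \<open>The Schwarzian derivative written through the nonlinearity. Read as an equation for
  \<open>y = yy i\<close> it is a Riccati equation with \<open>sc i\<close> as its inhomogeneous
  term.\<close>

definition sc :: "nat \<Rightarrow> real \<Rightarrow> real" where
  "sc i x = deriv (yy i) x - (yy i x)\<^sup>2 / 2"

lemma yy_0: "yy 0 = (\<lambda>x. 0)"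
proof
  fix x
  have "el 0 = (\<lambda>x. 0)" by (simp add: fun_eq_iff)
  then show "yy 0 x = 0" using el_deriv[of 0 x] DERIV_unique[OF _ DERIV_const] by metis
qed

lemma yy_Suc: "yy (Suc i) = (\<lambda>x. yy 1 ((f ^^ i) x) * deriv (f ^^ i) x + yy i x)"
proof
  fix x
  have "el (Suc i) = (\<lambda>x. el 1 ((f ^^ i) x) + el i x)" by (rule ext) (rule el_Suc)
  moreover have "((\<lambda>x. el 1 ((f ^^ i) x) + el i x) has_real_derivative
      yy 1 ((f ^^ i) x) * deriv (f ^^ i) x + yy i x) (at x)"
    by (intro DERIV_add DERIV_chain2[of "el 1"] el_deriv smooth_DERIV it_smooth)
  ultimately show "yy (Suc i) x = yy 1 ((f ^^ i) x) * deriv (f ^^ i) x + yy i x"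
    using DERIV_unique el_deriv by metis
qed

lemma deriv2_it: "deriv (deriv (f ^^ i)) x = yy i x * deriv (f ^^ i) x"
  using it_deriv_pos[of i x] by (simp add: yy_def)

lemma sc_0: "sc 0 x = 0"
  by (simp add: sc_def yy_0)

text \<open>The cocycle rule of the Schwarzian: the mixed term in the derivative of
  \<open>yy_Suc\<close> cancels against the mixed term of the square.\<close>

lemma sc_Suc: "sc (Suc i) x = sc 1 ((f ^^ i) x) * (deriv (f ^^ i) x)\<^sup>2 + sc i x"
proof -
  have "(yy (Suc i) has_real_derivative
      deriv (yy 1) ((f ^^ i) x) * deriv (f ^^ i) x * deriv (f ^^ i) x
      + deriv (deriv (f ^^ i)) x * yy 1 ((f ^^ i) x) + deriv (yy i) x) (at x)"
    unfolding yy_Suc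
    by (intro DERIV_add DERIV_mult DERIV_chain2[of "yy 1"] smooth_DERIV yy_smooth it_smooth smooth_deriv)
  then have "deriv (yy (Suc i)) x = deriv (yy 1) ((f ^^ i) x) * deriv (f ^^ i) x * deriv (f ^^ i) x
      + deriv (deriv (f ^^ i)) x * yy 1 ((f ^^ i) x) + deriv (yy i) x" by (rule DERIV_imp_deriv)
  then show ?thesis
    unfolding sc_def deriv2_it yy_Suc by (simp add: power2_eq_square field_simps)
qed

lemma sc_sum: "sc i x = (\<Sum>j<i. sc 1 ((f ^^ j) x) * (deriv (f ^^ j) x)\<^sup>2)"
  by (induction i) (simp_all add: sc_0 sc_Suc add.commute del: funpow.simps One_nat_def)

lemma sc_smooth: "smooth (sc i)"
  unfolding sc_def power2_eq_square divide_inverse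
  by (intro smooth_diff smooth_mult smooth_const smooth_deriv yy_smooth)

lemma sc_periodic: "periodic (sc i)"
  using yy_periodic[of i] periodic_deriv[OF yy_smooth yy_periodic, of i] by (simp add: sc_def periodic_def)

definition s0 :: real where "s0 = max 1 (nrm (sc 1))"

lemma s0_ge: "s0 \<ge> 1" and sc_1_le: "\<bar>sc 1 x\<bar> \<le> s0"
  using nrm_ge[OF sc_smooth sc_periodic, of 1 x] by (auto simp: s0_def)

lemma sc_le: "\<bar>sc i x\<bar> \<le> (\<Sum>j<i. s0 * (deriv (f ^^ j) x)\<^sup>2)"
  unfolding sc_sum[of i]
  by (rule order_trans[OF sum_abs]) (auto intro!: sum_mono mult_right_mono simp: abs_mult sc_1_le simp del: One_nat_def)

lemma it_deriv_gap:
  assumes "j \<le> q (Suc n)"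
  shows "deriv (f ^^ j) x * gap n x \<le> exp V * gap n ((f ^^ j) x)"
proof -
  obtain z where z: "min x (ret n x) \<le> z" "z \<le> max x (ret n x)"
      "(f ^^ j) (ret n x) - (f ^^ j) x = deriv (f ^^ j) z * (ret n x - x)"
    using MVT_seg[of "f ^^ j" "deriv (f ^^ j)" x "ret n x"] smooth_DERIV[OF it_smooth] by blast
  have "el j x \<le> V + el j z"
    using distortion[OF assms, of z x x] z by (auto simp: seg_def)
  then have "deriv (f ^^ j) x \<le> exp V * deriv (f ^^ j) z"
    unfolding exp_el[symmetric] exp_add[symmetric] by simp
  then have "deriv (f ^^ j) x * gap n x \<le> exp V * deriv (f ^^ j) z * gap n x"
    using gap_pos[of n x] by (intro mult_right_mono) auto
  moreover have "deriv (f ^^ j) z * gap n x = gap n ((f ^^ j) x)"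
    unfolding gap_it z(3) using it_deriv_pos[of j z] by (simp add: gap_def abs_mult)
  ultimately show ?thesis by (simp add: mult.assoc)
qed

text \<open>In each summand the squared image gap is split: one factor is bounded by the
  geometrically small maximal gap, the other sums to at most 1 along the orbit.\<close>

lemma sc_gap:
  assumes "i \<le> q (Suc n)"
  shows "\<bar>sc i x\<bar> * (gap n x)\<^sup>2 \<le> s0 * B\<^sup>2 * \<kappa> ^ (n div 2)"
proof -
  have "\<bar>sc i x\<bar> * (gap n x)\<^sup>2 \<le> (\<Sum>j<i. s0 * (deriv (f ^^ j) x)\<^sup>2) * (gap n x)\<^sup>2"
    by (intro mult_right_mono sc_le) auto
  also have "\<dots> = (\<Sum>j<i. s0 * (deriv (f ^^ j) x * gap n x)\<^sup>2)"
    by (simp add: sum_distrib_right power_mult_distrib mult.assoc)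
  also have "\<dots> \<le> (\<Sum>j<i. s0 * (B * (B * \<kappa> ^ (n div 2)) * gap n ((f ^^ j) x)))"
  proof (intro sum_mono mult_left_mono)
    fix j assume "j \<in> {..<i}"
    then have "deriv (f ^^ j) x * gap n x \<le> exp V * gap n ((f ^^ j) x)"
      using assms by (intro it_deriv_gap) auto
    then have "(deriv (f ^^ j) x * gap n x)\<^sup>2 \<le> (exp V * gap n ((f ^^ j) x))\<^sup>2"
      using it_deriv_pos[of j x] gap_pos[of n x] by (intro power_mono) auto
    also have "\<dots> = B * gap n ((f ^^ j) x) * gap n ((f ^^ j) x)"
      by (simp add: B_def power2_eq_square exp_add[symmetric] mult_ac)
    also have "\<dots> \<le> B * gap n ((f ^^ j) x) * (B * \<kappa> ^ (n div 2))"
      using gap_le[of n "(f ^^ j) x"] B_ge gap_pos[of n "(f ^^ j) x"] by (intro mult_left_mono) auto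
    finally show "(deriv (f ^^ j) x * gap n x)\<^sup>2 \<le> B * (B * \<kappa> ^ (n div 2)) * gap n ((f ^^ j) x)"
      by (simp add: mult_ac)
  qed (use s0_ge in auto)
  also have "\<dots> = s0 * B\<^sup>2 * \<kappa> ^ (n div 2) * (\<Sum>j<i. gap n ((f ^^ j) x))"
    by (simp add: sum_distrib_left power2_eq_square mult_ac)
  also have "\<dots> \<le> s0 * B\<^sup>2 * \<kappa> ^ (n div 2) * 1"
  proof (intro mult_left_mono)
    have "(\<Sum>j<i. gap n ((f ^^ j) x)) \<le> (\<Sum>j<q (Suc n). gap n ((f ^^ j) x))"
      using assms less_imp_le[OF gap_pos] by (intro sum_mono2) auto
    then show "(\<Sum>j<i. gap n ((f ^^ j) x)) \<le> 1" using sum_gap_le[of n x] by linarith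
  qed (use s0_ge B_ge \<kappa>_pos in auto)
  finally show ?thesis by simp
qed

text \<open>A Riccati comparison on a length comparable to the level \<open>n\<close> gap, for
  iterates so long that the Schwarzian is controlled only at the finer level \<open>n + k\<close>.
  The change of level costs \<open>4 * ((2 * B)\<^sup>2) ^ k\<close>, and the assumption
  \<open>small\<close> says that the decay of the Schwarzian outweighs it.\<close>

lemma yy_le:
  assumes i: "i \<le> q (Suc (n + k))"
    and small: "4 * (s0 * B\<^sup>2) * ((2 * B)\<^sup>2) ^ k * \<kappa> ^ ((n + k) div 2) \<le> 1"
  shows "\<bar>yy i x\<bar> \<le> 8 * B / gap n x"
proof -
  define L where "L = gap n x / (2 * B)"
  have L: "L > 0" "L \<le> gap n x"
    using gap_pos[of n x] B_ge by (auto simp: L_def field_simps intro: order_trans[of _ "1 * gap n x"])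
  have "\<bar>yy i x\<bar> \<le> 4 / L"
  proof (rule riccati[of "yy i" "deriv (yy i)" L x, OF _ L(1)])
    show "(yy i has_real_derivative deriv (yy i) z) (at z)" for z
      by (rule smooth_DERIV[OF yy_smooth])
    fix z assume "\<bar>z - x\<bar> \<le> L"
    then have "gap n x \<le> 2 * gap n z" unfolding L_def by (rule gap_near)
    then have "gap n x \<le> 2 * ((2 * B) ^ k * gap (n + k) z)" using gap_le_iter[of n z k] by linarith
    then have "(gap n x)\<^sup>2 \<le> (2 * ((2 * B) ^ k * gap (n + k) z))\<^sup>2"
      using gap_pos[of n x] by (intro power_mono) auto
    then have "\<bar>sc i z\<bar> * (gap n x)\<^sup>2 \<le> \<bar>sc i z\<bar> * (2 * ((2 * B) ^ k * gap (n + k) z))\<^sup>2"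
      by (intro mult_left_mono) auto
    also have "\<dots> = 4 * ((2 * B)\<^sup>2) ^ k * (\<bar>sc i z\<bar> * (gap (n + k) z)\<^sup>2)"
    proof -
      have "((2 * B) ^ k)\<^sup>2 = ((2 * B)\<^sup>2) ^ k" by (simp only: power_mult[symmetric] mult.commute)
      then show ?thesis
        by (simp only: power_mult_distrib[of _ "(2 * B) ^ k * _"] power_mult_distrib[of "(2 * B) ^ k"]) simp
    qed
    also have "\<dots> \<le> 4 * ((2 * B)\<^sup>2) ^ k * (s0 * B\<^sup>2 * \<kappa> ^ ((n + k) div 2))"
      by (intro mult_left_mono sc_gap i) auto
    also have "\<dots> \<le> 1" using small by (simp add: mult_ac)
    finally have "\<bar>sc i z\<bar> \<le> 1 / (gap n x)\<^sup>2" using gap_pos[of n x] by (simp add: field_simps)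
    also have "\<dots> \<le> 1 / L\<^sup>2"
      using L gap_pos[of n x] by (intro divide_left_mono power_mono mult_pos_pos) auto
    finally show "\<bar>deriv (yy i) z - (yy i z)\<^sup>2 / 2\<bar> \<le> 1 / L\<^sup>2" by (simp add: sc_def)
  qed
  then show ?thesis by (simp add: L_def)
qed

text \<open>The gain: the nonlinearity is bounded at the scale of the coarse gap but measured
  against the fine one.\<close>

lemma yy_gap_le:
  assumes "i \<le> q (Suc (n + k))"
    and "4 * (s0 * B\<^sup>2) * ((2 * B)\<^sup>2) ^ k * \<kappa> ^ ((n + k) div 2) \<le> 1"
  shows "gap (n + k) x * \<bar>yy i x\<bar> \<le> 8 * B\<^sup>2 * \<kappa> ^ (k div 2)"
proof -
  have "gap (n + k) x * \<bar>yy i x\<bar> \<le> (\<kappa> ^ (k div 2) * (B * gap n x)) * (8 * B / gap n x)"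
    using gap_decay_iter[of n k x] yy_le[OF assms, of x] gap_pos[of "n + k" x] gap_pos[of n x] \<kappa>_pos B_ge
    by (intro mult_mono) auto
  also have "\<dots> = 8 * B\<^sup>2 * \<kappa> ^ (k div 2)"
    using gap_pos[of n x] by (simp add: power2_eq_square)
  finally show ?thesis .
qed

section \<open>Decay of the logarithmic derivatives and boundedness of the first derivatives\<close>

lemma el_seg:
  assumes Y: "\<And>x. gap n x * \<bar>yy i x\<bar> \<le> Y" and seg: "\<And>w. w \<in> seg k z \<Longrightarrow> gap k z \<le> c * gap n w"
    and c: "0 \<le> c" and y: "y \<in> seg k z"
  shows "\<bar>el i y - el i z\<bar> \<le> c * Y"
proof -
  obtain w where w: "min z y \<le> w" "w \<le> max z y" "el i y - el i z = yy i w * (y - z)"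
    using MVT_seg[of "el i" "yy i" z y] el_deriv by blast
  have ws: "w \<in> seg k z" using w y by (auto simp: seg_def min_def max_def split: if_splits)
  have "\<bar>y - z\<bar> \<le> gap k z" using y by (auto simp: seg_def gap_def min_def max_def split: if_splits)
  then have "\<bar>yy i w\<bar> * \<bar>y - z\<bar> \<le> \<bar>yy i w\<bar> * (c * gap n w)"
    using seg[OF ws] by (intro mult_left_mono) auto
  also have "\<dots> = c * (gap n w * \<bar>yy i w\<bar>)" by simp
  also have "\<dots> \<le> c * Y" using c Y by (intro mult_left_mono)
  finally show ?thesis unfolding w abs_mult .
qed

text \<open>The spread argument again, with the oscillation over a gap bounded by nonlinearity times
  length instead of Denjoy's constant.\<close>

lemma el_q_small:
  assumes Y: "\<And>i x. i \<le> q (Suc n) \<Longrightarrow> gap n x * \<bar>yy i x\<bar> \<le> Y"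
  shows "\<bar>el (q n) x\<bar> \<le> 2 * (B\<^sup>2 * Y)"
proof (rule el_q_spread)
  have Y0: "0 \<le> Y" using Y[of 0 0] by (simp add: yy_0)
  have BY: "B * Y \<le> B\<^sup>2 * Y"
    using Y0 B_ge by (intro mult_right_mono) (auto simp: power2_eq_square)
  have 1: "\<bar>el i y - el i z\<bar> \<le> B * Y" if "i \<le> q (Suc n)" "y \<in> seg n z" for i y z
    by (rule el_seg[OF Y gap_seg _ that(2)]) (use that B_ge in auto)
  show "\<bar>el i (ret n y) - el i y\<bar> \<le> B\<^sup>2 * Y" if "i < q (Suc n)" for i y
    using 1[of i "ret n y" y] that BY by auto
  show "\<bar>el (q n) y - el (q n) z\<bar> \<le> B\<^sup>2 * Y" if yz: "y \<in> seg n z \<or> y \<in> seg (Suc n) z" for y z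
  proof (cases "y \<in> seg n z")
    case True
    then show ?thesis using 1[of "q n" y z] q_mono[of n] BY by simp
  next
    case False
    then have y: "y \<in> seg (Suc n) z" using yz by simp
    show ?thesis
    proof (rule el_seg[OF Y _ _ y])
      fix w assume "w \<in> seg (Suc n) z"
      then have "gap (Suc n) z \<le> B * gap (Suc n) w" by (rule gap_seg)
      also have "\<dots> \<le> B * (B * gap n w)" using B_ge by (intro mult_left_mono gap_Suc_le) auto
      finally show "gap (Suc n) z \<le> B\<^sup>2 * gap n w" by (simp add: power2_eq_square)
    qed (use q_mono[of n] in auto)
  qed
qed

lemma el_q_decay: "\<exists>C \<mu>. 0 \<le> C \<and> 0 < \<mu> \<and> \<mu> < 1 \<and> (\<forall>n x. \<bar>el (q n) x\<bar> \<le> C * \<mu> ^ n)"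
proof -
  \<comment> \<open>With \<open>k = n div (2 * r)\<close> finer levels,
    \<open>\<kappa> ^ (n div 2)\<close> is at most \<open>(\<kappa> ^ r) ^ k\<close>, which has to
    beat \<open>((2 * B)\<^sup>2) ^ k\<close>. This fixes \<open>r\<close>; the threshold
    \<open>k0\<close> then absorbs the constant factor.\<close>
  have "(\<lambda>r. (2 * B)\<^sup>2 * \<kappa> ^ r) \<longlonglongrightarrow> (2 * B)\<^sup>2 * 0"
    using \<kappa>_pos \<kappa>_lt_1 by (intro tendsto_intros LIMSEQ_power_zero) auto
  then have "\<forall>\<^sub>F r in sequentially. (2 * B)\<^sup>2 * \<kappa> ^ r < 1 / 2"
    by (intro order_tendstoD) auto
  then obtain r0 where "\<And>r. r \<ge> r0 \<Longrightarrow> (2 * B)\<^sup>2 * \<kappa> ^ r < 1 / 2"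
    unfolding eventually_sequentially by blast
  then obtain r where r: "r > 0" "(2 * B)\<^sup>2 * \<kappa> ^ r \<le> 1 / 2"
    by (metis less_imp_le max.cobounded1 max.cobounded2 zero_less_Suc less_le_trans lessI)
  have "(\<lambda>k. 4 * (s0 * B\<^sup>2) * (1 / 2) ^ k) \<longlonglongrightarrow> 4 * (s0 * B\<^sup>2) * 0"
    by (intro tendsto_intros LIMSEQ_power_zero) auto
  then have "\<forall>\<^sub>F k in sequentially. 4 * (s0 * B\<^sup>2) * (1 / 2) ^ k < 1"
    by (intro order_tendstoD) auto
  then obtain k0 where k0: "\<And>k. k \<ge> k0 \<Longrightarrow> 4 * (s0 * B\<^sup>2) * (1 / 2) ^ k < 1"
    unfolding eventually_sequentially by blast
  \<comment> \<open>This makes \<open>n div R\<close> equal to \<open>k div 2\<close>, the exponent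
    delivered by \<open>yy_gap_le\<close>.\<close>
  define R where "R = 2 * r * 2"
  obtain \<mu> where \<mu>: "0 < \<mu>" "\<mu> < 1" "\<And>n. \<kappa> ^ (n div R) \<le> \<mu> ^ n / \<kappa>"
    using power_div_bound[OF \<kappa>_pos \<kappa>_lt_1, of R] r by (auto simp: R_def)
  \<comment> \<open>The second entry covers the finitely many \<open>n\<close> below
    \<open>2 * r * k0\<close>, where only the Denjoy bound \<open>2 * V\<close> is
    available.\<close>
  define C where "C = max (16 * B ^ 4 / \<kappa>) (2 * V / \<mu> ^ (2 * r * k0))"
  have "\<bar>el (q n) x\<bar> \<le> C * \<mu> ^ n" for n x
  proof (cases "n \<ge> 2 * r * k0")
    case True
    define k where "k = n div (2 * r)"
    have k: "k \<ge> k0" using True r div_le_mono[OF True, of "2 * r"] by (simp add: k_def)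
    have rk: "2 * (r * k) \<le> n" unfolding k_def by (metis mult.assoc times_div_less_eq_dividend)
    then have kn: "k \<le> n" "r * k \<le> n div 2" using r by (auto intro: order_trans[of k "2 * (r * k)"])
    have "((2 * B)\<^sup>2) ^ k * \<kappa> ^ (n div 2) \<le> ((2 * B)\<^sup>2) ^ k * \<kappa> ^ (r * k)"
      using kn \<kappa>_pos \<kappa>_lt_1 by (intro mult_left_mono power_decreasing) auto
    also have "\<dots> = ((2 * B)\<^sup>2 * \<kappa> ^ r) ^ k" by (simp only: power_mult_distrib power_mult)
    also have "\<dots> \<le> (1 / 2) ^ k" using r \<kappa>_pos by (intro power_mono) auto
    finally have "4 * (s0 * B\<^sup>2) * (((2 * B)\<^sup>2) ^ k * \<kappa> ^ (n div 2)) \<le> 4 * (s0 * B\<^sup>2) * (1 / 2) ^ k"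
      using s0_ge by (intro mult_left_mono) auto
    then have sm: "4 * (s0 * B\<^sup>2) * ((2 * B)\<^sup>2) ^ k * \<kappa> ^ ((n - k + k) div 2) \<le> 1"
      using k0[OF k] kn by (simp add: mult.assoc)
    have "\<bar>el (q n) x\<bar> \<le> 2 * (B\<^sup>2 * (8 * B\<^sup>2 * \<kappa> ^ (k div 2)))"
      using yy_gap_le[of _ "n - k" k, OF _ sm] kn by (intro el_q_small) auto
    also have "\<dots> = 16 * B ^ 4 * \<kappa> ^ (n div R)"
    proof -
      have "k div 2 = n div R" unfolding k_def R_def div_mult2_eq[symmetric] ..
      moreover have "B\<^sup>2 * B\<^sup>2 = B ^ 4" by (simp add: power_add[symmetric])
      ultimately show ?thesis by simp
    qed
    also have "\<dots> \<le> 16 * B ^ 4 * (\<mu> ^ n / \<kappa>)" using \<mu> by (intro mult_left_mono) auto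
    also have "\<dots> \<le> C * \<mu> ^ n"
      using \<mu> mult_right_mono[of "16 * B ^ 4 / \<kappa>" C "\<mu> ^ n"] by (simp add: C_def)
    finally show ?thesis .
  next
    case False
    then have "\<mu> ^ (2 * r * k0) \<le> \<mu> ^ n" using \<mu> by (intro power_decreasing) auto
    then have "2 * V \<le> 2 * V / \<mu> ^ (2 * r * k0) * \<mu> ^ n"
      using \<mu> V_ge by (simp add: field_simps)
    also have "\<dots> \<le> C * \<mu> ^ n" using \<mu> by (intro mult_right_mono) (auto simp: C_def)
    finally show ?thesis using el_q_le[of n x] by linarith
  qed
  moreover have "0 \<le> C" using \<kappa>_pos by (simp add: C_def le_max_iff_disj)
  ultimately show ?thesis using \<mu> by blast
qed

text \<open>Each \<open>i\<close> is a sum of terms \<open>q j\<close> with distinct indices, found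
  by removing the largest one; by the cocycle rule \<open>el_add\<close> the logarithmic derivatives
  add up to a partial sum of a geometric series.\<close>

lemma el_bounded: "\<exists>c. \<forall>i x. \<bar>el i x\<bar> \<le> c"
proof -
  obtain C \<mu> where C: "0 \<le> C" "0 < \<mu>" "\<mu> < 1" "\<And>n x. \<bar>el (q n) x\<bar> \<le> C * \<mu> ^ n"
    using el_q_decay by blast
  have "\<forall>i<q (Suc n). \<forall>x. \<bar>el i x\<bar> \<le> (\<Sum>j<Suc n. C * \<mu> ^ j)" for n
  proof (induction n)
    case 0
    then show ?case using C by simp
  next
    case (Suc n)
    show ?case
    proof (intro allI impI)
      fix i x assume i: "i < q (Suc (Suc n))"
      show "\<bar>el i x\<bar> \<le> (\<Sum>j<Suc (Suc n). C * \<mu> ^ j)"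
      proof (cases "i < q (Suc n)")
        case True
        have "0 \<le> C * \<mu> ^ Suc n" using C by simp
        then show ?thesis using Suc[rule_format, OF True, of x] unfolding sum.lessThan_Suc[of _ "Suc n"] by linarith
      next
        case False
        define k where "k = i - q (Suc n)"
        have k: "k < q (Suc n)" "i = q (Suc n) + k" using i False q_mono[of n] by (auto simp: k_def)
        have "\<bar>el i x\<bar> \<le> \<bar>el (q (Suc n)) ((f ^^ k) x)\<bar> + \<bar>el k x\<bar>"
          unfolding k(2) el_add by simp
        also have "\<dots> \<le> C * \<mu> ^ Suc n + (\<Sum>j<Suc n. C * \<mu> ^ j)"
          using C(4)[of "Suc n" "(f ^^ k) x"] Suc[rule_format, OF k(1), of x] by linarith
        finally show ?thesis by simp
      qed
    qed
  qed
  moreover have "(\<Sum>j<n. C * \<mu> ^ j) \<le> C / (1 - \<mu>)" for n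
    using C sum_le_suminf[OF summable_mult[OF summable_geometric[of \<mu>]], of "{..<n}" C]
    by (simp add: suminf_mult suminf_geometric summable_geometric)
  moreover have "\<exists>n. i < q (Suc n)" for i
  proof -
    have "\<exists>n. 2 * real i < (3 / 2) ^ n" by (rule real_arch_pow) simp
    then obtain n where "2 * real i < (3 / 2) ^ n" by blast
    then have "real i < real (q n)" using q_growth[of n] by linarith
    then show ?thesis using q_mono[of n] by (intro exI[of _ n]) simp
  qed
  ultimately have "\<bar>el i x\<bar> \<le> C / (1 - \<mu>)" for i x by (meson order_trans)
  then show ?thesis by blast
qed

definition K :: real where
  "K = (SOME K. K \<ge> 1 \<and> (\<forall>i x. deriv (f ^^ i) x \<le> K \<and> 1 / K \<le> deriv (f ^^ i) x))"

lemma K: "K \<ge> 1" "deriv (f ^^ i) x \<le> K" "1 / K \<le> deriv (f ^^ i) x"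
proof -
  obtain c where c: "\<And>i x. \<bar>el i x\<bar> \<le> c" using el_bounded by blast
  have "exp c \<ge> 1 \<and> (\<forall>i x. deriv (f ^^ i) x \<le> exp c \<and> 1 / exp c \<le> deriv (f ^^ i) x)"
  proof (intro conjI allI)
    show "1 \<le> exp c" using c[of 0 0] by simp
    fix i x
    show "deriv (f ^^ i) x \<le> exp c" using c[of i x] by (simp add: exp_el[symmetric])
    have "- c \<le> el i x" using c[of i x] by linarith
    then show "1 / exp c \<le> deriv (f ^^ i) x"
      by (simp add: exp_el[symmetric] inverse_eq_divide[symmetric] exp_minus[symmetric])
  qed
  then have "K \<ge> 1 \<and> (\<forall>i x. deriv (f ^^ i) x \<le> K \<and> 1 / K \<le> deriv (f ^^ i) x)"
    unfolding K_def by (rule someI)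
  then show "K \<ge> 1" "deriv (f ^^ i) x \<le> K" "1 / K \<le> deriv (f ^^ i) x" by auto
qed

text \<open>The first \<open>q (Suc n)\<close> images of the level \<open>n\<close> interval fit
  into length 1, and each has at least the proportion \<open>1 / K\<close> of the original
  length.\<close>

lemma gap_q: "gap n x * q n \<le> K"
proof -
  have "gap n x / K \<le> gap n ((f ^^ i) x)" for i
  proof -
    obtain z where z: "(f ^^ i) (ret n x) - (f ^^ i) x = deriv (f ^^ i) z * (ret n x - x)"
      using MVT_seg[of "f ^^ i" "deriv (f ^^ i)" x "ret n x"] smooth_DERIV[OF it_smooth] by blast
    have "gap n ((f ^^ i) x) = deriv (f ^^ i) z * gap n x"
      unfolding gap_it z using it_deriv_pos[of i z] by (simp add: gap_def abs_mult)
    then show ?thesis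
      using mult_right_mono[OF K(3)[of i z], of "gap n x"] gap_pos[of n x] by simp
  qed
  then have "(\<Sum>i<q (Suc n). gap n x / K) \<le> (\<Sum>i<q (Suc n). gap n ((f ^^ i) x))" by (intro sum_mono)
  then have "q (Suc n) * (gap n x / K) \<le> 1" using sum_gap_le[of n x] by simp
  moreover have "q n * (gap n x / K) \<le> q (Suc n) * (gap n x / K)"
    using q_mono[of n] K(1) gap_pos[of n x] by (intro mult_right_mono) auto
  ultimately show ?thesis using K(1) by (simp add: field_simps)
qed

end

lemma periodic_bd:
  assumes "smooth u" "periodic u"
  shows "\<exists>P\<ge>0. bd k u P 1"
proof (intro exI conjI)
  have nn: "0 \<le> nrm ((deriv ^^ j) u)" for j
    using assms nrm_nonneg smooth_derivs periodic_derivs by blast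
  then show "0 \<le> (\<Sum>j\<le>k. nrm ((deriv ^^ j) u))" by (intro sum_nonneg)
  show "bd k u (\<Sum>j\<le>k. nrm ((deriv ^^ j) u)) 1"
    unfolding bd_def
  proof (intro allI impI)
    fix j x assume "j \<le> k"
    then have "nrm ((deriv ^^ j) u) \<le> (\<Sum>j\<le>k. nrm ((deriv ^^ j) u))"
      using nn by (intro member_le_sum) auto
    then show "\<bar>(deriv ^^ j) u x\<bar> \<le> (\<Sum>j\<le>k. nrm ((deriv ^^ j) u)) * 1 ^ j"
      using nrm_ge[OF smooth_derivs[OF assms(1)] periodic_derivs[OF assms], of j x] by simp
  qed
qed

lemma geometric_limit:
  fixes d :: "nat \<Rightarrow> real"
  assumes "\<And>n. n \<ge> N \<Longrightarrow> \<bar>d (Suc n) - d n\<bar> \<le> C * \<theta> ^ n" "0 \<le> \<theta>" "\<theta> < 1"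
  shows "convergent d" "n \<ge> N \<Longrightarrow> \<bar>d n - lim d\<bar> \<le> C * \<theta> ^ n / (1 - \<theta>)"
proof -
  have C: "0 \<le> C * \<theta> ^ n" if "n \<ge> N" for n using assms(1)[OF that] by linarith
  have *: "\<bar>d (n + k) - d n\<bar> \<le> C * \<theta> ^ n / (1 - \<theta>)" if n: "n \<ge> N" for n k
  proof -
    have "\<bar>d (n + k) - d n\<bar> \<le> C * \<theta> ^ n * (\<Sum>i<k. \<theta> ^ i)"
    proof (induction k)
      case (Suc k)
      then show ?case using assms(1)[of "n + k"] n by (simp add: power_add algebra_simps)
    qed simp
    also have "(\<Sum>i<k. \<theta> ^ i) \<le> 1 / (1 - \<theta>)"
      using sum_le_suminf[OF summable_geometric[of \<theta>], of "{..<k}"] assms by (simp add: suminf_geometric)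
    finally show ?thesis using C[OF n] mult_left_mono by (metis (no_types, lifting) \<open>(\<Sum>i<k. \<theta> ^ i) \<le> 1 / (1 - \<theta>)\<close> order_trans times_divide_eq_right mult.right_neutral)
  qed
  have lim0: "(\<lambda>n. C * \<theta> ^ n / (1 - \<theta>)) \<longlonglongrightarrow> 0"
    using assms by (auto intro!: tendsto_eq_intros LIMSEQ_power_zero)
  have "Cauchy d"
  proof (rule metric_CauchyI)
    fix e :: real assume "e > 0"
    then have "\<forall>\<^sub>F n in sequentially. C * \<theta> ^ n / (1 - \<theta>) < e / 2"
      using lim0 by (intro order_tendstoD) auto
    then obtain M where M: "\<And>n. n \<ge> M \<Longrightarrow> C * \<theta> ^ n / (1 - \<theta>) < e / 2"
      unfolding eventually_sequentially by blast
    define m where "m = max M N"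
    have "\<bar>d n - d m\<bar> < e / 2" if "n \<ge> m" for n
    proof -
      have "C * \<theta> ^ m / (1 - \<theta>) < e / 2" using M[of m] by (simp add: m_def)
      moreover have "\<bar>d n - d m\<bar> \<le> C * \<theta> ^ m / (1 - \<theta>)" using *[of m "n - m"] that by (simp add: m_def)
      ultimately show ?thesis by linarith
    qed
    then show "\<exists>M. \<forall>m\<ge>M. \<forall>n\<ge>M. dist (d m) (d n) < e"
      by (intro exI[of _ m]) (smt (verit) dist_real_def field_sum_of_halves)
  qed
  then show c: "convergent d" by (simp add: Cauchy_convergent)
  then have l: "d \<longlonglongrightarrow> lim d" by (simp add: convergent_LIMSEQ_iff)
  show "\<bar>d n - lim d\<bar> \<le> C * \<theta> ^ n / (1 - \<theta>)" if "n \<ge> N"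
  proof (rule LIMSEQ_le_const2)
    show "(\<lambda>k. \<bar>d n - d (n + k)\<bar>) \<longlonglongrightarrow> \<bar>d n - lim d\<bar>"
      using LIMSEQ_ignore_initial_segment[OF l, of n] by (auto intro!: tendsto_intros simp: add.commute)
    show "\<exists>M. \<forall>k\<ge>M. \<bar>d n - d (n + k)\<bar> \<le> C * \<theta> ^ n / (1 - \<theta>)"
      using *[OF that] by (metis abs_minus_commute)
  qed
qed

context golden
begin

subsection \<open>Derivatives of the iterates grow like powers of the square root of time\<close>

text \<open>At a maximum of \<open>\<bar>yy i x\<bar>\<close> the derivative of the square vanishes,
  so either \<open>yy i\<close> is 0 there or the Riccati equation leaves
  \<open>(yy i z)\<^sup>2 = - 2 * sc i z\<close>; and \<open>sc i\<close> is a sum of at most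
  \<open>N\<close> bounded terms.\<close>

lemma yy_sqrt: "i \<le> N \<Longrightarrow> \<bar>yy i x\<bar> \<le> 2 * s0 * K * sqrt N"
proof -
  assume i: "i \<le> N"
  obtain z where z: "\<And>x. \<bar>yy i x\<bar> \<le> \<bar>yy i z\<bar>"
    using periodic_attains[OF yy_periodic smooth_continuous[OF yy_smooth]] by blast
  have "((\<lambda>x. (yy i x)\<^sup>2) has_real_derivative 2 * yy i z * deriv (yy i) z) (at z)"
    by (auto intro!: derivative_eq_intros smooth_DERIV yy_smooth)
  moreover have "\<forall>y. \<bar>z - y\<bar> < 1 \<longrightarrow> (yy i y)\<^sup>2 \<le> (yy i z)\<^sup>2"
    using z by (simp add: abs_le_square_iff)
  ultimately have "2 * yy i z * deriv (yy i) z = 0" by (rule DERIV_local_max[OF _ zero_less_one])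
  then have "yy i z = 0 \<or> (yy i z)\<^sup>2 = - 2 * sc i z" by (auto simp: sc_def)
  moreover have "\<bar>sc i z\<bar> \<le> s0 * K\<^sup>2 * N"
  proof -
    have "(\<Sum>j<i. s0 * (deriv (f ^^ j) z)\<^sup>2) \<le> (\<Sum>j<i. s0 * K\<^sup>2)"
      using K(2) it_deriv_pos s0_ge by (intro sum_mono mult_left_mono power_mono) (auto intro: less_imp_le)
    also have "\<dots> = i * (s0 * K\<^sup>2)" by simp
    also have "\<dots> \<le> N * (s0 * K\<^sup>2)" using i s0_ge by (intro mult_right_mono) auto
    finally show ?thesis using sc_le[of i z] by (simp add: mult_ac)
  qed
  moreover have "(yy i z)\<^sup>2 \<le> 2 * \<bar>sc i z\<bar>" using calculation(1) by (elim disjE) simp_all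
  ultimately have "(yy i z)\<^sup>2 \<le> 2 * (s0 * K\<^sup>2 * N)" by linarith
  also have "\<dots> \<le> (2 * s0 * K * sqrt N)\<^sup>2"
  proof -
    have "s0 * (K\<^sup>2 * N) \<le> (2 * s0\<^sup>2) * (K\<^sup>2 * N)"
      using s0_ge by (intro mult_right_mono) (auto simp: power2_eq_square)
    then show ?thesis by (simp add: power_mult_distrib mult_ac)
  qed
  finally have "\<bar>yy i z\<bar> \<le> 2 * s0 * K * sqrt N"
    by (rule_tac power2_le_imp_le) (use s0_ge K(1) in auto)
  then show ?thesis using z[of x] by linarith
qed

text \<open>Bootstrapping at the length scale \<open>1 / sqrt N\<close>. Order \<open>k\<close> for
  the first derivatives gives order \<open>k\<close> for the Schwarzian, of size \<open>N\<close>;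
  the Riccati equation passes this on to the nonlinearity, and \<open>deriv2_it\<close> raises the
  order of the iterates by one.\<close>

lemma it_bd: "\<exists>Q\<ge>1. \<forall>N\<ge>1. \<forall>i\<le>N. bd k (deriv (f ^^ i)) Q (sqrt (real N))"
proof (induction k)
  case 0
  have "\<bar>deriv (f ^^ i) x\<bar> \<le> K" for i x using K(2)[of i x] it_deriv_pos[of i x] by simp
  then show ?case using K(1) by (intro exI[of _ K]) (simp add: bd_0)
next
  case (Suc k)
  then obtain Q where Q: "Q \<ge> 1" "\<And>N i. N \<ge> 1 \<Longrightarrow> i \<le> N \<Longrightarrow> bd k (deriv (f ^^ i)) Q (sqrt (real N))" by blast
  obtain S where S: "S \<ge> 0" "bd k (sc 1) S 1" using periodic_bd[OF sc_smooth sc_periodic] by blast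
  define G where "G = 2 ^ k * (comp_const k Q * S) * (2 ^ k * Q * Q)"
  have G0: "0 \<le> G" using S Q comp_const_ge_1[OF Q(1), of k] by (simp add: G_def)
  have sc_bd: "bd k (sc i) (G * sqrt N * sqrt N) (sqrt N)" if N: "N \<ge> 1" and i: "i \<le> N" for N i
  proof -
    have L: "1 \<le> sqrt N" using N by simp
    have S': "bd k (sc 1) S (sqrt N)" using S L by (intro bd_mono[OF S(2)]) auto
    have sm1: "smooth (\<lambda>x. sc 1 ((f ^^ j) x))" "smooth (\<lambda>x. deriv (f ^^ j) x * deriv (f ^^ j) x)" for j
      by (rule smooth_comp[OF sc_smooth it_smooth], rule smooth_mult[OF smooth_deriv[OF it_smooth] smooth_deriv[OF it_smooth]])
    have "bd k (\<lambda>x. sc 1 ((f ^^ j) x) * (deriv (f ^^ j) x * deriv (f ^^ j) x)) G (sqrt N)" if j: "j < i" for j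
    proof -
      have bQ: "bd k (deriv (f ^^ j)) Q (sqrt N)" using j i by (intro Q(2) N) auto
      have "bd k (\<lambda>x. sc 1 ((f ^^ j) x)) (comp_const k Q * S) (sqrt N)"
        by (rule bd_comp[OF sc_smooth it_smooth S' bQ _ Q(1)]) simp
      moreover have "bd k (\<lambda>x. deriv (f ^^ j) x * deriv (f ^^ j) x) (2 ^ k * Q * Q) (sqrt N)"
        by (rule bd_mult[OF smooth_deriv[OF it_smooth] smooth_deriv[OF it_smooth] bQ bQ]) simp
      ultimately show ?thesis unfolding G_def by (rule bd_mult[OF sm1]) simp
    qed
    then have "bd k (\<lambda>x. \<Sum>j<i. sc 1 ((f ^^ j) x) * (deriv (f ^^ j) x * deriv (f ^^ j) x)) (of_nat (card {..<i}) * G) (sqrt N)"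
      by (intro bd_sum smooth_mult sm1) auto
    moreover have "sc i = (\<lambda>x. \<Sum>j<i. sc 1 ((f ^^ j) x) * (deriv (f ^^ j) x * deriv (f ^^ j) x))"
      by (rule ext) (simp add: sc_sum[of i] power2_eq_square del: One_nat_def)
    ultimately have "bd k (sc i) (i * G) (sqrt N)" by simp
    moreover have "i * G \<le> G * sqrt N * sqrt N"
    proof -
      have "G * sqrt N * sqrt N = N * G" by (simp add: mult.assoc)
      moreover have "i * G \<le> N * G" using i G0 by (intro mult_right_mono) auto
      ultimately show ?thesis by linarith
    qed
    ultimately show ?thesis using G0 by (rule_tac bd_mono[of k "sc i" "i * G" "sqrt N"]) auto
  qed
  \<comment> \<open>An inner induction along the Riccati equation: order \<open>j\<close> of
    \<open>yy i\<close> controls order \<open>j\<close> of its derivative, since both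
    \<open>yy i x * yy i x\<close> and \<open>sc i x\<close> have size \<open>N\<close>, which is
    the size \<open>sqrt N\<close> of \<open>yy i\<close> times one factor \<open>sqrt N\<close> for
    the differentiation.\<close>
  have "\<exists>c\<ge>0. \<forall>N\<ge>1. \<forall>i\<le>N. bd j (yy i) (c * sqrt N) (sqrt N)" if "j \<le> k" for j
    using that
  proof (induction j)
    case 0
    then show ?case using yy_sqrt s0_ge K(1) by (intro exI[of _ "2 * s0 * K"]) (auto simp: bd_0)
  next
    case (Suc j)
    then obtain c where c: "c \<ge> 0" "\<And>N i. N \<ge> 1 \<Longrightarrow> i \<le> N \<Longrightarrow> bd j (yy i) (c * sqrt (real N)) (sqrt (real N))"
      using Suc_leD by blast
    define c' where "c' = max c (1 / 2 * (2 ^ j * c * c) + G)"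
    have "bd (Suc j) (yy i) (c' * sqrt N) (sqrt N)" if N: "N \<ge> 1" and i: "i \<le> N" for N i
    proof -
      have "bd j (\<lambda>x. 1 / 2 * (yy i x * yy i x) + sc i x)
          (\<bar>1 / 2\<bar> * (2 ^ j * (c * sqrt N) * (c * sqrt N)) + G * sqrt N * sqrt N) (sqrt N)"
        using c(2)[OF N i] bd_le[OF sc_bd[OF N i], of j] Suc.prems
        by (intro bd_add bd_cmult bd_mult smooth_mult smooth_const yy_smooth sc_smooth) auto
      moreover have "(\<lambda>x. 1 / 2 * (yy i x * yy i x) + sc i x) = deriv (yy i)"
        by (auto simp: sc_def power2_eq_square)
      moreover have "\<bar>1 / 2\<bar> * (2 ^ j * (c * r) * (c * r)) + G * r * r = (1 / 2 * (2 ^ j * c * c) + G) * (r * r)"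
        for r :: real by (simp add: algebra_simps)
      ultimately have "bd j (deriv (yy i)) ((1 / 2 * (2 ^ j * c * c) + G) * (sqrt N * sqrt N)) (sqrt N)"
        by (simp only:)
      then have "bd j (deriv (yy i)) (c' * sqrt N * sqrt N) (sqrt N)"
      proof (rule bd_mono)
        have "(1 / 2 * (2 ^ j * c * c) + G) * (sqrt N * sqrt N) \<le> c' * (sqrt N * sqrt N)"
          by (intro mult_right_mono) (auto simp: c'_def)
        then show "(1 / 2 * (2 ^ j * c * c) + G) * (sqrt N * sqrt N) \<le> c' * sqrt N * sqrt N"
          by (simp only: mult.assoc)
      qed (use c(1) in \<open>auto simp: c'_def le_max_iff_disj\<close>)
      moreover have "\<bar>yy i x\<bar> \<le> c' * sqrt N" for x
      proof -
        have "c * sqrt N \<le> c' * sqrt N" by (intro mult_right_mono) (auto simp: c'_def)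
        then show ?thesis using bd_D0[OF c(2)[OF N i], of x] by linarith
      qed
      ultimately show ?thesis by (simp add: bd_Suc)
    qed
    then show ?case using c(1) by (intro exI[of _ c']) (auto simp: c'_def)
  qed
  then obtain c where c: "c \<ge> 0" "\<And>N i. N \<ge> 1 \<Longrightarrow> i \<le> N \<Longrightarrow> bd k (yy i) (c * sqrt (real N)) (sqrt (real N))"
    by blast
  define Q' where "Q' = max Q (2 ^ k * c * Q)"
  have "bd (Suc k) (deriv (f ^^ i)) Q' (sqrt N)" if N: "N \<ge> 1" and i: "i \<le> N" for N i
  proof -
    have "bd k (\<lambda>x. yy i x * deriv (f ^^ i) x) (2 ^ k * (c * sqrt N) * Q) (sqrt N)"
      using c(2)[OF N i] Q(2)[OF N i] by (intro bd_mult yy_smooth smooth_deriv it_smooth) auto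
    moreover have "(\<lambda>x. yy i x * deriv (f ^^ i) x) = deriv (deriv (f ^^ i))"
      by (auto simp: deriv2_it)
    ultimately have "bd k (deriv (deriv (f ^^ i))) (2 ^ k * (c * sqrt N) * Q) (sqrt N)" by simp
    then have "bd k (deriv (deriv (f ^^ i))) (Q' * sqrt N) (sqrt N)"
    proof (rule bd_mono)
      have "2 ^ k * c * Q * sqrt N \<le> Q' * sqrt N" by (intro mult_right_mono) (auto simp: Q'_def)
      then show "2 ^ k * (c * sqrt N) * Q \<le> Q' * sqrt N" by (simp add: mult_ac)
    qed (use Q(1) in \<open>auto simp: Q'_def\<close>)
    moreover have "\<bar>deriv (f ^^ i) x\<bar> \<le> Q'" for x
      using bd_D0[OF Q(2)[OF N i], of x] by (simp add: Q'_def)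
    ultimately show ?thesis by (simp add: bd_Suc)
  qed
  then show ?case using Q(1) by (intro exI[of _ Q']) (auto simp: Q'_def)
qed

subsection \<open>Decay of the displacements\<close>

definition ph :: "nat \<Rightarrow> real \<Rightarrow> real" where "ph n x = ret n x - x"

lemma ph_smooth: "smooth (ph n)"
  unfolding ph_def ret_def by (intro smooth_diff it_smooth smooth_const smooth_ident)

lemma ph_periodic: "periodic (ph n)"
  using ret_shift[of n _ 1] by (simp add: periodic_def ph_def)

lemma ph_le: "\<bar>ph n x\<bar> \<le> K / q n"
  using gap_q[of n x] q_pos[of n] by (simp add: ph_def gap_def field_simps)

lemma ph_rec: "ph (Suc (Suc n)) = (\<lambda>x. ph (Suc n) (x + ph n x) + ph n x)"
  by (auto simp: ph_def ret_comp)

lemma ph_derivs: "(deriv ^^ Suc (Suc k)) (ph n) = (deriv ^^ Suc k) (deriv (f ^^ q n))"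
proof -
  have "deriv (ph n) = (\<lambda>x. deriv (f ^^ q n) x - 1)"
    unfolding ph_def using ret_deriv[of n]
    by (auto intro!: ext DERIV_imp_deriv derivative_eq_intros)
  then have "(deriv ^^ Suc (Suc k)) (ph n) = (deriv ^^ Suc k) (\<lambda>x. deriv (f ^^ q n) x - 1)"
    by (simp add: funpow_swap1)
  then show ?thesis
    using derivs_diff[OF smooth_deriv[OF it_smooth] smooth_const, of "Suc k" "q n" 1]
    by (simp only: derivs_const diff_zero)
qed

lemma q_at_top: "filterlim (\<lambda>n. real (q n)) at_top sequentially"
  unfolding filterlim_at_top eventually_sequentially
proof
  fix Z :: real
  obtain N where N: "2 * Z < (3 / 2) ^ N" using real_arch_pow[of "3 / 2" "2 * Z"] by auto
  have "Z \<le> real (q n)" if "n \<ge> N" for n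
  proof -
    have "(3 / 2 :: real) ^ N \<le> (3 / 2) ^ n" using that by (intro power_increasing) auto
    then show ?thesis using N q_growth[of n] by linarith
  qed
  then show "\<exists>N. \<forall>n\<ge>N. Z \<le> real (q n)" by blast
qed

lemma q_Suc_le: "q (Suc n) \<le> 2 * q n"
  using q_mono[of "n - 1"] by (cases n) auto

text \<open>In \<open>ph_rec\<close> a mere addition would at most double the derivatives; the
  correction caused by the composition adds at most the same amount once more, as soon as the
  relative error in \<open>comp_near_id\<close> is small. The bounds of \<open>it_bd\<close> ensure
  that smallness. What matters is that the base 3 does not depend on \<open>k\<close>.\<close>

lemma ph_growth:
  assumes k: "k \<ge> 2"
  shows "\<exists>C. \<forall>n x. \<bar>(deriv ^^ k) (ph n) x\<bar> \<le> C * 3 ^ n"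
proof -
  define a where "a n = max 1 (nrm ((deriv ^^ k) (ph n)))" for n
  have a_ge: "\<bar>(deriv ^^ k) (ph n) x\<bar> \<le> a n" for n x
    using nrm_ge[OF smooth_derivs[OF ph_smooth] periodic_derivs[OF ph_smooth ph_periodic], of k n x]
    by (simp add: a_def)
  have a1: "1 \<le> a n" and a0: "0 \<le> a n" for n by (simp_all add: a_def le_max_iff_disj)
  obtain Q where Q: "Q \<ge> 1" "\<And>N i. N \<ge> 1 \<Longrightarrow> i \<le> N \<Longrightarrow> bd (k - 1) (deriv (f ^^ i)) Q (sqrt (real N))"
    using it_bd[of "k - 1"] by blast
  have a_le: "a n \<le> Q * sqrt (q n) ^ (k - 1)" for n
  proof -
    obtain k' where k': "k = Suc (Suc k')" using k by (metis add_2_eq_Suc le_Suc_ex)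
    have "1 \<le> Q * sqrt (q n) ^ (k - 1)"
      using Q(1) q_pos[of n] mult_mono[of 1 Q 1 "sqrt (q n) ^ (k - 1)"] by (simp add: one_le_power)
    moreover have "nrm ((deriv ^^ k) (ph n)) \<le> Q * sqrt (q n) ^ (k - 1)"
      using bd_D[OF Q(2)[of "q n" "q n"], of "k - 1"] q_pos[of n]
      unfolding k' ph_derivs by (intro nrm_le) auto
    ultimately show ?thesis by (simp add: a_def)
  qed
  obtain Ci where Ci: "Ci \<ge> 1" "\<And>u P L. smooth u \<Longrightarrow> periodic u \<Longrightarrow> 0 \<le> P \<Longrightarrow> 0 \<le> L \<Longrightarrow>
      (\<And>x. \<bar>u x\<bar> \<le> P) \<Longrightarrow> (\<And>x. \<bar>(deriv ^^ k) u x\<bar> \<le> P * L ^ k) \<Longrightarrow> bd k u (Ci * P) L"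
    using interpolation[of k] by blast
  define e where "e = near_const k"
  have e0: "0 \<le> e" by (simp add: e_def near_const_nonneg)
  \<comment> \<open>The relative error at which the correction from \<open>comp_near_id\<close> is
    at most \<open>A\<close>.\<close>
  define \<eta> where "\<eta> = 1 / (1 + e * Ci)"
  have \<eta>: "0 < \<eta>" "\<eta> \<le> 1" "e * Ci * \<eta> \<le> 1"
    using e0 Ci(1) by (auto simp: \<eta>_def field_simps add_pos_nonneg)
  have lim: "(\<lambda>n. 2 * K / sqrt (q n)) \<longlonglongrightarrow> 0"
    by (intro tendsto_divide_0[OF tendsto_const] filterlim_at_top_imp_at_infinity
        filterlim_compose[OF sqrt_at_top] q_at_top)
  then have "(\<lambda>n. Q * Ci ^ k * (2 * K / sqrt (q n))) \<longlonglongrightarrow> Q * Ci ^ k * 0" by (intro tendsto_intros)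
  then have "\<forall>\<^sub>F n in sequentially. Q * Ci ^ k * (2 * K / sqrt (q n)) < \<eta> ^ k"
    using \<eta> by (intro order_tendstoD) auto
  moreover have "\<forall>\<^sub>F n in sequentially. 2 * K / sqrt (q n) < 1"
    using lim by (intro order_tendstoD) auto
  ultimately have "\<forall>\<^sub>F n in sequentially. Q * Ci ^ k * (2 * K / sqrt (q n)) < \<eta> ^ k \<and> 2 * K / sqrt (q n) < 1"
    by eventually_elim auto
  then obtain n0 where n0: "\<And>n. n \<ge> n0 \<Longrightarrow> Q * Ci ^ k * (2 * K / sqrt (q n)) < \<eta> ^ k"
      "\<And>n. n \<ge> n0 \<Longrightarrow> 2 * K / sqrt (q n) < 1"
    unfolding eventually_sequentially by blast
  have step: "a (Suc (Suc n)) \<le> 3 * max (a n) (a (Suc n))" if n: "n \<ge> n0" for n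
  proof -
    define A where "A = max (a n) (a (Suc n))"
    define P where "P = K / q n"
    \<comment> \<open>The scale at which the bound \<open>P\<close> on the functions and the bound
      \<open>A\<close> on their \<open>k\<close>-th derivatives have the form required by the
      interpolation.\<close>
    define L where "L = root k (A / P)"
    have A: "1 \<le> A" "a n \<le> A" "a (Suc n) \<le> A" using a1 by (auto simp: A_def le_max_iff_disj)
    have P: "P > 0" using K(1) q_pos by (simp add: P_def)
    have L: "0 \<le> L" "P * L ^ k = A" using A P k by (auto simp: L_def)
    have b1: "bd k (ph n) (Ci * P) L"
      using ph_le[of n] a_ge[of n] A L P
      by (intro Ci(2) ph_smooth ph_periodic) (auto simp: P_def intro: order_trans)
    have "K / q (Suc n) \<le> P" unfolding P_def using K(1) q_pos q_mono[of n] by (intro divide_left_mono) auto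
    then have b2: "bd k (ph (Suc n)) (Ci * P) L"
      using ph_le[of "Suc n"] a_ge[of "Suc n"] A L P
      by (intro Ci(2) ph_smooth ph_periodic) (auto intro: order_trans)
    define s where "s = sqrt (q n)"
    have s: "s > 0" "s * s = q n" using q_pos by (auto simp: s_def)
    have "sqrt (q (Suc n)) \<le> 2 * s"
    proof -
      have "real (q (Suc n)) \<le> 4 * q n" using q_Suc_le[of n] q_pos[of n] by simp
      then have "sqrt (q (Suc n)) \<le> sqrt (4 * q n)" by (rule real_sqrt_le_mono)
      then show ?thesis by (simp add: s_def real_sqrt_mult)
    qed
    then have "Q * sqrt (q (Suc n)) ^ (k - 1) \<le> Q * (2 * s) ^ (k - 1)"
      using Q(1) by (intro mult_left_mono power_mono) auto
    moreover have "Q * sqrt (q n) ^ (k - 1) \<le> Q * (2 * s) ^ (k - 1)"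
      using Q(1) s by (intro mult_left_mono power_mono) (auto simp: s_def)
    ultimately have AQ: "A \<le> Q * (2 * s) ^ (k - 1)"
      unfolding A_def using a_le[of n] a_le[of "Suc n"] by (auto intro: order_trans)
    \<comment> \<open>Up to constants \<open>A\<close> is at most \<open>s ^ (k - 1)\<close> and
      \<open>P\<close> is \<open>1 / s\<^sup>2\<close>, so this power is of order
      \<open>1 / s ^ (k - 1)\<close> and tends to 0.\<close>
    have "(L * (Ci * P)) ^ k = Ci ^ k * (P * L ^ k) * P ^ (k - 1)"
      using k by (cases k) (auto simp: power_mult_distrib)
    also have "\<dots> \<le> Ci ^ k * (Q * (2 * s) ^ (k - 1)) * P ^ (k - 1)"
      unfolding L(2) using AQ Ci(1) P by (intro mult_right_mono mult_left_mono) auto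
    also have "\<dots> = Q * Ci ^ k * (2 * K / s) ^ (k - 1)"
    proof -
      have "2 * s * P = 2 * K / s" using s(1) unfolding P_def s(2)[symmetric] by simp
      then have "(2 * s) ^ (k - 1) * P ^ (k - 1) = (2 * K / s) ^ (k - 1)"
        by (simp only: power_mult_distrib[symmetric])
      then show ?thesis by (simp add: mult_ac)
    qed
    also have "\<dots> \<le> Q * Ci ^ k * (2 * K / s)"
    proof -
      have "(2 * K / s) ^ (k - 1) \<le> (2 * K / s) ^ 1"
        using n0(2)[OF n] k K(1) s by (intro power_decreasing) (auto simp: s_def)
      then show ?thesis using Q(1) Ci(1) by (intro mult_left_mono) auto
    qed
    also have "\<dots> < \<eta> ^ k" using n0(1)[OF n] by (simp add: s_def)
    finally have LN: "L * (Ci * P) \<le> \<eta>"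
      using power_less_imp_less_base[of "L * (Ci * P)" k \<eta>] \<eta>(1) by linarith
    have comp: "\<bar>(deriv ^^ k) (\<lambda>x. ph (Suc n) (x + ph n x)) x - (deriv ^^ k) (ph (Suc n)) (x + ph n x)\<bar> \<le> A" for x
    proof -
      have "\<bar>(deriv ^^ k) (\<lambda>x. ph (Suc n) (x + ph n x)) x - (deriv ^^ k) (ph (Suc n)) (x + ph n x)\<bar>
          \<le> near_const k * (Ci * P) * L ^ k * (L * (Ci * P))"
      proof (rule comp_near_id[OF ph_smooth ph_smooth])
        show "\<bar>(deriv ^^ j) (ph (Suc n)) x\<bar> \<le> Ci * P * L ^ j" if "j \<le> k" for j x
          using bd_D[OF b2 that] .
        show "\<bar>(deriv ^^ j) (ph n) x\<bar> \<le> Ci * P * L ^ j" if "j \<le> k" for j x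
          using bd_D[OF b1 that] .
        show "L * (Ci * P) \<le> 1" using LN \<eta>(2) by linarith
      qed (use L P Ci(1) in auto)
      also have "\<dots> = e * Ci * A * (L * (Ci * P))" unfolding L(2)[symmetric] by (simp add: e_def mult_ac)
      also have "\<dots> \<le> e * Ci * A * \<eta>" using LN e0 Ci(1) A by (intro mult_left_mono) auto
      also have "\<dots> \<le> 1 * A" using \<eta>(3) A mult_right_mono[OF \<eta>(3), of A] by (simp add: mult_ac)
      finally show ?thesis by simp
    qed
    have "\<bar>(deriv ^^ k) (ph (Suc (Suc n))) x\<bar> \<le> 3 * A" for x
    proof -
      have "smooth (\<lambda>x. ph (Suc n) (x + ph n x))"
        by (intro smooth_comp[OF ph_smooth] smooth_add smooth_ident ph_smooth)
      then have "(deriv ^^ k) (ph (Suc (Suc n))) x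
          = (deriv ^^ k) (\<lambda>x. ph (Suc n) (x + ph n x)) x + (deriv ^^ k) (ph n) x"
        unfolding ph_rec by (simp add: derivs_add ph_smooth)
      then show ?thesis using comp[of x] a_ge[of "Suc n" "x + ph n x"] a_ge[of n x] A by linarith
    qed
    then have "nrm ((deriv ^^ k) (ph (Suc (Suc n)))) \<le> 3 * A" by (rule nrm_le)
    then show ?thesis using A(1) unfolding a_def[of "Suc (Suc n)"] A_def[symmetric] by linarith
  qed
  define C where "C = (\<Sum>j\<le>Suc n0. a j)"
  have "a n \<le> C * 3 ^ n" for n
  proof (induction n rule: less_induct)
    case (less n)
    have C0: "0 \<le> C" unfolding C_def using a0 by (intro sum_nonneg)
    show ?case
    proof (cases "n \<le> Suc n0")
      case True
      then have "a n \<le> C" unfolding C_def using a0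
        by (intro member_le_sum) auto
      also have "\<dots> \<le> C * 3 ^ n" using C0 mult_left_mono[of 1 "3 ^ n" C] by simp
      finally show ?thesis .
    next
      case False
      define m where "m = n - 2"
      have m: "n = Suc (Suc m)" "m \<ge> n0" using False by (auto simp: m_def)
      have "a m \<le> C * 3 ^ Suc m"
      proof -
        have "C * 3 ^ m \<le> C * 3 ^ Suc m" using C0 by (intro mult_left_mono) auto
        then show ?thesis using less[of m] m by simp
      qed
      then have "max (a m) (a (Suc m)) \<le> C * 3 ^ Suc m" using less[of "Suc m"] m by simp
      moreover have "C * 3 ^ Suc (Suc m) = 3 * (C * 3 ^ Suc m)" by simp
      ultimately show ?thesis using step[OF m(2)] unfolding m(1) by linarith
    qed
  qed
  then show ?thesis using a_ge order_trans by blast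
qed

text \<open>Interpolation between the size \<open>(2 / 3) ^ n\<close> and the growth
  \<open>3 ^ n\<close> at a high order \<open>m\<close>. The ratio \<open>(9 / 2) ^ n\<close> is
  spread over \<open>m\<close> derivatives, so each of them costs a factor as close to 1 per step as
  desired.\<close>

lemma ph_decay: "\<exists>C\<ge>0. \<forall>n x. \<forall>j\<le>k. \<bar>(deriv ^^ j) (ph n) x\<bar> \<le> C * (8 / 9) ^ n"
proof -
  \<comment> \<open>The admissible cost of one derivative: up to order \<open>k\<close> the total
    stays below \<open>4 / 3\<close>, and \<open>2 / 3 * (4 / 3) = 8 / 9\<close>.\<close>
  define l where "l = root (Suc k) (4 / 3)"
  have l: "l > 1" "l ^ Suc k = 4 / 3" by (auto simp: l_def simp del: power_Suc)
  have lj: "l ^ j \<le> 4 / 3" if "j \<le> k" for j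
    using l that power_increasing[of j "Suc k" l] by simp
  obtain m' where m': "9 / 2 < l ^ m'" using real_arch_pow[OF l(1)] by blast
  define m where "m = max m' (max k 2)"
  have m: "m \<ge> k" "m \<ge> 2" "m' \<le> m" by (auto simp: m_def)
  have m9: "9 / 2 \<le> l ^ m" using m' l(1) power_increasing[OF m(3), of l] by linarith
  obtain C where C: "\<And>n x. \<bar>(deriv ^^ m) (ph n) x\<bar> \<le> C * 3 ^ n" using ph_growth[OF m(2)] by blast
  obtain Ci where Ci: "Ci \<ge> 1" "\<And>u P L. smooth u \<Longrightarrow> periodic u \<Longrightarrow> 0 \<le> P \<Longrightarrow> 0 \<le> L \<Longrightarrow>
      (\<And>x. \<bar>u x\<bar> \<le> P) \<Longrightarrow> (\<And>x. \<bar>(deriv ^^ m) u x\<bar> \<le> P * L ^ m) \<Longrightarrow> bd m u (Ci * P) L"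
    using interpolation[of m] by blast
  define C' where "C' = max (2 * K) C"
  have C': "C' \<ge> 0" "C \<le> C'" "2 * K \<le> C'" using K(1) by (auto simp: C'_def le_max_iff_disj)
  have "\<bar>(deriv ^^ j) (ph n) x\<bar> \<le> Ci * C' * (8 / 9) ^ n" if j: "j \<le> k" for n x j
  proof -
    have "bd m (ph n) (Ci * (C' * (2 / 3) ^ n)) (l ^ n)"
    proof (rule Ci(2)[OF ph_smooth ph_periodic])
      show "\<bar>ph n x\<bar> \<le> C' * (2 / 3) ^ n" for x
      proof -
        have "1 / real (q n) \<le> 2 * (2 / 3) ^ n"
          using q_growth[of n] q_pos[of n] by (simp add: field_simps power_divide)
        then have "K * (1 / q n) \<le> K * (2 * (2 / 3) ^ n)" using K(1) by (intro mult_left_mono) auto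
        also have "\<dots> \<le> C' * (2 / 3) ^ n"
          using mult_right_mono[OF C'(3), of "(2 / 3) ^ n"] by simp
        finally show ?thesis using ph_le[of n x] by simp
      qed
      show "\<bar>(deriv ^^ m) (ph n) x\<bar> \<le> C' * (2 / 3) ^ n * (l ^ n) ^ m" for x
      proof -
        have "C * 3 ^ n \<le> C' * (2 / 3 * (9 / 2)) ^ n" using C' by (intro mult_mono) auto
        also have "\<dots> \<le> C' * (2 / 3 * l ^ m) ^ n" using C' m9 by (intro mult_left_mono power_mono) auto
        also have "\<dots> = C' * (2 / 3) ^ n * (l ^ n) ^ m"
          by (simp only: power_mult_distrib power_mult[symmetric] mult.commute[of n m] mult.assoc)
        finally show ?thesis using C[of n x] by linarith
      qed
    qed (use C' l in auto)
    then have "\<bar>(deriv ^^ j) (ph n) x\<bar> \<le> Ci * (C' * (2 / 3) ^ n) * (l ^ n) ^ j"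
      using m j by (intro bd_D[of m]) auto
    also have "\<dots> = Ci * C' * (2 / 3 * l ^ j) ^ n"
      by (simp only: power_mult_distrib power_mult[symmetric] mult.commute[of n j] mult.assoc)
    also have "\<dots> \<le> Ci * C' * (8 / 9) ^ n"
      using lj[OF j] l Ci(1) C'(1) by (intro mult_left_mono power_mono) auto
    finally show ?thesis .
  qed
  then show ?thesis using Ci(1) C'(1) by (intro exI[of _ "Ci * C'"]) auto
qed

end

text \<open>The hypothesis makes only derivatives of order at least 1 converge uniformly; the
  normalization at 0 starts the convergence of the functions themselves.\<close>

lemma smooth_limit:
  fixes g :: "nat \<Rightarrow> real \<Rightarrow> real"
  assumes sm: "\<And>n. smooth (g n)" and g0: "\<And>n. g n 0 = 0" and \<theta>: "0 \<le> \<theta>" "\<theta> < 1"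
    and d: "\<And>k. \<exists>C N. \<forall>n\<ge>N. \<forall>x. \<bar>(deriv ^^ Suc k) (g (Suc n)) x - (deriv ^^ Suc k) (g n) x\<bar> \<le> C * \<theta> ^ n"
  obtains h where "smooth h" "\<And>x. (\<lambda>n. g n x) \<longlonglongrightarrow> h x" "\<And>x. (\<lambda>n. deriv (g n) x) \<longlonglongrightarrow> deriv h x"
proof -
  define G where "G k x = lim (\<lambda>n. (deriv ^^ k) (g n) x)" for k x
  have unif: "\<forall>\<^sub>F n in sequentially. \<forall>x\<in>UNIV. \<forall>h. norm ((deriv ^^ Suc k) (g n) x * h - G (Suc k) x * h) \<le> e * norm h"
    if e: "e > 0" for k e
  proof -
    obtain C N where C: "\<And>n x. n \<ge> N \<Longrightarrow>
        \<bar>(deriv ^^ Suc k) (g (Suc n)) x - (deriv ^^ Suc k) (g n) x\<bar> \<le> C * \<theta> ^ n" using d[of k] by blast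
    have "(\<lambda>n. C * \<theta> ^ n / (1 - \<theta>)) \<longlonglongrightarrow> 0"
      using \<theta> by (auto intro!: tendsto_eq_intros LIMSEQ_power_zero)
    then have "\<forall>\<^sub>F n in sequentially. C * \<theta> ^ n / (1 - \<theta>) < e"
      using e by (intro order_tendstoD) auto
    moreover have "\<forall>\<^sub>F n in sequentially. n \<ge> N" by (rule eventually_ge_at_top)
    ultimately show ?thesis
    proof eventually_elim
      case (elim n)
      show ?case
      proof (intro ballI allI)
        fix x h :: real
        have "\<bar>(deriv ^^ Suc k) (g n) x - G (Suc k) x\<bar> \<le> C * \<theta> ^ n / (1 - \<theta>)"
          unfolding G_def by (rule geometric_limit(2)[OF C \<theta>]) (use elim in auto)
        then have "\<bar>(deriv ^^ Suc k) (g n) x - G (Suc k) x\<bar> * \<bar>h\<bar> \<le> e * \<bar>h\<bar>"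
          using elim by (intro mult_right_mono) auto
        then show "norm ((deriv ^^ Suc k) (g n) x * h - G (Suc k) x * h) \<le> e * norm h"
          by (simp only: real_norm_def abs_mult[symmetric] left_diff_distrib)
      qed
    qed
  qed
  have step: "\<exists>l. \<forall>x\<in>UNIV. (\<lambda>n. (deriv ^^ k) (g n) x) \<longlonglongrightarrow> l x \<and>
      (l has_derivative (\<lambda>h. G (Suc k) x * h)) (at x within UNIV)"
    if c: "(\<lambda>n. (deriv ^^ k) (g n) 0) \<longlonglongrightarrow> l0" for k l0
  proof (rule has_derivative_sequence[of UNIV _ "\<lambda>n x h. (deriv ^^ Suc k) (g n) x * h" _ 0])
    show "((deriv ^^ k) (g n) has_derivative (\<lambda>h. (deriv ^^ Suc k) (g n) x * h)) (at x within UNIV)" for n x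
      using smooth_DERIV[OF smooth_derivs[OF sm], of k n x] by (simp add: has_field_derivative_def)
  qed (use unif c in auto)
  have conv: "(\<lambda>n. (deriv ^^ k) (g n) x) \<longlonglongrightarrow> G k x \<and> (G k has_real_derivative G (Suc k) x) (at x)" for k x
  proof -
    have "convergent (\<lambda>n. (deriv ^^ k) (g n) 0)"
    proof (cases k)
      case 0
      then show ?thesis by (simp add: g0 convergent_const)
    next
      case (Suc k')
      then show ?thesis using d[of k'] geometric_limit(1)[OF _ \<theta>] by metis
    qed
    then obtain l0 where "(\<lambda>n. (deriv ^^ k) (g n) 0) \<longlonglongrightarrow> l0" by (auto simp: convergent_def)
    from step[OF this] obtain l where l: "\<And>x. (\<lambda>n. (deriv ^^ k) (g n) x) \<longlonglongrightarrow> l x"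
        "\<And>x. (l has_derivative (\<lambda>h. G (Suc k) x * h)) (at x)" by auto
    have "G k = l" unfolding G_def using l(1) limI by blast
    then show ?thesis using l by (simp add: has_field_derivative_def)
  qed
  have "diffk m (G k)" for m k
  proof (induction m arbitrary: k)
    case (Suc m)
    have "deriv (G k) = G (Suc k)" using conv by (auto intro!: ext DERIV_imp_deriv)
    then show ?case using Suc conv by (auto simp: real_differentiable_def)
  qed simp
  then have "smooth (G 0)" by (simp add: smooth_def)
  moreover have "deriv (G 0) = G 1" using conv[of 0] by (auto intro!: ext DERIV_imp_deriv)
  ultimately show ?thesis using that[of "G 0"] conv[of 0] conv[of 1] by simp
qed

context golden
begin

subsection \<open>Uniform bounds on all iterates\<close>

lemma it_as_ph: "(f ^^ (i + q n)) x = (f ^^ i) (x + ph n x) + fib n"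
proof -
  have "x + ph n x = (f ^^ q n) x + of_int (- int (fib n))" by (simp add: ph_def ret_def)
  then show ?thesis using it_shift[of i "(f ^^ q n) x" "- int (fib n)"] by (simp add: funpow_add)
qed

lemma derivs_it_as_ph: "(deriv ^^ Suc j) (f ^^ (i + q n)) = (deriv ^^ Suc j) (\<lambda>x. (f ^^ i) (x + ph n x))"
proof -
  have "(f ^^ (i + q n)) = (\<lambda>x. (f ^^ i) (x + ph n x) + fib n)" by (rule ext) (rule it_as_ph)
  moreover have "smooth (\<lambda>x. (f ^^ i) (x + ph n x))"
    by (intro smooth_comp[OF it_smooth] smooth_add smooth_ident ph_smooth)
  ultimately show ?thesis using derivs_add[OF _ smooth_const, of _ "Suc j" "real (fib n)"]
    by (simp only: derivs_const add_0_right)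
qed

lemma q_unbounded: "\<exists>n\<ge>m. i < q n"
proof -
  obtain N where N: "2 * real i < (3 / 2) ^ N" using real_arch_pow[of "3 / 2" "2 * real i"] by auto
  have "(3 / 2 :: real) ^ N \<le> (3 / 2) ^ max m N" by (intro power_increasing) auto
  then have "real i < real (q (max m N))" using N q_growth[of "max m N"] by linarith
  then show ?thesis by (intro exI[of _ "max m N"]) simp
qed

text \<open>Passing from iterates below \<open>q (n0 + n)\<close> to the next level precomposes with
  one return map near the identity. This multiplies the bound by \<open>1 + a\<close> with
  \<open>a\<close> geometrically small, and the product of these factors stays below the exponential
  of a convergent series.\<close>

lemma it_derivs_bounded: "\<exists>P\<ge>0. \<forall>i x. \<forall>j. 1 \<le> j \<and> j \<le> k \<longrightarrow> \<bar>(deriv ^^ j) (f ^^ i) x\<bar> \<le> P"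
proof -
  obtain C where C: "0 \<le> C" "\<And>n x j. j \<le> k \<Longrightarrow> \<bar>(deriv ^^ j) (ph n) x\<bar> \<le> C * (8 / 9) ^ n"
    using ph_decay[of k] by blast
  define e where "e = near_const k"
  have e0: "0 \<le> e" by (simp add: e_def near_const_nonneg)
  have "(\<lambda>n. C * (8 / 9) ^ n) \<longlonglongrightarrow> C * 0" by (intro tendsto_intros LIMSEQ_power_zero) auto
  then have "\<forall>\<^sub>F n in sequentially. C * (8 / 9) ^ n < 1" by (intro order_tendstoD) auto
  then obtain n0 where n0: "\<And>n. n \<ge> n0 \<Longrightarrow> C * (8 / 9) ^ n < 1" unfolding eventually_sequentially by blast
  obtain Q where Q: "Q \<ge> 1" "\<And>N i. N \<ge> 1 \<Longrightarrow> i \<le> N \<Longrightarrow> bd k (deriv (f ^^ i)) Q (sqrt (real N))"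
    using it_bd[of k] by blast
  define P0 where "P0 = Q * sqrt (q n0) ^ k"
  have P0: "0 \<le> P0" using Q(1) by (simp add: P0_def)
  define Pn where "Pn n = P0 * exp (\<Sum>i<n. e * C * (8 / 9) ^ (n0 + i))" for n
  have Pn0: "0 \<le> Pn n" for n using P0 by (simp add: Pn_def)
  have main: "\<forall>i<q (n0 + n). \<forall>x j. 1 \<le> j \<and> j \<le> k \<longrightarrow> \<bar>(deriv ^^ j) (f ^^ i) x\<bar> \<le> Pn n" for n
  proof (induction n)
    case 0
    show ?case
    proof (intro allI impI)
      fix i x j assume i: "i < q (n0 + 0)" and j: "1 \<le> j \<and> j \<le> k"
      then obtain j' where j': "j = Suc j'" by (cases j) auto
      have "\<bar>(deriv ^^ j') (deriv (f ^^ i)) x\<bar> \<le> Q * sqrt (q n0) ^ j'"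
        using bd_D[OF Q(2)[of "q n0" i], of j' x] q_pos[of n0] i j j' by simp
      also have "\<dots> \<le> P0" unfolding P0_def
        using q_pos[of n0] Q(1) j j' by (intro mult_left_mono power_increasing) auto
      finally show "\<bar>(deriv ^^ j) (f ^^ i) x\<bar> \<le> Pn 0" by (simp add: Pn_def j' funpow_swap1)
    qed
  next
    case (Suc n)
    define a where "a = e * C * (8 / 9) ^ (n0 + n)"
    have a0: "0 \<le> a" using e0 C by (simp add: a_def)
    have PS: "Pn (Suc n) = Pn n * exp a" by (simp add: Pn_def a_def exp_add mult.assoc)
    have ge: "Pn n * (1 + a) \<le> Pn (Suc n)"
      unfolding PS using Pn0 exp_ge_add_one_self[of a] by (intro mult_left_mono) auto
    have ge': "Pn n \<le> Pn (Suc n)"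
      using ge a0 Pn0[of n] mult_left_mono[of 1 "1 + a" "Pn n"] by linarith
    show ?case
    proof (intro allI impI)
      fix i x j assume i: "i < q (n0 + Suc n)" and j: "1 \<le> j \<and> j \<le> k"
      show "\<bar>(deriv ^^ j) (f ^^ i) x\<bar> \<le> Pn (Suc n)"
      proof (cases "i < q (n0 + n)")
        case True
        then show ?thesis using Suc j ge' by (meson order_trans)
      next
        case False
        define l where "l = i - q (n0 + n)"
        have il: "i = l + q (n0 + n)" using False by (simp add: l_def)
        have l: "l < q (n0 + n)" using i il q_Suc_le[of "n0 + n"] by simp
        obtain j' where j': "j = Suc j'" using j by (cases j) auto
        have "\<bar>(deriv ^^ j) (\<lambda>x. (f ^^ l) (x + ph (n0 + n) x)) x - (deriv ^^ j) (f ^^ l) (x + ph (n0 + n) x)\<bar>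
            \<le> near_const k * Pn n * 1 ^ j * (1 * (C * (8 / 9) ^ (n0 + n)))"
        proof (rule comp_near_id[OF it_smooth ph_smooth])
          show "\<bar>(deriv ^^ j) (f ^^ l) x\<bar> \<le> Pn n * 1 ^ j" if "1 \<le> j" "j \<le> k" for j x
            using Suc l that by simp
          show "\<bar>(deriv ^^ j) (ph (n0 + n)) x\<bar> \<le> C * (8 / 9) ^ (n0 + n) * 1 ^ j" if "j \<le> k" for j x
            using C(2)[OF that] by simp
          show "1 * (C * (8 / 9) ^ (n0 + n)) \<le> 1" using n0[of "n0 + n"] by simp
        qed (use C Pn0 j in auto)
        also have "\<dots> = Pn n * a" by (simp add: a_def e_def)
        finally have "\<bar>(deriv ^^ j) (f ^^ i) x\<bar> \<le> Pn n + Pn n * a"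
          unfolding il j' derivs_it_as_ph
          using Suc[rule_format, OF l conjI, of j "x + ph (n0 + n) x"] j unfolding j' by linarith
        then show ?thesis using ge by (simp add: algebra_simps)
      qed
    qed
  qed
  define S where "S = e * C * (8 / 9) ^ n0 * 9"
  have "Pn n \<le> P0 * exp S" for n
  proof -
    have "(\<Sum>i<n. e * C * (8 / 9) ^ (n0 + i)) = e * C * (8 / 9) ^ n0 * (\<Sum>i<n. (8 / 9) ^ i)"
      by (simp add: sum_distrib_left power_add mult.assoc)
    also have "\<dots> \<le> S"
    proof -
      have "(\<Sum>i<n. (8 / 9 :: real) ^ i) \<le> 9"
        using sum_le_suminf[OF summable_geometric[of "8 / 9 :: real"], of "{..<n}"]
        by (simp add: suminf_geometric)
      then show ?thesis unfolding S_def using e0 C(1) by (intro mult_left_mono) auto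
    qed
    finally show ?thesis unfolding Pn_def using P0 by (intro mult_left_mono) auto
  qed
  then have "\<bar>(deriv ^^ j) (f ^^ i) x\<bar> \<le> P0 * exp S" if j: "1 \<le> j" "j \<le> k" for i x j
  proof -
    obtain n where n: "n \<ge> n0" "i < q n" using q_unbounded by blast
    then have "\<bar>(deriv ^^ j) (f ^^ i) x\<bar> \<le> Pn (n - n0)" using main[of "n - n0"] j by simp
    then show ?thesis using \<open>\<And>n. Pn n \<le> P0 * exp S\<close>[of "n - n0"] by linarith
  qed
  then show ?thesis using P0 by (intro exI[of _ "P0 * exp S"]) auto
qed

subsection \<open>The linearizing coordinate\<close>

definition avg :: "nat \<Rightarrow> real \<Rightarrow> real" where
  "avg n x = (\<Sum>i<q n. (f ^^ i) x) / q n"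

lemma avg_sm: "smooth (\<lambda>x. \<Sum>i<q n. (f ^^ i) x)"
  by (intro smooth_sum it_smooth)

lemma avg_smooth: "smooth (avg n)"
  unfolding avg_def divide_inverse by (intro smooth_mult avg_sm smooth_const)

lemma avg_derivs: "(deriv ^^ j) (avg n) x = (deriv ^^ j) (\<lambda>x. \<Sum>i<q n. (f ^^ i) x) x / q n"
proof -
  have "avg n = (\<lambda>x. (1 / q n) * (\<Sum>i<q n. (f ^^ i) x))" by (auto simp: avg_def)
  then have "(deriv ^^ j) (avg n) x = (1 / q n) * (deriv ^^ j) (\<lambda>x. \<Sum>i<q n. (f ^^ i) x) x"
    by (simp only: derivs_cmult[OF avg_sm])
  then show ?thesis by simp
qed

lemma sum_rec: "(\<Sum>i<q (Suc (Suc n)). (f ^^ i) x)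
   = (\<Sum>i<q (Suc n). (f ^^ i) x) + ((\<Sum>i<q n. (f ^^ i) (x + ph (Suc n) x)) + q n * fib (Suc n))"
proof -
  have "(\<Sum>i<q (Suc (Suc n)). (f ^^ i) x) = (\<Sum>i<q (Suc n). (f ^^ i) x) + (\<Sum>i<q n. (f ^^ (i + q (Suc n))) x)"
    using sum.shift_bounds_nat_ivl[of "\<lambda>i. (f ^^ i) x" 0 "q (Suc n)" "q n"]
      sum.atLeastLessThan_concat[of 0 "q (Suc n)" "q (Suc n) + q n" "\<lambda>i. (f ^^ i) x"]
    by (simp add: lessThan_atLeast0 add.commute)
  then show ?thesis by (simp add: it_as_ph sum.distrib)
qed

text \<open>By \<open>sum_rec\<close> the sum at level \<open>n + 2\<close> is the sum of the two
  previous ones, up to a constant and a precomposition near the identity. The derivatives of the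
  averages thus satisfy a recursion by weighted means with a geometrically small error.\<close>

lemma avg_derivs_cauchy:
  "\<exists>C N. \<forall>n\<ge>N. \<forall>x. \<bar>(deriv ^^ Suc k) (avg (Suc n)) x - (deriv ^^ Suc k) (avg n) x\<bar> \<le> C * (8 / 9) ^ n"
proof -
  define k' where "k' = Suc k"
  obtain P where P: "P \<ge> 0" "\<And>i x j. 1 \<le> j \<Longrightarrow> j \<le> Suc k' \<Longrightarrow> \<bar>(deriv ^^ j) (f ^^ i) x\<bar> \<le> P"
    using it_derivs_bounded[of "Suc k'"] by blast
  obtain C where C: "0 \<le> C" "\<And>n x j. j \<le> k' \<Longrightarrow> \<bar>(deriv ^^ j) (ph n) x\<bar> \<le> C * (8 / 9) ^ n"
    using ph_decay[of k'] by blast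
  define e where "e = near_const k'"
  have e0: "0 \<le> e" by (simp add: e_def near_const_nonneg)
  have "(\<lambda>n. C * (8 / 9) ^ n) \<longlonglongrightarrow> C * 0" by (intro tendsto_intros LIMSEQ_power_zero) auto
  then have "\<forall>\<^sub>F n in sequentially. C * (8 / 9) ^ n < 1" by (intro order_tendstoD) auto
  then obtain N where N: "\<And>n. n \<ge> N \<Longrightarrow> C * (8 / 9) ^ n < 1" unfolding eventually_sequentially by blast
  define s where "s n = (\<lambda>x. \<Sum>i<q n. (f ^^ i) x)" for n
  have s_smooth: "smooth (s n)" for n unfolding s_def by (rule avg_sm)
  have s_le: "\<bar>(deriv ^^ j) (s n) x\<bar> \<le> q n * P" if "1 \<le> j" "j \<le> Suc k'" for j n x
  proof -
    have "\<bar>\<Sum>i<q n. (deriv ^^ j) (f ^^ i) x\<bar> \<le> (\<Sum>i<q n. P)"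
      using P(2)[OF that] by (intro order_trans[OF sum_abs] sum_mono) auto
    then show ?thesis unfolding s_def by (simp add: derivs_sum it_smooth)
  qed
  define C1 where "C1 = P * (e + 1) * C"
  have C1: "0 \<le> C1" using P C e0 by (simp add: C1_def)
  have rec: "\<bar>(deriv ^^ k') (s (Suc (Suc n))) x - (deriv ^^ k') (s (Suc n)) x - (deriv ^^ k') (s n) x\<bar>
      \<le> q n * (C1 * (8 / 9) ^ n)" if n: "n \<ge> N" for n x
  proof -
    let ?p = "ph (Suc n)"
    have sm: "smooth (\<lambda>x. s n (x + ?p x))"
      by (intro smooth_comp[OF s_smooth] smooth_add smooth_ident ph_smooth)
    have "s (Suc (Suc n)) = (\<lambda>x. s (Suc n) x + (s n (x + ?p x) + real (q n * fib (Suc n))))"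
      unfolding s_def by (rule ext) (use sum_rec in simp)
    then have eq: "(deriv ^^ k') (s (Suc (Suc n))) x = (deriv ^^ k') (s (Suc n)) x + (deriv ^^ k') (\<lambda>x. s n (x + ?p x)) x"
      by (simp only: derivs_add s_smooth sm smooth_add smooth_const k'_def derivs_const add_0_right)
    have N1: "C * (8 / 9) ^ Suc n < 1" using n by (intro N) simp
    have "\<bar>(deriv ^^ k') (\<lambda>x. s n (x + ?p x)) x - (deriv ^^ k') (s n) (x + ?p x)\<bar>
        \<le> near_const k' * (q n * P) * 1 ^ k' * (1 * (C * (8 / 9) ^ Suc n))"
    proof (rule comp_near_id[OF s_smooth ph_smooth])
      show "\<bar>(deriv ^^ j) (s n) x\<bar> \<le> q n * P * 1 ^ j" if "1 \<le> j" "j \<le> k'" for j x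
        using s_le[of j n x] that by simp
      show "\<bar>(deriv ^^ j) ?p x\<bar> \<le> C * (8 / 9) ^ Suc n * 1 ^ j" if "j \<le> k'" for j x
        using C(2)[OF that, of "Suc n" x] by simp
      show "1 * (C * (8 / 9) ^ Suc n) \<le> 1" using N1 by simp
    qed (use C P in auto)
    moreover have "\<bar>(deriv ^^ k') (s n) (x + ?p x) - (deriv ^^ k') (s n) x\<bar> \<le> q n * P * (C * (8 / 9) ^ Suc n)"
    proof -
      have "((deriv ^^ k') (s n) has_real_derivative (deriv ^^ Suc k') (s n) x) (at x)" for x
        using smooth_DERIV[OF smooth_derivs[OF s_smooth]] by simp
      then obtain z where z: "(deriv ^^ k') (s n) (x + ?p x) - (deriv ^^ k') (s n) x
          = (deriv ^^ Suc k') (s n) z * (x + ?p x - x)"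
        using MVT_seg[of "(deriv ^^ k') (s n)" "(deriv ^^ Suc k') (s n)" x "x + ?p x"] by blast
      have "\<bar>?p x\<bar> \<le> C * (8 / 9) ^ Suc n" using C(2)[of 0 "Suc n" x] by simp
      then show ?thesis unfolding z abs_mult
        using s_le[of "Suc k'" n z] P(1) by (intro mult_mono) auto
    qed
    ultimately have "\<bar>(deriv ^^ k') (s (Suc (Suc n))) x - (deriv ^^ k') (s (Suc n)) x - (deriv ^^ k') (s n) x\<bar>
        \<le> near_const k' * (q n * P) * 1 ^ k' * (1 * (C * (8 / 9) ^ Suc n)) + q n * P * (C * (8 / 9) ^ Suc n)"
      unfolding eq by linarith
    also have "\<dots> = q n * (C1 * (8 / 9) ^ Suc n)" by (simp add: C1_def e_def algebra_simps)
    also have "\<dots> \<le> q n * (C1 * (8 / 9) ^ n)" using C1 by (intro mult_left_mono) auto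
    finally show ?thesis .
  qed
  define d where "d n x = (deriv ^^ k') (avg n) x" for n x
  have d_eq: "d n x = (deriv ^^ k') (s n) x / q n" for n x
    unfolding d_def s_def by (rule avg_derivs)
  have step: "\<bar>d (Suc (Suc n)) x - d (Suc n) x\<bar> \<le> 1 / 2 * \<bar>d (Suc n) x - d n x\<bar> + C1 * (8 / 9) ^ n"
    if n: "n \<ge> N" for n x
  proof -
    define r where "r = (deriv ^^ k') (s (Suc (Suc n))) x - (deriv ^^ k') (s (Suc n)) x - (deriv ^^ k') (s n) x"
    define a where "a = real (q n)"
    define b where "b = real (q (Suc n))"
    have ab: "0 < a" "a \<le> b" using q_pos[of n] q_mono[of n] by (auto simp: a_def b_def)
    have "(deriv ^^ k') (s n) x = a * d n x" "(deriv ^^ k') (s (Suc n)) x = b * d (Suc n) x"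
      "(deriv ^^ k') (s (Suc (Suc n))) x = (b + a) * d (Suc (Suc n)) x"
      using ab q_pos[of n] q_pos[of "Suc n"] by (auto simp: d_eq a_def b_def)
    then have r: "r = (b + a) * d (Suc (Suc n)) x - b * d (Suc n) x - a * d n x" by (simp add: r_def)
    \<comment> \<open>The older term has weight \<open>a / (b + a)\<close>, at most
      \<open>1 / 2\<close> since \<open>a \<le> b\<close>; so consecutive differences are halved up
      to the error \<open>r\<close>.\<close>
    have "(b + a) * (d (Suc (Suc n)) x - d (Suc n) x) = r - a * (d (Suc n) x - d n x)"
      by (simp add: r algebra_simps)
    then have "(b + a) * \<bar>d (Suc (Suc n)) x - d (Suc n) x\<bar> = \<bar>r - a * (d (Suc n) x - d n x)\<bar>"
      using ab by (metis abs_mult abs_of_pos add_pos_pos less_le_trans)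
    also have "\<dots> \<le> a * (C1 * (8 / 9) ^ n) + a * \<bar>d (Suc n) x - d n x\<bar>"
    proof -
      have "\<bar>r\<bar> \<le> a * (C1 * (8 / 9) ^ n)" unfolding r_def a_def by (rule rec[OF n])
      moreover have "\<bar>a * (d (Suc n) x - d n x)\<bar> = a * \<bar>d (Suc n) x - d n x\<bar>" using ab by (simp add: abs_mult)
      ultimately show ?thesis by linarith
    qed
    also have "\<dots> \<le> (b + a) * (C1 * (8 / 9) ^ n) + (b + a) * (1 / 2 * \<bar>d (Suc n) x - d n x\<bar>)"
    proof (rule add_mono)
      show "a * (C1 * (8 / 9) ^ n) \<le> (b + a) * (C1 * (8 / 9) ^ n)" using ab C1 by (intro mult_right_mono) auto
      have "a * \<bar>d (Suc n) x - d n x\<bar> \<le> (b + a) / 2 * \<bar>d (Suc n) x - d n x\<bar>"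
        using ab by (intro mult_right_mono) auto
      then show "a * \<bar>d (Suc n) x - d n x\<bar> \<le> (b + a) * (1 / 2 * \<bar>d (Suc n) x - d n x\<bar>)" by simp
    qed
    also have "\<dots> = (b + a) * (1 / 2 * \<bar>d (Suc n) x - d n x\<bar> + C1 * (8 / 9) ^ n)"
      by (simp add: algebra_simps)
    finally show ?thesis using ab by (simp only: mult_le_cancel_left_pos add_pos_pos less_le_trans)
  qed
  have d_le: "\<bar>d n x\<bar> \<le> P" for n x
    using s_le[of k' n x] q_pos[of n] by (simp add: d_eq k'_def field_simps)
  \<comment> \<open>The first summand starts the induction at \<open>N\<close>; the second gives
    \<open>1 / 2 * C2 + C1 \<le> 8 / 9 * C2\<close>.\<close>
  define C2 where "C2 = 2 * P / (8 / 9) ^ N + 3 * C1"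
  have "\<bar>d (Suc (N + i)) x - d (N + i) x\<bar> \<le> C2 * (8 / 9) ^ (N + i)" for i x
  proof (induction i)
    case 0
    have "\<bar>d (Suc N) x - d N x\<bar> \<le> 2 * P" using d_le[of "Suc N" x] d_le[of N x] by linarith
    also have "\<dots> \<le> C2 * (8 / 9) ^ N" using C1 by (simp add: C2_def distrib_right)
    finally show ?case by simp
  next
    case (Suc i)
    have "\<bar>d (Suc (Suc (N + i))) x - d (Suc (N + i)) x\<bar> \<le> 1 / 2 * (C2 * (8 / 9) ^ (N + i)) + C1 * (8 / 9) ^ (N + i)"
      using order_trans[OF step[of "N + i" x] add_right_mono[OF mult_left_mono[OF Suc]]] by simp
    also have "\<dots> = (1 / 2 * C2 + C1) * (8 / 9) ^ (N + i)" by (simp add: algebra_simps)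
    also have "\<dots> \<le> (8 / 9 * C2) * (8 / 9) ^ (N + i)"
    proof (rule mult_right_mono)
      have "3 * C1 \<le> C2" using P by (simp add: C2_def)
      then show "1 / 2 * C2 + C1 \<le> 8 / 9 * C2" using C1 by linarith
    qed simp
    finally show ?case by (simp add: mult_ac)
  qed
  then have "\<forall>n\<ge>N. \<forall>x. \<bar>d (Suc n) x - d n x\<bar> \<le> C2 * (8 / 9) ^ n"
    using le_Suc_ex by blast
  then show ?thesis unfolding d_def k'_def by blast
qed

text \<open>The difference \<open>g n (f x) - g n x\<close> telescopes to
  \<open>(fib n + ph n x) / q n\<close>, whose dependence on \<open>x\<close> vanishes in the limit.
  The averages keep the lower bound \<open>1 / K\<close> of the first derivatives, so the limit is a
  diffeomorphism.\<close>

theorem linearization: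
  obtains h \<alpha> where "smooth h" "\<And>x. h (x + 1) = h x + 1" "\<And>x. deriv h x > 0" "\<And>x. h (f x) = h x + \<alpha>"
proof -
  define g where "g n x = avg n x - avg n 0" for n x
  have gd: "(deriv ^^ Suc k) (g n) = (deriv ^^ Suc k) (avg n)" for k n
    using derivs_diff[OF avg_smooth smooth_const, of "Suc k" n "avg n 0"]
    unfolding g_def derivs_const by simp
  have g_smooth: "smooth (g n)" for n
    unfolding g_def by (intro smooth_diff avg_smooth smooth_const)
  obtain h where h: "smooth h" "\<And>x. (\<lambda>n. g n x) \<longlonglongrightarrow> h x" "\<And>x. (\<lambda>n. deriv (g n) x) \<longlonglongrightarrow> deriv h x"
  proof (rule smooth_limit[of g "8 / 9"])
    show "\<exists>C N. \<forall>n\<ge>N. \<forall>x. \<bar>(deriv ^^ Suc k) (g (Suc n)) x - (deriv ^^ Suc k) (g n) x\<bar> \<le> C * (8 / 9) ^ n" for k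
      unfolding gd by (rule avg_derivs_cauchy)
  qed (auto simp: g_smooth g_def)
  have "h (x + 1) = h x + 1" for x
  proof (rule LIMSEQ_unique[OF h(2)])
    have "g n (x + 1) = g n x + 1" for n
      using q_pos[of n] by (simp add: g_def avg_def it_shift1 sum.distrib add_divide_distrib)
    then show "(\<lambda>n. g n (x + 1)) \<longlonglongrightarrow> h x + 1" using h(2)[of x] by (auto intro!: tendsto_intros)
  qed
  moreover have "deriv h x > 0" for x
  proof -
    have "1 / K \<le> deriv h x"
    proof (rule LIMSEQ_le_const[OF h(3)], intro exI allI impI)
      fix n
      have "(\<Sum>i<q n. 1 / K) \<le> (\<Sum>i<q n. deriv (f ^^ i) x)" using K(3) by (intro sum_mono)
      also have "\<dots> = q n * deriv (g n) x"
        using gd[of 0 n] avg_derivs[of 1 n x] derivs_sum[of "{..<q n}" "\<lambda>i. f ^^ i" 1] it_smooth q_pos[of n] by simp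
      finally have "q n * (1 / K) \<le> q n * deriv (g n) x" by simp
      then show "1 / K \<le> deriv (g n) x" using q_pos[of n] by (simp only: mult_le_cancel_left_pos of_nat_0_less_iff)
    qed
    moreover have "0 < 1 / K" using K(1) by simp
    ultimately show ?thesis by linarith
  qed
  moreover have "h (f x) = h x + (h (f 0) - h 0)" for x
  proof -
    have e: "g n (f x) - g n x = (fib n + ph n x) / q n" for n x
    proof -
      have "(\<Sum>i<q n. (f ^^ i) (f x)) - (\<Sum>i<q n. (f ^^ i) x) = (\<Sum>i<q n. (f ^^ Suc i) x - (f ^^ i) x)"
        by (simp add: sum_subtractf funpow_swap1)
      also have "\<dots> = (f ^^ q n) x - x" using sum_lessThan_telescope[of "\<lambda>i. (f ^^ i) x" "q n"] by simp
      finally show ?thesis by (simp add: g_def avg_def ph_def ret_def diff_divide_distrib[symmetric])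
    qed
    have "(\<lambda>n. (g n (f x) - g n x) - (g n (f 0) - g n 0)) \<longlonglongrightarrow> (h (f x) - h x) - (h (f 0) - h 0)"
      by (intro tendsto_diff h)
    moreover have "(\<lambda>n. (g n (f x) - g n x) - (g n (f 0) - g n 0)) \<longlonglongrightarrow> 0"
    proof (rule Lim_null_comparison)
      have "\<bar>(g n (f x) - g n x) - (g n (f 0) - g n 0)\<bar> \<le> 2 * K / q n" for n
      proof -
        have q: "K / real (q n) \<le> K" using q_pos[of n] K(1) by (simp add: field_simps)
        have "(g n (f x) - g n x) - (g n (f 0) - g n 0) = (ph n x - ph n 0) / q n"
          unfolding e by (simp add: diff_divide_distrib add_divide_distrib)
        moreover have "\<bar>ph n x - ph n 0\<bar> \<le> 2 * K" using ph_le[of n x] ph_le[of n 0] q by linarith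
        ultimately show ?thesis by (simp add: divide_right_mono)
      qed
      then show "\<forall>\<^sub>F n in sequentially. norm ((g n (f x) - g n x) - (g n (f 0) - g n 0)) \<le> 2 * K / q n"
        by (intro always_eventually) simp
      show "(\<lambda>n. 2 * K / q n) \<longlonglongrightarrow> 0"
        by (intro tendsto_divide_0[OF tendsto_const] filterlim_at_top_imp_at_infinity q_at_top)
    qed
    ultimately have "(h (f x) - h x) - (h (f 0) - h 0) = 0" by (rule LIMSEQ_unique)
    then show ?thesis by simp
  qed
  ultimately show ?thesis using that h(1) by blast
qed

end

subsection \<open>Realizing the golden rotation number\<close>

definition golden_mean :: real where "golden_mean = (sqrt 5 - 1) / 2"

lemma golden_mean_pos: "golden_mean > 0" and golden_mean_lt_1: "golden_mean < 1"
proof -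
  have "sqrt 1 < sqrt 5" "sqrt 5 < sqrt 9" by (intro real_sqrt_less_mono; simp)+
  then show "golden_mean > 0" "golden_mean < 1" by (simp_all add: golden_mean_def)
qed

lemma golden_mean_sq: "golden_mean * golden_mean = 1 - golden_mean"
  by (simp add: golden_mean_def field_simps)

text \<open>By \<open>golden_mean_sq\<close> both sides obey the Fibonacci recursion; the
  alternating sign is the one required in the locale \<open>golden\<close>.\<close>

lemma fib_golden: "real (fib (Suc n)) * golden_mean - real (fib n) = (-1) ^ n * golden_mean ^ Suc n"
proof (induction n rule: fib.induct)
  case 2
  show ?case using golden_mean_sq by simp
next
  case (3 n)
  have "real (fib (Suc (Suc (Suc n)))) * golden_mean - real (fib (Suc (Suc n)))
     = (-1) ^ Suc n * golden_mean ^ Suc (Suc n) + (-1) ^ n * golden_mean ^ Suc n"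
    using 3 by (simp add: algebra_simps)
  also have "\<dots> = (-1) ^ n * golden_mean ^ Suc n * (1 - golden_mean)" by (simp add: algebra_simps)
  finally show ?case by (simp add: golden_mean_sq[symmetric])
qed simp

section \<open>Monotone maps of degree one and their translates\<close>

lemma mono_shift_dispersion:
  fixes G :: "real \<Rightarrow> real"
  assumes m: "mono G" and s: "\<And>x. G (x + 1) = G x + 1"
  shows "\<bar>(G x - x) - (G y - y)\<bar> \<le> 1"
proof -
  define k where "k = \<lfloor>y - x\<rfloor>"
  define z where "z = y - of_int k"
  have z: "x \<le> z" "z \<le> x + 1" unfolding z_def k_def by linarith+
  have "G y = G z + of_int k" using shift_int[of G 1, OF s, of z k] by (simp add: z_def)
  then have e: "G y - y = G z - z" by (simp add: z_def)
  show ?thesis using monoD[OF m z(1)] monoD[OF m z(2)] s[of x] z unfolding e by auto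
qed

lemma mono_shift_iter_le:
  fixes G :: "real \<Rightarrow> real" and p :: int
  assumes m: "mono G" and s: "\<And>x. G (x + 1) = G x + 1" and "G x \<le> x + of_int p"
  shows "(G ^^ k) x \<le> x + of_int (int k * p)"
proof (induction k)
  case (Suc k)
  have "G ((G ^^ k) x) \<le> G (x + of_int (int k * p))" using Suc by (rule monoD[OF m])
  also have "\<dots> \<le> x + of_int p + of_int (int k * p)"
    using shift_int[of G 1, OF s, of x "int k * p"] assms(3) by simp
  finally show ?case by (simp add: algebra_simps)
qed simp

lemma mono_shift_iter_ge:
  fixes G :: "real \<Rightarrow> real" and p :: int
  assumes m: "mono G" and s: "\<And>x. G (x + 1) = G x + 1" and "G x \<ge> x + of_int p"
  shows "(G ^^ k) x \<ge> x + of_int (int k * p)"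
proof (induction k)
  case (Suc k)
  have "x + of_int p + of_int (int k * p) \<le> G (x + of_int (int k * p))"
    using shift_int[of G 1, OF s, of x "int k * p"] assms(3) by simp
  also have "\<dots> \<le> G ((G ^^ k) x)" using Suc by (rule monoD[OF m])
  finally show ?case by (simp add: algebra_simps)
qed simp

text \<open>\<open>lo\<close> and \<open>hi\<close> say that some orbit witnesses a rotation number
  not exceeding a rational below, or at least a rational above, the golden mean. Both sets of
  parameters are open, they are disjoint and each contains an end of the interval, so connectedness
  leaves a parameter in neither; the Fibonacci quotients then give \<open>alt\<close>.\<close>

lemma golden_parameter:
  fixes f :: "real \<Rightarrow> real"
  assumes sm: "smooth f" and shift: "\<And>x. f (x + 1) = f x + 1" and pos: "\<And>x. deriv f x > 0"
    and t: "t1 \<le> t2" "f x1 + t1 \<le> x1" "f x2 + t2 \<ge> x2 + 1"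
  shows "\<exists>t\<in>{t1..t2}. golden (\<lambda>x. f x + t)"
proof -
  define w where "w t = (\<lambda>x. f x + t)" for t
  have "strict_mono f"
    by (rule strict_monoI, rule DERIV_pos_imp_increasing) (use smooth_DERIV[OF sm] pos in auto)
  then have "mono f" by (rule strict_mono_mono)
  then have wmono: "mono (w t)" for t unfolding w_def mono_def by auto
  have itm: "mono (w t ^^ k)" for t k using wmono by (induction k) (auto simp: mono_def)
  have its: "(w t ^^ k) (x + 1) = (w t ^^ k) x + 1" for t k x
    by (induction k) (auto simp: w_def shift)
  have itc: "continuous_on UNIV (\<lambda>t. (w t ^^ k) x)" for k x
  proof (induction k)
    case (Suc k)
    have "continuous_on UNIV (\<lambda>t. f ((w t ^^ k) x) + t)"
      by (intro continuous_intros continuous_on_compose2[OF smooth_continuous[OF sm] Suc]) auto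
    then show ?case by (simp add: w_def)
  qed simp
  define lo where "lo t \<longleftrightarrow> (\<exists>q\<ge>1. \<exists>p::int. \<exists>x. real_of_int p < real q * golden_mean \<and> (w t ^^ q) x \<le> x + of_int p)" for t
  define hi where "hi t \<longleftrightarrow> (\<exists>q\<ge>1. \<exists>p::int. \<exists>x. real_of_int p > real q * golden_mean \<and> (w t ^^ q) x \<ge> x + of_int p)" for t
  have pw: "(w t ^^ (q * k)) x = ((w t ^^ q) ^^ k) x" for t q k x
    by (simp add: funpow_mult)
  have "open {t. lo t}"
    unfolding open_contains_ball
  proof
    fix t0 assume "t0 \<in> {t. lo t}"
    then obtain q p x where q: "q \<ge> 1" "real_of_int p < real q * golden_mean" "(w t0 ^^ q) x \<le> x + of_int p"
      unfolding lo_def by blast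
    \<comment> \<open>Iterating \<open>k\<close> times enlarges the margin beyond 1. The weak
      inequality for \<open>p\<close> then implies a strict one for \<open>k * p + 1\<close>, still
      below the golden slope, and strict inequalities are open in \<open>t\<close>.\<close>
    obtain k where k: "1 < real k * (real q * golden_mean - p)"
      using reals_Archimedean3[of "real q * golden_mean - p"] q(2) by auto
    then have k1: "k \<ge> 1" by (cases k) auto
    have "(w t0 ^^ (q * k)) x < x + of_int (int k * p + 1)"
      using mono_shift_iter_le[OF itm its q(3), of k] unfolding pw by simp
    moreover have "open {t. (w t ^^ (q * k)) x < x + of_int (int k * p + 1)}"
      by (intro open_Collect_less itc continuous_on_const)
    ultimately obtain e where e: "e > 0" "ball t0 e \<subseteq> {t. (w t ^^ (q * k)) x < x + of_int (int k * p + 1)}"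
      unfolding open_contains_ball by blast
    have "real_of_int (int k * p + 1) < real (q * k) * golden_mean" using k by (simp add: algebra_simps)
    moreover have "q * k \<ge> 1" using q(1) k1 by simp
    ultimately have "ball t0 e \<subseteq> {t. lo t}" using e(2) unfolding lo_def by (blast intro: less_imp_le)
    then show "\<exists>e>0. ball t0 e \<subseteq> {t. lo t}" using e(1) by blast
  qed
  moreover have "open {t. hi t}"
    unfolding open_contains_ball
  proof
    fix t0 assume "t0 \<in> {t. hi t}"
    then obtain q p x where q: "q \<ge> 1" "real_of_int p > real q * golden_mean" "(w t0 ^^ q) x \<ge> x + of_int p"
      unfolding hi_def by blast
    obtain k where k: "1 < real k * (p - real q * golden_mean)"
      using reals_Archimedean3[of "p - real q * golden_mean"] q(2) by auto
    then have k1: "k \<ge> 1" by (cases k) auto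
    have "(w t0 ^^ (q * k)) x > x + of_int (int k * p - 1)"
      using mono_shift_iter_ge[OF itm its q(3), of k] unfolding pw by simp
    moreover have "open {t. x + of_int (int k * p - 1) < (w t ^^ (q * k)) x}"
      by (intro open_Collect_less itc continuous_on_const)
    ultimately obtain e where e: "e > 0" "ball t0 e \<subseteq> {t. x + of_int (int k * p - 1) < (w t ^^ (q * k)) x}"
      unfolding open_contains_ball by blast
    have "real_of_int (int k * p - 1) > real (q * k) * golden_mean" using k by (simp add: algebra_simps)
    moreover have "q * k \<ge> 1" using q(1) k1 by simp
    ultimately have "ball t0 e \<subseteq> {t. hi t}" using e(2) unfolding hi_def by (blast intro: less_imp_le)
    then show "\<exists>e>0. ball t0 e \<subseteq> {t. hi t}" using e(1) by blast
  qed
  moreover have disj: "\<not> (lo t \<and> hi t)" for t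
  proof
    assume "lo t \<and> hi t"
    then obtain q p x q' p' x' where q: "q \<ge> 1" "real_of_int p < real q * golden_mean" "(w t ^^ q) x \<le> x + of_int p"
      and q': "q' \<ge> 1" "real_of_int p' > real q' * golden_mean" "(w t ^^ q') x' \<ge> x' + of_int p'"
      unfolding lo_def hi_def by blast
    \<comment> \<open>Doubling the common time \<open>q * q'\<close> is enough: the integer
      displacements would then differ by at least 2, against a dispersion of at most 1.\<close>
    define k where "k = (2::nat)"
    have "(w t ^^ (q * (q' * k))) x \<le> x + of_int (int (q' * k) * p)"
      unfolding pw by (rule mono_shift_iter_le[OF itm its q(3)])
    moreover have "(w t ^^ (q' * (q * k))) x' \<ge> x' + of_int (int (q * k) * p')"
      unfolding pw by (rule mono_shift_iter_ge[OF itm its q'(3)])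
    then have "(w t ^^ (q * (q' * k))) x' \<ge> x' + of_int (int (q * k) * p')"
      by (simp only: mult.left_commute)
    moreover have "\<bar>((w t ^^ (q * (q' * k))) x' - x') - ((w t ^^ (q * (q' * k))) x - x)\<bar> \<le> 1"
      by (rule mono_shift_dispersion[OF itm its])
    ultimately have "of_int (int (q * k) * p') - of_int (int (q' * k) * p) \<le> (1::real)"
      unfolding abs_le_iff by linarith
    then have "int (q * k) * p' - int (q' * k) * p \<le> 1" by linarith
    then have "2 * (int q * p') - 2 * (int q' * p) \<le> 1"
      by (simp add: k_def mult_ac)
    moreover have "int q' * p < int q * p'"
    proof -
      have "real q' * p < real q' * (real q * golden_mean)" using q q' by (intro mult_strict_left_mono) auto
      also have "\<dots> = real q * (real q' * golden_mean)" by simp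
      also have "\<dots> < real q * p'" using q q' by (intro mult_strict_left_mono) auto
      finally have "real_of_int (int q' * p) < real_of_int (int q * p')" by simp
      then show ?thesis by (simp only: of_int_less_iff)
    qed
    ultimately show False by linarith
  qed
  moreover have "lo t1" unfolding lo_def using t golden_mean_pos
    by (intro exI[of _ 1] conjI exI[of _ 0] exI[of _ x1]) (auto simp: w_def)
  moreover have "hi t2" unfolding hi_def using t golden_mean_lt_1
    by (intro exI[of _ 1] conjI exI[of _ 1] exI[of _ x2]) (auto simp: w_def)
  moreover have "{t. lo t} \<inter> {t. hi t} \<inter> {t1..t2} = {}" using disj by blast
  moreover have "t1 \<in> {t1..t2}" "t2 \<in> {t1..t2}" using t(1) by auto
  ultimately have "\<not> {t1..t2} \<subseteq> {t. lo t} \<union> {t. hi t}"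
    using connectedD[of "{t1..t2}" "{t. lo t}" "{t. hi t}"] connected_Icc by blast
  then obtain t where tt: "t \<in> {t1..t2}" "\<not> lo t" "\<not> hi t" by blast
  have "golden (w t)"
  proof
    show "smooth (w t)" unfolding w_def by (intro smooth_add sm smooth_const)
    show "w t (x + 1) = w t x + 1" for x by (simp add: w_def shift)
    have "deriv (w t) x = deriv f x" for x
      unfolding w_def using deriv_add_smooth[OF sm smooth_const[of t]] by simp
    then show "deriv (w t) x > 0" for x using pos by simp
    fix n x
    have fp: "fib (Suc n) \<ge> 1" using fib_neq_0_nat[of "Suc n"] by simp
    have gp: "golden_mean ^ Suc n > 0" using golden_mean_pos by simp
    show "(-1) ^ n * ((w t ^^ fib (Suc n)) x - real (fib n) - x) > 0"
    proof (cases "even n")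
      case True
      then have "real_of_int (int (fib n)) < real (fib (Suc n)) * golden_mean"
        using fib_golden[of n] gp by simp
      then have "\<not> (w t ^^ fib (Suc n)) x \<le> x + of_int (int (fib n))"
        using tt(2) fp unfolding lo_def by blast
      then show ?thesis using True by simp
    next
      case False
      then have "real_of_int (int (fib n)) > real (fib (Suc n)) * golden_mean"
        using fib_golden[of n] gp by simp
      then have "\<not> (w t ^^ fib (Suc n)) x \<ge> x + of_int (int (fib n))"
        using tt(3) fp unfolding hi_def by blast
      then show ?thesis using False by simp
    qed
  qed
  then show ?thesis using tt(1) unfolding w_def by blast
qed

section \<open>Real analytic functions\<close>

text \<open>With local holomorphic extensions in place of power series, closure under derivatives,
  sums and inversion comes from complex analysis.\<close>

lemma real_analytic_iff:
  "real_analytic F \<longleftrightarrow> (\<forall>x. \<exists>e>0. \<exists>\<Phi>. \<Phi> holomorphic_on ball (of_real x :: complex) e \<and>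
     (\<forall>y. \<bar>y - x\<bar> < e \<longrightarrow> \<Phi> (of_real y) = of_real (F y)))"
  unfolding real_analytic_def
proof (intro all_cong1 iffI)
  fix x assume "\<exists>a e. e > 0 \<and> (\<forall>y. \<bar>y - x\<bar> < e \<longrightarrow> (\<lambda>n. a n * (y - x) ^ n) sums F y)"
  then obtain a e where e: "e > 0" and s: "\<And>y. \<bar>y - x\<bar> < e \<Longrightarrow> (\<lambda>n. a n * (y - x) ^ n) sums F y" by blast
  define \<Phi> where "\<Phi> w = (\<Sum>n. complex_of_real (a n) * (w - of_real x) ^ n)" for w
  have "(\<lambda>n. complex_of_real (a n) * (w - of_real x) ^ n) sums \<Phi> w" if w: "w \<in> ball (of_real x) e" for w
  proof -
    have "norm (w - of_real x) < e" using w by (simp add: dist_norm norm_minus_commute)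
    then obtain r where r: "norm (w - of_real x) < r" "r < e" using dense by blast
    then have r0: "r > 0" by (meson norm_ge_zero le_less_trans)
    have "summable (\<lambda>n. a n * r ^ n)" using s[of "x + r"] r r0 by (auto simp: sums_iff)
    then have "summable (\<lambda>n. complex_of_real (a n * r ^ n))" by (rule summable_of_real)
    then have "summable (\<lambda>n. complex_of_real (a n) * (of_real r) ^ n)" by simp
    then have "summable (\<lambda>n. complex_of_real (a n) * (w - of_real x) ^ n)"
      by (rule powser_inside) (use r r0 in auto)
    then show ?thesis unfolding \<Phi>_def by (rule summable_sums)
  qed
  then have "\<Phi> holomorphic_on ball (of_real x) e" by (rule power_series_holomorphic)
  moreover have "\<Phi> (of_real y) = of_real (F y)" if "\<bar>y - x\<bar> < e" for y
  proof -
    have "(\<lambda>n. complex_of_real (a n * (y - x) ^ n)) sums of_real (F y)"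
      using s[OF that] by (rule sums_of_real)
    then show ?thesis unfolding \<Phi>_def by (simp add: sums_iff)
  qed
  ultimately show "\<exists>e>0. \<exists>\<Phi>. \<Phi> holomorphic_on ball (of_real x) e \<and> (\<forall>y. \<bar>y - x\<bar> < e \<longrightarrow> \<Phi> (of_real y) = of_real (F y))"
    using e by blast
next
  fix x assume "\<exists>e>0. \<exists>\<Phi>. \<Phi> holomorphic_on ball (complex_of_real x) e \<and> (\<forall>y. \<bar>y - x\<bar> < e \<longrightarrow> \<Phi> (of_real y) = of_real (F y))"
  then obtain e \<Phi> where e: "e > 0" "\<Phi> holomorphic_on ball (complex_of_real x) e"
    "\<And>y. \<bar>y - x\<bar> < e \<Longrightarrow> \<Phi> (of_real y) = of_real (F y)" by blast
  have "(\<lambda>n. Re ((deriv ^^ n) \<Phi> (of_real x) / fact n) * (y - x) ^ n) sums F y" if y: "\<bar>y - x\<bar> < e" for y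
  proof -
    have "complex_of_real y \<in> ball (of_real x) e" using y by (simp add: dist_norm norm_minus_commute flip: of_real_diff)
    from holomorphic_power_series[OF e(2) this]
    have "(\<lambda>n. Re ((deriv ^^ n) \<Phi> (of_real x) / fact n * (of_real y - of_real x) ^ n)) sums Re (of_real (F y))"
      unfolding e(3)[OF y] by (rule sums_Re)
    moreover have "Re (c * (of_real y - of_real x) ^ n) = Re c * (y - x) ^ n" for c n
      by (simp flip: of_real_diff of_real_power)
    ultimately show ?thesis by (simp only: Re_complex_of_real)
  qed
  then show "\<exists>a e. e > 0 \<and> (\<forall>y. \<bar>y - x\<bar> < e \<longrightarrow> (\<lambda>n. a n * (y - x) ^ n) sums F y)"
    using e(1) by (intro exI conjI) auto
qed

text \<open>The complex derivative is taken along the real line; its imaginary part is the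
  derivative of the zero function.\<close>

lemma real_extension_deriv:
  assumes hol: "\<Phi> holomorphic_on ball (complex_of_real x) e"
    and F: "\<And>y. \<bar>y - x\<bar> < e \<Longrightarrow> \<Phi> (of_real y) = of_real (F y)" and y: "\<bar>y - x\<bar> < e"
  shows "(F has_real_derivative deriv F y) (at y)" "deriv \<Phi> (of_real y) = of_real (deriv F y)"
proof -
  define d where "d = deriv \<Phi> (of_real y)"
  have yb: "complex_of_real y \<in> ball (of_real x) e" using y by (simp add: dist_norm norm_minus_commute flip: of_real_diff)
  have "(\<Phi> has_field_derivative d) (at (of_real y))"
    unfolding d_def using holomorphic_derivI[OF hol open_ball yb] .
  then have v: "((\<lambda>x. \<Phi> (of_real x)) has_vector_derivative d) (at y)"
    by (rule has_vector_derivative_real_field)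
  have v': "((\<lambda>x. complex_of_real (F x)) has_vector_derivative d) (at y)"
  proof (rule has_vector_derivative_transform_within_open[OF v])
    show "open (ball x e)" "y \<in> ball x e" using y by (auto simp: dist_real_def abs_minus_commute)
    show "\<Phi> (of_real z) = of_real (F z)" if "z \<in> ball x e" for z
      using that by (intro F) (auto simp: dist_real_def abs_minus_commute)
  qed
  have "((\<lambda>x. Re (complex_of_real (F x))) has_vector_derivative Re d) (at y)"
    by (rule bounded_linear.has_vector_derivative[OF bounded_linear_Re v'])
  then have r: "(F has_real_derivative Re d) (at y)" by (simp add: has_real_derivative_iff_has_vector_derivative)
  have "((\<lambda>x. Im (complex_of_real (F x))) has_vector_derivative Im d) (at y)"
    by (rule bounded_linear.has_vector_derivative[OF bounded_linear_Im v'])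
  then have "((\<lambda>x. 0 :: real) has_real_derivative Im d) (at y)"
    by (simp add: has_real_derivative_iff_has_vector_derivative)
  then have "Im d = 0" using DERIV_unique[OF _ DERIV_const] by blast
  moreover have "deriv F y = Re d" using r by (rule DERIV_imp_deriv)
  ultimately show "(F has_real_derivative deriv F y) (at y)" "deriv \<Phi> (of_real y) = of_real (deriv F y)"
    using r by (auto simp: d_def complex_eq_iff)
qed

lemma real_analytic_DERIV:
  assumes "real_analytic F"
  shows "(F has_real_derivative deriv F x) (at x)"
proof -
  obtain e \<Phi> where "e > 0" "\<Phi> holomorphic_on ball (complex_of_real x) e"
    "\<And>y. \<bar>y - x\<bar> < e \<Longrightarrow> \<Phi> (of_real y) = of_real (F y)" using assms unfolding real_analytic_iff by blast
  from real_extension_deriv(1)[OF this(2,3), of x] this(1) show ?thesis by simp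
qed

lemma real_analytic_deriv:
  assumes "real_analytic F"
  shows "real_analytic (deriv F)"
  unfolding real_analytic_iff
proof
  fix x
  obtain e \<Phi> where e: "e > 0" "\<Phi> holomorphic_on ball (complex_of_real x) e"
    "\<And>y. \<bar>y - x\<bar> < e \<Longrightarrow> \<Phi> (of_real y) = of_real (F y)" using assms unfolding real_analytic_iff by blast
  then show "\<exists>e>0. \<exists>\<Phi>. \<Phi> holomorphic_on ball (complex_of_real x) e \<and>
      (\<forall>y. \<bar>y - x\<bar> < e \<longrightarrow> \<Phi> (of_real y) = of_real (deriv F y))"
    using real_extension_deriv(2)[OF e(2,3)] holomorphic_deriv[OF e(2) open_ball]
    by (intro exI[of _ e] conjI exI[of _ "deriv \<Phi>"]) auto
qed

lemma real_analytic_smooth: "real_analytic F \<Longrightarrow> smooth F"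
proof -
  assume "real_analytic F"
  then have "diffk k F" for k
  proof (induction k arbitrary: F)
    case (Suc k)
    then show ?case using real_analytic_DERIV[OF Suc.prems] real_analytic_deriv[OF Suc.prems]
      by (auto simp: real_differentiable_def)
  qed simp
  then show ?thesis by (simp add: smooth_def)
qed

lemma real_analytic_add:
  assumes "real_analytic F" "real_analytic G"
  shows "real_analytic (\<lambda>x. F x + G x)"
  unfolding real_analytic_iff
proof
  fix x
  obtain e \<Phi> where e: "e > 0" "\<Phi> holomorphic_on ball (complex_of_real x) e"
    "\<And>y. \<bar>y - x\<bar> < e \<Longrightarrow> \<Phi> (of_real y) = of_real (F y)" using assms(1) unfolding real_analytic_iff by blast
  obtain d \<Psi> where d: "d > 0" "\<Psi> holomorphic_on ball (complex_of_real x) d"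
    "\<And>y. \<bar>y - x\<bar> < d \<Longrightarrow> \<Psi> (of_real y) = of_real (G y)" using assms(2) unfolding real_analytic_iff by blast
  show "\<exists>e>0. \<exists>\<Phi>. \<Phi> holomorphic_on ball (complex_of_real x) e \<and>
      (\<forall>y. \<bar>y - x\<bar> < e \<longrightarrow> \<Phi> (of_real y) = of_real (F y + G y))"
  proof (intro exI conjI)
    show "(\<lambda>z. \<Phi> z + \<Psi> z) holomorphic_on ball (complex_of_real x) (min e d)"
      by (intro holomorphic_intros holomorphic_on_subset[OF e(2)] holomorphic_on_subset[OF d(2)]) auto
  qed (use e d in auto)
qed

lemma real_analytic_entire:
  assumes "\<Phi> holomorphic_on UNIV" "\<And>x. \<Phi> (of_real x) = of_real (F x)"
  shows "real_analytic F"
  unfolding real_analytic_iff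
  using holomorphic_on_subset[OF assms(1) subset_UNIV] assms(2)
  by (intro allI exI[of _ 1] conjI exI[of _ \<Phi>]) auto

text \<open>The extension \<open>\<Phi>\<close> has nonzero derivative on the real axis, hence a
  local holomorphic inverse; continuity of \<open>H\<close> keeps \<open>H y\<close> in the ball
  where \<open>\<Phi>\<close> is injective, so this inverse extends \<open>H\<close>.\<close>

lemma real_analytic_inv:
  assumes F: "real_analytic F" and pos: "\<And>x. deriv F x > 0" and fg: "\<And>x. F (H x) = x" and gf: "\<And>x. H (F x) = x"
  shows "real_analytic H"
  unfolding real_analytic_iff
proof
  fix y0
  define x0 where "x0 = H y0"
  obtain e \<Phi> where e: "e > 0" and hol: "\<Phi> holomorphic_on ball (complex_of_real x0) e"
    and ext: "\<And>y. \<bar>y - x0\<bar> < e \<Longrightarrow> \<Phi> (of_real y) = of_real (F y)"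
    using F unfolding real_analytic_iff by blast
  have "deriv \<Phi> (of_real x0) \<noteq> 0"
    using real_extension_deriv(2)[OF hol ext, of x0] e pos[of x0] by auto
  then obtain r where r: "r > 0" "ball (complex_of_real x0) r \<subseteq> ball (complex_of_real x0) e" "inj_on \<Phi> (ball (of_real x0) r)"
    using has_complex_derivative_locally_injective[OF hol _ open_ball] e by (metis centre_in_ball)
  have hol': "\<Phi> holomorphic_on ball (of_real x0) r" using hol r(2) by (rule holomorphic_on_subset)
  obtain \<Gamma> where \<Gamma>: "\<Gamma> holomorphic_on \<Phi> ` ball (of_real x0) r" "\<And>z. z \<in> ball (of_real x0) r \<Longrightarrow> \<Gamma> (\<Phi> z) = z"
    using holomorphic_has_inverse[OF hol' open_ball r(3)] by metis
  have "open (\<Phi> ` ball (of_real x0) r)" by (rule open_mapping_thm3[OF hol' open_ball r(3)])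
  moreover have "of_real y0 \<in> \<Phi> ` ball (of_real x0) r"
    using ext[of x0] e r(1) fg[of y0] by (auto simp: x0_def intro!: rev_image_eqI[of "of_real (H y0)"])
  ultimately obtain d where d: "d > 0" "ball (of_real y0) d \<subseteq> \<Phi> ` ball (of_real x0) r"
    using open_contains_ball by blast
  have "isCont H y0"
    using smooth_isCont[OF smooth_inv(1)[OF real_analytic_smooth[OF F] pos fg gf]] .
  then obtain d' where d': "d' > 0" "\<And>y. \<bar>y - y0\<bar> < d' \<Longrightarrow> \<bar>H y - x0\<bar> < min r e"
  proof -
    have "\<exists>d>0. \<forall>y. dist y y0 < d \<longrightarrow> dist (H y) (H y0) < min r e"
    proof -
      have "0 < min r e" using e r(1) by simp
      then show ?thesis using \<open>isCont H y0\<close> unfolding continuous_at_eps_delta by blast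
    qed
    then show ?thesis using that by (auto simp: dist_real_def x0_def)
  qed
  show "\<exists>e>0. \<exists>\<Phi>. \<Phi> holomorphic_on ball (complex_of_real y0) e \<and> (\<forall>y. \<bar>y - y0\<bar> < e \<longrightarrow> \<Phi> (of_real y) = of_real (H y))"
  proof (intro exI conjI allI impI)
    show "\<Gamma> holomorphic_on ball (of_real y0) (min d d')"
      by (rule holomorphic_on_subset[OF \<Gamma>(1)]) (use d in auto)
    fix y assume "\<bar>y - y0\<bar> < min d d'"
    then have Hy: "\<bar>H y - x0\<bar> < min r e" using d' by auto
    then have "\<Phi> (of_real (H y)) = of_real y" using ext[of "H y"] fg by simp
    moreover have "complex_of_real (H y) \<in> ball (of_real x0) r"
      using Hy by (simp add: dist_norm abs_minus_commute flip: of_real_diff)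
    ultimately show "\<Gamma> (of_real y) = of_real (H y)" using \<Gamma>(2) by metis
  qed (use d d' in auto)
qed

section \<open>Trigonometric approximation\<close>

text \<open>Trigonometric polynomials without constant term. The constant is split off in
  \<open>trig\<close> because a nonzero one has no periodic antiderivative.\<close>

inductive trig0 :: "(real \<Rightarrow> real) \<Rightarrow> bool" where
  zero: "trig0 (\<lambda>x. 0)"
| cos: "k > 0 \<Longrightarrow> trig0 (\<lambda>x. a * cos (2 * pi * real k * x))"
| sin: "k > 0 \<Longrightarrow> trig0 (\<lambda>x. a * sin (2 * pi * real k * x))"
| add: "trig0 u \<Longrightarrow> trig0 v \<Longrightarrow> trig0 (\<lambda>x. u x + v x)"

definition trig :: "(real \<Rightarrow> real) \<Rightarrow> bool" where
  "trig u \<longleftrightarrow> (\<exists>c v. trig0 v \<and> u = (\<lambda>x. c + v x))"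

lemma trig0_trig: "trig0 v \<Longrightarrow> trig v"
  unfolding trig_def by (intro exI[of _ 0] exI[of _ v]) auto

lemma trig_const: "trig (\<lambda>x. c)"
  unfolding trig_def using trig0.zero by (intro exI[of _ c] exI[of _ "\<lambda>x. 0"]) auto

lemma trig_add:
  assumes "trig u" "trig v"
  shows "trig (\<lambda>x. u x + v x)"
proof -
  obtain c u0 d v0 where "trig0 u0" "u = (\<lambda>x. c + u0 x)" "trig0 v0" "v = (\<lambda>x. d + v0 x)"
    using assms unfolding trig_def by blast
  then show ?thesis unfolding trig_def
    by (intro exI[of _ "c + d"] exI[of _ "\<lambda>x. u0 x + v0 x"]) (auto intro: trig0.add)
qed

lemma trig_cos_int: "trig (\<lambda>x. a * cos (2 * pi * real_of_int k * x))"
proof (cases "k = 0")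
  case True
  then show ?thesis using trig_const[of a] by simp
next
  case False
  have "trig (\<lambda>x. a * cos (2 * pi * real (nat \<bar>k\<bar>) * x))"
    using False by (intro trig0_trig trig0.cos) auto
  moreover have "cos (2 * pi * real (nat \<bar>k\<bar>) * x) = cos (2 * pi * real_of_int k * x)" for x
    by (cases "k \<ge> 0") auto
  ultimately show ?thesis by simp
qed

lemma trig_sin_int: "trig (\<lambda>x. a * sin (2 * pi * real_of_int k * x))"
proof (cases "k = 0")
  case True
  then show ?thesis using trig_const[of 0] by simp
next
  case False
  have "trig (\<lambda>x. (a * of_int (sgn k)) * sin (2 * pi * real (nat \<bar>k\<bar>) * x))"
    using False by (intro trig0_trig trig0.sin) auto
  moreover have "of_int (sgn k) * sin (2 * pi * real (nat \<bar>k\<bar>) * x) = sin (2 * pi * real_of_int k * x)" for x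
    using False by (cases "k \<ge> 0") auto
  ultimately show ?thesis by (simp add: mult.assoc)
qed

lemma trig0_cmult: "trig0 v \<Longrightarrow> trig0 (\<lambda>x. c * v x)"
proof (induction rule: trig0.induct)
  case (cos k a)
  then show ?case using trig0.cos[of k "c * a"] by (simp add: mult.assoc)
next
  case (sin k a)
  then show ?case using trig0.sin[of k "c * a"] by (simp add: mult.assoc)
next
  case (add u v)
  then show ?case using trig0.add by (simp add: distrib_left)
qed (use trig0.zero in simp)

lemma trig_cmult:
  assumes "trig v"
  shows "trig (\<lambda>x. c * v x)"
proof -
  obtain d v0 where "trig0 v0" "v = (\<lambda>x. d + v0 x)" using assms unfolding trig_def by blast
  then show ?thesis unfolding trig_def using trig0_cmult[of v0 c]
    by (intro exI[of _ "c * d"] exI[of _ "\<lambda>x. c * v0 x"]) (auto simp: distrib_left)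
qed

lemma trig_cos_mult:
  assumes "trig0 v"
  shows "trig (\<lambda>x. a * cos (2 * pi * real k * x) * v x)"
  using assms
proof (induction rule: trig0.induct)
  case (cos l b)
  have "a * cos (2 * pi * real k * x) * (b * cos (2 * pi * real l * x))
     = a * b / 2 * cos (2 * pi * of_int (int k - int l) * x) + a * b / 2 * cos (2 * pi * of_int (int k + int l) * x)" for x
    by (simp add: algebra_simps cos_diff cos_add)
  then show ?case using trig_add[OF trig_cos_int trig_cos_int] by presburger
next
  case (sin l b)
  have "a * cos (2 * pi * real k * x) * (b * sin (2 * pi * real l * x))
     = a * b / 2 * sin (2 * pi * of_int (int l - int k) * x) + a * b / 2 * sin (2 * pi * of_int (int k + int l) * x)" for x
    by (simp add: algebra_simps sin_diff sin_add)
  then show ?case using trig_add[OF trig_sin_int trig_sin_int] by presburger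
next
  case (add u v)
  then show ?case using trig_add by (simp add: distrib_left)
qed (use trig_const[of 0] in simp)

lemma trig_sin_mult:
  assumes "trig0 v"
  shows "trig (\<lambda>x. a * sin (2 * pi * real k * x) * v x)"
  using assms
proof (induction rule: trig0.induct)
  case (cos l b)
  have "a * sin (2 * pi * real k * x) * (b * cos (2 * pi * real l * x))
     = a * b / 2 * sin (2 * pi * of_int (int k - int l) * x) + a * b / 2 * sin (2 * pi * of_int (int k + int l) * x)" for x
    by (simp add: algebra_simps sin_diff sin_add)
  then show ?case using trig_add[OF trig_sin_int trig_sin_int] by presburger
next
  case (sin l b)
  have "a * sin (2 * pi * real k * x) * (b * sin (2 * pi * real l * x))
     = a * b / 2 * cos (2 * pi * of_int (int k - int l) * x) + (- (a * b / 2)) * cos (2 * pi * of_int (int k + int l) * x)" for x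
    by (simp add: algebra_simps cos_diff cos_add)
  then show ?case using trig_add[OF trig_cos_int trig_cos_int] by presburger
next
  case (add u v)
  then show ?case using trig_add by (simp add: distrib_left)
qed (use trig_const[of 0] in simp)

lemma trig0_mult: "trig0 u \<Longrightarrow> trig0 v \<Longrightarrow> trig (\<lambda>x. u x * v x)"
proof (induction rule: trig0.induct)
  case (add u w)
  then show ?case using trig_add by (simp add: distrib_right)
qed (use trig_const[of 0] trig_cos_mult trig_sin_mult in auto)

lemma trig_mult:
  assumes "trig u" "trig v"
  shows "trig (\<lambda>x. u x * v x)"
proof -
  obtain c u0 d v0 where *: "trig0 u0" "u = (\<lambda>x. c + u0 x)" "trig0 v0" "v = (\<lambda>x. d + v0 x)"
    using assms unfolding trig_def by blast
  have "trig (\<lambda>x. c * v x + (d * u0 x + u0 x * v0 x))"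
    by (intro trig_add trig_cmult trig0_trig[OF *(1)] trig0_mult * assms)
  moreover have "(\<lambda>x. c * v x + (d * u0 x + u0 x * v0 x)) = (\<lambda>x. u x * v x)"
    by (auto simp: * algebra_simps)
  ultimately show ?thesis by simp
qed

lemma trig_periodic: "trig u \<Longrightarrow> periodic u"
proof -
  have "periodic v" if "trig0 v" for v
    using that
  proof (induction rule: trig0.induct)
    case (cos k a)
    have "cos (2 * pi * real k * (x + 1)) = cos (2 * pi * real k * x)" for x
      using cos.plus_of_nat[of "2 * pi * real k * x" k] by (simp add: algebra_simps)
    then show ?case by (simp add: periodic_def)
  next
    case (sin k a)
    have "sin (2 * pi * real k * (x + 1)) = sin (2 * pi * real k * x)" for x
      using sin.plus_of_nat[of "2 * pi * real k * x" k] by (simp add: algebra_simps)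
    then show ?case by (simp add: periodic_def)
  qed (auto simp: periodic_def)
  then show "trig u \<Longrightarrow> periodic u" unfolding trig_def by (auto simp: periodic_def)
qed

lemma norm_exp_le: "norm (exp (\<i> * z)) \<le> exp \<bar>Im z\<bar>" "norm (exp (- (\<i> * z))) \<le> exp \<bar>Im z\<bar>" for z :: complex
  by (simp_all add: norm_exp_eq_Re)

lemma norm_cos_sin_le: "norm (cos z) \<le> exp \<bar>Im z\<bar>" "norm (sin z) \<le> exp \<bar>Im z\<bar>" for z :: complex
proof -
  have "norm (exp (\<i> * z) + exp (- (\<i> * z))) \<le> 2 * exp \<bar>Im z\<bar>"
    using norm_triangle_ineq[of "exp (\<i> * z)" "exp (- (\<i> * z))"] norm_exp_le[of z] by linarith
  then show "norm (cos z) \<le> exp \<bar>Im z\<bar>" by (simp add: cos_exp_eq norm_divide)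
  have "norm (exp (\<i> * z) - exp (- (\<i> * z))) \<le> 2 * exp \<bar>Im z\<bar>"
    using norm_triangle_ineq4[of "exp (\<i> * z)" "exp (- (\<i> * z))"] norm_exp_le[of z] by linarith
  then show "norm (sin z) \<le> exp \<bar>Im z\<bar>" by (simp add: sin_exp_eq norm_divide norm_mult)
qed

text \<open>The bound on a strip is what makes small multiples of a trigonometric polynomial small
  for \<open>close_omega\<close>; it comes from the growth of sine and cosine with the imaginary
  part.\<close>

lemma trig_entire:
  assumes "trig u"
  obtains \<Phi> M where "\<Phi> holomorphic_on UNIV" "\<And>x. \<Phi> (of_real x) = complex_of_real (u x)"
    "\<And>z. z \<in> strip 1 \<Longrightarrow> norm (\<Phi> z) \<le> M"
proof -
  have b: "norm (of_real a * w) \<le> \<bar>a\<bar> * exp c" if "norm w \<le> exp \<bar>Im (of_real c * z)\<bar>" "\<bar>Im z\<bar> < 1" "c \<ge> 0"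
    for a c :: real and w z :: complex
  proof -
    have "c * \<bar>Im z\<bar> \<le> c" using that by (simp add: mult_left_le)
    then have "norm w \<le> exp c" using that by (simp add: abs_mult) (meson exp_le_cancel_iff order_trans)
    then show ?thesis by (simp add: norm_mult mult_left_mono)
  qed
  have "\<exists>\<Phi> M. \<Phi> holomorphic_on UNIV \<and> (\<forall>x. \<Phi> (of_real x) = complex_of_real (v x)) \<and> (\<forall>z\<in>strip 1. norm (\<Phi> z) \<le> M)"
    if "trig0 v" for v
    using that
  proof (induction rule: trig0.induct)
    case zero
    show ?case by (intro exI[of _ "\<lambda>z. 0"] exI[of _ 0]) auto
  next
    case (cos k a)
    show ?case
      by (intro exI[of _ "\<lambda>z. of_real a * cos (of_real (2 * pi * real k) * z)"]
          exI[of _ "\<bar>a\<bar> * exp (2 * pi * real k)"] conjI allI ballI b[OF norm_cos_sin_le(1)])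
        (auto intro!: holomorphic_intros simp: strip_def simp flip: cos_of_real)
  next
    case (sin k a)
    show ?case
      by (intro exI[of _ "\<lambda>z. of_real a * sin (of_real (2 * pi * real k) * z)"]
          exI[of _ "\<bar>a\<bar> * exp (2 * pi * real k)"] conjI allI ballI b[OF norm_cos_sin_le(2)])
        (auto intro!: holomorphic_intros simp: strip_def simp flip: sin_of_real)
  next
    case (add u v)
    then obtain \<Phi> M \<Psi> N where "\<Phi> holomorphic_on UNIV" "\<forall>x. \<Phi> (of_real x) = complex_of_real (u x)"
       "\<Psi> holomorphic_on UNIV" "\<forall>x. \<Psi> (of_real x) = complex_of_real (v x)"
       "\<forall>z\<in>strip 1. norm (\<Phi> z) \<le> M" "\<forall>z\<in>strip 1. norm (\<Psi> z) \<le> N" by blast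
    then show ?case by (intro exI[of _ "\<lambda>z. \<Phi> z + \<Psi> z"] exI[of _ "M + N"])
      (auto intro!: holomorphic_intros norm_triangle_mono)
  qed
  moreover obtain c v where v: "trig0 v" "u = (\<lambda>x. c + v x)" using assms unfolding trig_def by blast
  ultimately obtain \<Phi> M where \<Phi>: "\<Phi> holomorphic_on UNIV" "\<forall>x. \<Phi> (of_real x) = complex_of_real (v x)"
    "\<forall>z\<in>strip 1. norm (\<Phi> z) \<le> M" by blast
  show ?thesis
  proof (rule that)
    show "(\<lambda>z. of_real c + \<Phi> z) holomorphic_on UNIV" using \<Phi> by (auto intro!: holomorphic_intros)
    show "of_real c + \<Phi> (of_real x) = complex_of_real (u x)" for x using \<Phi> v by simp
    show "norm (of_real c + \<Phi> z) \<le> \<bar>c\<bar> + M" if "z \<in> strip 1" for z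
      using \<Phi>(3) that by (intro norm_triangle_mono) auto
  qed
qed

lemma trig_analytic: "trig u \<Longrightarrow> real_analytic u"
  by (erule trig_entire) (rule real_analytic_entire)

lemma trig_smooth: "trig u \<Longrightarrow> smooth u"
  using trig_analytic real_analytic_smooth by blast

section \<open>Density of trigonometric polynomials\<close>

lemma trig0_antideriv: "trig0 v \<Longrightarrow> \<exists>w. trig0 w \<and> (\<forall>x. (w has_real_derivative v x) (at x))"
proof (induction rule: trig0.induct)
  case zero
  show ?case by (intro exI[of _ "\<lambda>x. 0"]) (auto intro: trig0.zero)
next
  case (cos k a)
  have "((\<lambda>x. a / (2 * pi * real k) * sin (2 * pi * real k * x)) has_real_derivative a * cos (2 * pi * real k * x)) (at x)" for x
    using cos.hyps by (auto intro!: derivative_eq_intros)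
  then show ?case using trig0.sin[OF cos.hyps, of "a / (2 * pi * real k)"] by blast
next
  case (sin k a)
  have "((\<lambda>x. - a / (2 * pi * real k) * cos (2 * pi * real k * x)) has_real_derivative a * sin (2 * pi * real k * x)) (at x)" for x
    using sin.hyps by (auto intro!: derivative_eq_intros)
  then show ?case using trig0.cos[OF sin.hyps, of "- a / (2 * pi * real k)"] by blast
next
  case (add u v)
  then obtain w z where "trig0 w" "\<forall>x. (w has_real_derivative u x) (at x)" "trig0 z" "\<forall>x. (z has_real_derivative v x) (at x)"
    by blast
  then show ?case by (intro exI[of _ "\<lambda>x. w x + z x"]) (auto intro!: trig0.add DERIV_add)
qed

lemma periodic_on_circle:
  assumes per: "periodic \<phi>" and cont: "continuous_on UNIV \<phi>"
  shows "continuous_on (sphere 0 1) (\<lambda>z::complex. \<phi> (Arg z / (2 * pi)))"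
proof (rule continuous_at_imp_continuous_on, rule ballI)
  fix z :: complex assume z: "z \<in> sphere 0 1"
  have c: "isCont \<phi> y" for y using cont by (simp add: continuous_on_eq_continuous_at)
  show "isCont (\<lambda>z. \<phi> (Arg z / (2 * pi))) z"
  proof (cases "z \<in> \<real>\<^sub>\<le>\<^sub>0")
    case False
    have "isCont (\<lambda>z. Arg z / (2 * pi)) z" by (intro continuous_intros continuous_at_Arg False) auto
    then show ?thesis by (rule isCont_o2[where g = \<phi>]) (rule c)
  next
    case True
    have nz: "z \<noteq> 0" using z by auto
    then have nz': "- z \<notin> \<real>\<^sub>\<le>\<^sub>0" using True by (auto simp: complex_nonpos_Reals_iff complex_eq_iff)
    \<comment> \<open>At the cut of \<open>Arg\<close> the half-turned branch
      \<open>Arg (- w)\<close> is continuous; after scaling, the two branches differ by an integer,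
      which periodicity ignores.\<close>
    have eq: "\<phi> (Arg w / (2 * pi)) = \<phi> (Arg (- w) / (2 * pi) + 1 / 2)" if "w \<noteq> 0" for w
    proof -
      have "Arg (- w) / (2 * pi) + 1 / 2 = (if Arg w \<le> 0 then Arg w / (2 * pi) + 1 else Arg w / (2 * pi))"
        unfolding Arg_minus[OF that] by (simp add: field_simps)
      then show ?thesis using per by (simp add: periodic_def)
    qed
    have "isCont (\<lambda>w. \<phi> (Arg (- w) / (2 * pi) + 1 / 2)) z"
    proof (rule isCont_o2[where g = \<phi>, OF _ c])
      have "isCont (\<lambda>w. Arg (- w)) z"
        by (rule isCont_o2[where g = Arg and f = uminus]) (auto intro!: continuous_intros, rule continuous_at_Arg[OF nz'])
      then show "isCont (\<lambda>w. Arg (- w) / (2 * pi) + 1 / 2) z" by (intro continuous_intros) auto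
    qed
    moreover have "\<forall>\<^sub>F w in nhds z. w \<in> - {0}"
      by (rule eventually_nhds_in_open) (use nz in auto)
    then have "\<forall>\<^sub>F w in nhds z. \<phi> (Arg w / (2 * pi)) = \<phi> (Arg (- w) / (2 * pi) + 1 / 2)"
      by (rule eventually_mono) (use eq in auto)
    then have "isCont (\<lambda>w. \<phi> (Arg w / (2 * pi))) z \<longleftrightarrow> isCont (\<lambda>w. \<phi> (Arg (- w) / (2 * pi) + 1 / 2)) z"
      by (rule isCont_cong)
    with \<open>isCont (\<lambda>w. \<phi> (Arg (- w) / (2 * pi) + 1 / 2)) z\<close> show ?thesis by blast
  qed
qed

lemma trig_dense_C0:
  assumes per: "periodic \<phi>" and cont: "continuous_on UNIV \<phi>" and e: "e > 0"
  shows "\<exists>T. trig T \<and> (\<forall>x. \<bar>\<phi> x - T x\<bar> < e)"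
proof -
  define P where "P g \<longleftrightarrow> continuous_on UNIV g \<and> trig (\<lambda>x. g (cis (2 * pi * x)))" for g :: "complex \<Rightarrow> real"
  have "\<exists>g. P g \<and> (\<forall>z\<in>sphere 0 1. \<bar>\<phi> (Arg z / (2 * pi)) - g z\<bar> < e)"
  proof (rule Stone_Weierstrass_HOL)
    show "P (\<lambda>x. c)" for c by (simp add: P_def trig_const)
    show "P g \<Longrightarrow> continuous_on (sphere 0 1) g" for g
      unfolding P_def using continuous_on_subset by blast
    show "P f \<and> P g \<Longrightarrow> P (\<lambda>x. f x + g x)" "P f \<and> P g \<Longrightarrow> P (\<lambda>x. f x * g x)" for f g
      unfolding P_def by (auto intro!: continuous_intros trig_add trig_mult)
    have "P Re" "P Im"
      using trig_cos_int[of 1 1] trig_sin_int[of 1 1] by (auto simp: P_def intro!: continuous_intros)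
    then show "\<exists>f. P f \<and> f x \<noteq> f y" if "x \<in> sphere 0 1 \<and> y \<in> sphere 0 1 \<and> x \<noteq> y" for x y
      using that complex_eqI by blast
  qed (use periodic_on_circle[OF per cont] e in auto)
  then obtain g where g: "P g" "\<And>z. z \<in> sphere 0 1 \<Longrightarrow> \<bar>\<phi> (Arg z / (2 * pi)) - g z\<bar> < e" by blast
  have "\<bar>\<phi> x - g (cis (2 * pi * x))\<bar> < e" for x
  proof -
    have "cis (Arg (cis (2 * pi * x))) = cis (2 * pi * x)" by (simp add: cis_Arg)
    then have "sin (Arg (cis (2 * pi * x))) = sin (2 * pi * x) \<and> cos (Arg (cis (2 * pi * x))) = cos (2 * pi * x)"
      by (simp add: complex_eq_iff)
    then obtain n :: int where "Arg (cis (2 * pi * x)) = 2 * pi * x + 2 * pi * of_int n"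
      unfolding sin_cos_eq_iff by blast
    then have "Arg (cis (2 * pi * x)) / (2 * pi) = x + of_int n" by (simp add: field_simps)
    then show ?thesis using g(2)[of "cis (2 * pi * x)"] by (simp only: periodic_int[OF per]) simp
  qed
  then show ?thesis using g(1) unfolding P_def by blast
qed

lemma class_C_Suc:
  "class_C (enat (Suc s)) u \<Longrightarrow> class_C (enat s) (deriv u) \<and> (\<forall>x. (u has_real_derivative deriv u x) (at x))"
proof -
  assume u: "class_C (enat (Suc s)) u"
  have d: "(deriv ^^ k) u differentiable (at x)" if "k < Suc s" for k x
    using u that unfolding class_C_def by simp
  have c: "continuous_on UNIV ((deriv ^^ k) u)" if "k \<le> Suc s" for k
    using u that unfolding class_C_def by simp
  have e: "(deriv ^^ k) (deriv u) = (deriv ^^ Suc k) u" for k by (simp add: funpow_swap1)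
  have "class_C (enat s) (deriv u)"
    unfolding class_C_def e using d[of "Suc k" for k] c[of "Suc k" for k] by simp
  then show ?thesis using d[of 0] by (auto simp: DERIV_deriv_iff_real_differentiable)
qed

text \<open>A trigonometric approximation of the derivative is integrated. Its constant term would
  spoil periodicity, so it is dropped; the value at 0 fixes the constant of integration.\<close>

lemma trig_dense:
  assumes "class_C (enat s) \<phi>" "periodic \<phi>" "e > 0"
  shows "\<exists>T. trig T \<and> (\<forall>k\<le>s. \<forall>x. \<bar>(deriv ^^ k) \<phi> x - (deriv ^^ k) T x\<bar> < e)"
  using assms
proof (induction s arbitrary: \<phi> e)
  case 0
  have "continuous_on UNIV \<phi>" using 0(1) by (auto simp: class_C_def zero_enat_def)
  from trig_dense_C0[OF 0(2) this 0(3)] show ?case by auto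
next
  case (Suc s)
  have c: "class_C (enat s) (deriv \<phi>)" and d: "\<And>x. (\<phi> has_real_derivative deriv \<phi> x) (at x)"
    using class_C_Suc[OF Suc.prems(1)] by auto
  have "periodic (deriv \<phi>)"
    unfolding periodic_def
  proof
    fix x
    have "((\<lambda>y. \<phi> (y + 1)) has_real_derivative deriv \<phi> (x + 1) * 1) (at x)"
      by (rule DERIV_chain2[OF d]) (auto intro!: derivative_eq_intros)
    moreover have "(\<lambda>y. \<phi> (y + 1)) = \<phi>" using Suc.prems(2) by (auto simp: periodic_def)
    ultimately have "(\<phi> has_real_derivative deriv \<phi> (x + 1)) (at x)" by simp
    then show "deriv \<phi> (x + 1) = deriv \<phi> x" using d[of x] by (rule DERIV_unique)
  qed
  with Suc.IH[OF c, of "e / 2"] Suc.prems(3) obtain T1 where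
    T1: "trig T1" "\<And>k x. k \<le> s \<Longrightarrow> \<bar>(deriv ^^ k) (deriv \<phi>) x - (deriv ^^ k) T1 x\<bar> < e / 2" by auto
  obtain m v where v: "trig0 v" "T1 = (\<lambda>x. m + v x)" using T1(1) unfolding trig_def by blast
  obtain w where w: "trig0 w" "\<And>x. (w has_real_derivative v x) (at x)" using trig0_antideriv[OF v(1)] by blast
  have sv: "smooth v" using v(1) trig0_trig trig_smooth by blast
  \<comment> \<open>Over a period \<open>\<phi>\<close> and \<open>w\<close> return to their values,
    so by the mean value theorem \<open>\<bar>m\<bar>\<close> is the approximation error of
    \<open>T1\<close> at some point.\<close>
  have m: "\<bar>m\<bar> < e / 2"
  proof -
    have "\<exists>z. 0 < z \<and> z < 1 \<and> (\<phi> 1 - w 1 - m * 1) - (\<phi> 0 - w 0 - m * 0) = (1 - 0) * (deriv \<phi> z - v z - m)"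
      by (intro MVT2) (auto intro!: derivative_eq_intros d w)
    then obtain z where "(\<phi> 1 - w 1 - m * 1) - (\<phi> 0 - w 0 - m * 0) = deriv \<phi> z - v z - m" by auto
    moreover have "\<phi> 1 = \<phi> 0" "w 1 = w 0"
      using Suc.prems(2) trig_periodic[OF trig0_trig[OF w(1)]] unfolding periodic_def by (metis add_0)+
    ultimately show ?thesis using T1(2)[of 0 z] by (simp add: v(2))
  qed
  define T where "T = (\<lambda>x. (\<phi> 0 - w 0) + w x)"
  have T: "trig T" unfolding trig_def T_def using w(1) by blast
  have dT: "deriv T = v"
    unfolding T_def by (rule ext, rule DERIV_imp_deriv) (auto intro!: derivative_eq_intros w)
  have dv: "\<bar>(deriv ^^ k) (deriv \<phi>) x - (deriv ^^ k) v x\<bar> < e" if "k \<le> s" for k x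
  proof (cases k)
    case 0
    have "\<bar>deriv \<phi> x - v x\<bar> \<le> \<bar>deriv \<phi> x - (m + v x)\<bar> + \<bar>m\<bar>" by arith
    also have "\<dots> < e" using T1(2)[of 0 x] m by (simp add: v(2))
    finally show ?thesis using 0 by simp
  next
    case k': (Suc k')
    have "(deriv ^^ k) T1 x = (deriv ^^ k) v x"
      unfolding v(2) k' by (simp only: derivs_add[OF smooth_const sv] derivs_const add_0)
    then show ?thesis using T1(2)[OF that, of x] Suc.prems(3) by linarith
  qed
  have "\<bar>\<phi> x - T x\<bar> < e" for x
  proof -
    have "periodic (\<lambda>x. \<phi> x - T x)" using Suc.prems(2) trig_periodic[OF T] by (simp add: periodic_def)
    then have e1: "\<phi> x - T x = \<phi> (frac x) - T (frac x)" by (rule periodic_frac)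
    show ?thesis
    proof (cases "frac x = 0")
      case True
      show ?thesis unfolding e1 True using Suc.prems(3) by (simp add: T_def)
    next
      case False
      then have f: "0 < frac x" "frac x < 1" using frac_ge_0[of x] frac_lt_1[of x] by linarith+
      have "\<exists>z. 0 < z \<and> z < frac x \<and> (\<phi> (frac x) - T (frac x)) - (\<phi> 0 - T 0) = (frac x - 0) * (deriv \<phi> z - v z)"
        using f unfolding T_def by (intro MVT2) (auto intro!: derivative_eq_intros d w)
      then obtain z where z: "\<phi> (frac x) - T (frac x) = frac x * (deriv \<phi> z - v z)" by (auto simp: T_def)
      have "\<bar>frac x * (deriv \<phi> z - v z)\<bar> \<le> 1 * \<bar>deriv \<phi> z - v z\<bar>"
        unfolding abs_mult using f by (intro mult_right_mono) auto
      then show ?thesis unfolding e1 z using dv[of 0 z] by simp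
    qed
  qed
  then have "\<bar>(deriv ^^ k) \<phi> x - (deriv ^^ k) T x\<bar> < e" if "k \<le> Suc s" for k x
    using that dv by (cases k) (auto simp: funpow_swap1 dT)
  then show ?case using T by blast
qed

section \<open>Circle maps and their lifts\<close>

lemma abs_circle_eq: "abs_circle x = abs_circle y \<longleftrightarrow> x - y \<in> \<int>"
  by (rule circle.abs_eq_iff)

lemma abs_circle_cases: obtains x where "c = abs_circle x"
  using Quotient_abs_rep[OF Quotient_circle, of c, symmetric] by (rule that)

lemma abs_circle_rep: "abs_circle (rep_circle c) = c"
  by (rule Quotient_abs_rep[OF Quotient_circle])

text \<open>Through the chosen representative this makes sense for every \<open>F\<close>; the
  choice disappears when \<open>F\<close> commutes with the unit translation
  (\<open>cmap_abs\<close>), and every map that has a lift is of this form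
  (\<open>cmap_lift\<close>).\<close>

definition cmap :: "(real \<Rightarrow> real) \<Rightarrow> circle \<Rightarrow> circle" where
  "cmap F c = abs_circle (F (rep_circle c))"

lemma cmap_abs:
  assumes "\<And>x. F (x + 1) = F x + 1"
  shows "cmap F (abs_circle x) = abs_circle (F x)"
proof -
  have "rep_circle (abs_circle x) - x \<in> \<int>" using abs_circle_rep abs_circle_eq by blast
  then obtain k where "rep_circle (abs_circle x) - x = of_int k" by (rule Ints_cases)
  then have "rep_circle (abs_circle x) = x + of_int k" by simp
  then have "F (rep_circle (abs_circle x)) = F x + of_int k" using shift_int[of F 1, OF assms] by simp
  then show ?thesis by (simp add: cmap_def abs_circle_eq)
qed

lemma is_lift_cmap:
  assumes "continuous_on UNIV F" and s: "\<And>x. F (x + 1) = F x + 1"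
  shows "is_lift F (cmap F)"
  unfolding is_lift_def using assms(1) cmap_abs[of F, OF s] by simp

lemma cmap_lift:
  assumes "is_lift F g"
  shows "g = cmap F"
proof
  fix c
  have "abs_circle (F (rep_circle c)) = g (abs_circle (rep_circle c))" using assms unfolding is_lift_def by blast
  then show "g c = cmap F c" by (simp add: cmap_def abs_circle_rep)
qed

lemma cmap_comp:
  assumes "\<And>x. F (x + 1) = F x + 1"
  shows "cmap F \<circ> cmap G = cmap (F \<circ> G)"
  by (rule ext) (simp add: cmap_def[of G] cmap_def[of "F \<circ> G"] cmap_abs[of F, OF assms])

lemma cmap_id: "cmap id = id"
  by (rule ext) (simp add: cmap_def abs_circle_rep)

lemma cmap_rotation: "rotation \<alpha> = cmap (\<lambda>x. x + \<alpha>)"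
proof
  fix c
  have "rotation \<alpha> (abs_circle (rep_circle c)) = abs_circle (rep_circle c + \<alpha>)" by (rule rotation.abs_eq)
  then show "rotation \<alpha> c = cmap (\<lambda>x. x + \<alpha>) c" by (simp add: cmap_def abs_circle_rep)
qed

text \<open>The difference of two lifts is continuous and integer valued, so its connected range is
  a single point.\<close>

lemma is_lift_unique:
  assumes "is_lift F g" "is_lift G g"
  obtains k :: int where "\<And>x. G x = F x + of_int k"
proof -
  define d where "d x = G x - F x" for x
  have dI: "d x \<in> \<int>" for x
    using assms abs_circle_eq[of "G x" "F x"] unfolding is_lift_def d_def by simp
  have conn: "connected (range d)"
    unfolding d_def using assms by (intro connected_continuous_image continuous_intros) (auto simp: is_lift_def)
  have eq: "d x \<le> d y" for x y
  proof (rule ccontr)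
    assume n: "\<not> d x \<le> d y"
    obtain a where a: "d y = of_int a" using dI[of y] by (rule Ints_cases)
    obtain b where b: "d x = of_int b" using dI[of x] by (rule Ints_cases)
    note ab = a b
    then have "a < b" using n by simp
    then have "real_of_int a + 1 \<le> real_of_int b" by linarith
    then have "of_int a + 1 / 2 \<in> range d"
      using connectedD_interval[OF conn rangeI[of d y] rangeI[of d x], of "of_int a + 1 / 2"] ab by simp
    then obtain w where "real_of_int a + 1 / 2 = d w" by (rule imageE)
    then have "of_int a + 1 / 2 \<in> (\<int> :: real set)" using dI[of w] by simp
    then obtain c where "real_of_int a + 1 / 2 = of_int c" by (rule Ints_cases)
    then have "2 * c = 2 * a + 1" by linarith
    then show False by presburger
  qed
  obtain k where "d 0 = of_int k" using dI[of 0] by (rule Ints_cases)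
  then have "G x = F x + of_int k" for x using eq[of x 0] eq[of 0 x] by (simp add: d_def)
  then show ?thesis using that by blast
qed

lemma is_lift_add: "is_lift F g \<Longrightarrow> is_lift (\<lambda>x. F x + of_int k) g" (is "_ \<Longrightarrow> ?thesis")
proof -
  assume F: "is_lift F g"
  have "abs_circle (F x + of_int k) = abs_circle (F x)" for x by (simp add: abs_circle_eq)
  with F show ?thesis unfolding is_lift_def by (auto intro!: continuous_intros)
qed

lemma is_lift_degree:
  assumes "is_lift F g"
  obtains d :: int where "\<And>x. F (x + 1) = F x + of_int d"
proof -
  have "is_lift (\<lambda>x. F (x + 1)) g"
  proof -
    have "continuous_on UNIV (\<lambda>x. F (x + 1))"
      by (rule continuous_on_compose2[of UNIV F]) (use assms in \<open>auto simp: is_lift_def intro!: continuous_intros\<close>)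
    moreover have "abs_circle (F (x + 1)) = g (abs_circle x)" for x
    proof -
      have "abs_circle (F (x + 1)) = g (abs_circle (x + 1))" using assms unfolding is_lift_def by blast
      also have "abs_circle (x + 1) = abs_circle x" by (simp add: abs_circle_eq)
      finally show ?thesis .
    qed
    ultimately show ?thesis unfolding is_lift_def by blast
  qed
  from is_lift_unique[OF assms this] show ?thesis using that by blast
qed

lemma increasing_lift_inverse:
  assumes F: "\<And>x. (F has_real_derivative deriv F x) (at x)" and pos: "\<And>x. deriv F x > 0"
    and s: "\<And>x. F (x + 1) = F x + 1"
  obtains H where "\<And>x. F (H x) = x" "\<And>x. H (F x) = x" "\<And>x. H (x + 1) = H x + 1"
proof -
  have "strict_mono F"
    by (rule strict_monoI, rule DERIV_pos_imp_increasing) (use F pos in auto)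
  then have inj: "inj F" by (rule strict_mono_imp_inj_on)
  have "\<exists>x. F x = y" for y
  proof -
    define k where "k = \<lfloor>y - F 0\<rfloor>"
    have "F (of_int k) \<le> y" "y \<le> F (of_int k + 1)"
      unfolding s using shift_int[of F 1, OF s, of 0 k] unfolding k_def by simp_all linarith+
    moreover have "continuous_on A F" for A
      using F by (auto intro!: continuous_at_imp_continuous_on DERIV_isCont)
    ultimately show ?thesis using IVT'[of F "of_int k" y "of_int k + 1"] by auto
  qed
  then obtain H where H: "\<And>x. F (H x) = x" by metis
  then have H2: "H (F x) = x" for x using inj by (meson injD)
  have "H (x + 1) = H x + 1" for x using H2[of "H x + 1"] H[of x] s[of "H x"] by simp
  with H H2 show ?thesis using that by blast
qed

lemma cmap_bij:
  assumes "\<And>x. F (H x) = x" "\<And>x. H (F x) = x" "\<And>x. F (x + 1) = F x + 1" "\<And>x. H (x + 1) = H x + 1"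
  shows "bij (cmap F)" "inv (cmap F) = cmap H"
proof -
  have 1: "cmap F \<circ> cmap H = id" "cmap H \<circ> cmap F = id"
    using assms cmap_comp[of F H] cmap_comp[of H F] by (simp_all add: comp_def flip: cmap_id) (simp_all add: id_def)
  then show "bij (cmap F)" using o_bij by blast
  show "inv (cmap F) = cmap H" using 1 inv_unique_comp by blast
qed

lemma cmap_diffeo:
  assumes "P F" "P H" "continuous_on UNIV F" "continuous_on UNIV H"
    and "\<And>x. F (H x) = x" "\<And>x. H (F x) = x" "\<And>x. F (x + 1) = F x + 1" "\<And>x. H (x + 1) = H x + 1"
  shows "cmap F \<in> circle_diffeos P"
  unfolding circle_diffeos_def using assms cmap_bij[of F H] is_lift_cmap[of F] is_lift_cmap[of H] by auto

lemma cmap_Diff: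
  assumes F: "smooth F" and pos: "\<And>x. deriv F x > 0" and s: "\<And>x. F (x + 1) = F x + 1"
  shows "cmap F \<in> Diff r"
proof -
  obtain H where H: "\<And>x. F (H x) = x" "\<And>x. H (F x) = x" "\<And>x. H (x + 1) = H x + 1"
    using increasing_lift_inverse[OF smooth_DERIV[OF F] pos s] by blast
  have "smooth H" by (rule smooth_inv(1)[OF F pos H(1,2)])
  then show ?thesis unfolding Diff_def
    using F H s by (intro cmap_diffeo[of _ F H]) (auto intro: smooth_class_C' smooth_continuous)
qed

lemma cmap_Diff_omega:
  assumes F: "real_analytic F" and pos: "\<And>x. deriv F x > 0" and s: "\<And>x. F (x + 1) = F x + 1"
  shows "cmap F \<in> Diff_omega"
proof -
  have sF: "smooth F" by (rule real_analytic_smooth[OF F])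
  obtain H where H: "\<And>x. F (H x) = x" "\<And>x. H (F x) = x" "\<And>x. H (x + 1) = H x + 1"
    using increasing_lift_inverse[OF smooth_DERIV[OF sF] pos s] by blast
  have "real_analytic H" by (rule real_analytic_inv[OF F pos H(1,2)])
  then show ?thesis unfolding Diff_omega_def
    using F H s by (intro cmap_diffeo[of _ F H]) (auto intro: real_analytic_smooth smooth_continuous)
qed

lemma Diff_inv: "g \<in> Diff r \<Longrightarrow> inv g \<in> Diff r"
  unfolding Diff_def circle_diffeos_def by (auto simp: bij_imp_bij_inv inv_inv_eq)

section \<open>Neighbourhoods in the spaces of diffeomorphisms\<close>

text \<open>Adding a constant does not change which numbers are derivatives at a point, so the
  choice inside \<open>deriv\<close> gives the same value even where no derivative exists.\<close>

lemma deriv_add_const: "deriv (\<lambda>x. F x + c) = deriv (F :: real \<Rightarrow> real)"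
proof -
  have "((\<lambda>x. F x + c) has_real_derivative D) (at x) \<longleftrightarrow> (F has_real_derivative D) (at x)" for x D
    using DERIV_add[of F D x UNIV "\<lambda>x. c" 0] DERIV_add[of "\<lambda>x. F x + c" D x UNIV "\<lambda>x. - c" 0] by auto
  then show ?thesis unfolding deriv_def by simp
qed

lemma derivs_add_const: "(deriv ^^ k) (\<lambda>x. F x + c) x = (deriv ^^ k) F x + (if k = 0 then c else (0 :: real))"
  by (cases k) (simp_all add: funpow_swap1 deriv_add_const)

lemma derivs_diff_class:
  assumes "class_C (enat s) u" "smooth v"
  shows "k \<le> s \<Longrightarrow> (deriv ^^ k) (\<lambda>x. u x - v x) = (\<lambda>x. (deriv ^^ k) u x - (deriv ^^ k) v x)"
proof (induction k)
  case (Suc k)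
  have d: "((deriv ^^ k) u has_real_derivative deriv ((deriv ^^ k) u) x) (at x)" for x
    using assms(1) Suc.prems by (simp add: class_C_def DERIV_deriv_iff_real_differentiable)
  then have "deriv (\<lambda>x. (deriv ^^ k) u x - (deriv ^^ k) v x) = (\<lambda>x. deriv ((deriv ^^ k) u) x - deriv ((deriv ^^ k) v) x)"
    by (intro ext DERIV_imp_deriv DERIV_diff smooth_DERIV[OF smooth_derivs[OF assms(2)]])
  then show ?case using Suc by simp
qed simp

lemma class_C_diff:
  assumes u: "class_C (enat s) u" and v: "smooth v"
  shows "class_C (enat s) (\<lambda>x. u x - v x)"
  unfolding class_C_def
proof (intro conjI allI impI)
  fix k x assume k: "enat k < enat s"
  have "(deriv ^^ k) u differentiable (at x)" using u k by (simp add: class_C_def)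
  moreover have "(deriv ^^ k) v differentiable (at x)"
    using smooth_DERIV[OF smooth_derivs[OF v]] real_differentiable_def by blast
  ultimately show "(deriv ^^ k) (\<lambda>x. u x - v x) differentiable (at x)"
    using k by (simp add: derivs_diff_class[OF u v] differentiable_diff)
next
  fix k assume k: "enat k \<le> enat s"
  have "continuous_on UNIV ((deriv ^^ k) u)" using u k by (simp add: class_C_def)
  then show "continuous_on UNIV ((deriv ^^ k) (\<lambda>x. u x - v x))"
    using k by (simp add: derivs_diff_class[OF u v] continuous_on_diff smooth_continuous smooth_derivs v)
qed

lemma class_C_mono: "class_C r F \<Longrightarrow> r' \<le> r \<Longrightarrow> class_C r' F"
  unfolding class_C_def by (meson less_le_trans order_trans)

lemma Diff_infinity_subset: "Diff \<infinity> \<subseteq> Diff r"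
  unfolding Diff_def circle_diffeos_def using class_C_mono[of \<infinity> _ r] by auto

lemma lift_class_C:
  assumes "g \<in> Diff r" "is_lift F g"
  shows "class_C r F"
proof -
  obtain G where G: "is_lift G g" "class_C r G" using assms(1) unfolding Diff_def circle_diffeos_def by blast
  obtain k :: int where "\<And>x. F x = G x + of_int k" using is_lift_unique[OF G(1) assms(2)] by blast
  then have F: "F = (\<lambda>x. G x + of_int k)" by auto
  have e: "(deriv ^^ j) F = (\<lambda>x. (deriv ^^ j) G x + (if j = 0 then of_int k else 0))" for j
    unfolding F by (rule ext) (rule derivs_add_const)
  show ?thesis unfolding class_C_def e
    using G(2) by (auto simp: class_C_def intro!: differentiable_add continuous_intros)
qed

lemma lift_analytic:
  assumes "g \<in> Diff_omega" "is_lift F g"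
  shows "real_analytic F"
proof -
  obtain G where G: "is_lift G g" "real_analytic G" using assms(1) unfolding Diff_omega_def circle_diffeos_def by blast
  obtain k :: int where "\<And>x. F x = G x + of_int k" using is_lift_unique[OF G(1) assms(2)] by blast
  then have F: "F = (\<lambda>x. G x + of_int k)" by auto
  have "real_analytic (\<lambda>x. of_int k)"
    by (rule real_analytic_entire[of "\<lambda>z. of_int k"]) auto
  then show ?thesis unfolding F by (rule real_analytic_add[OF G(2)])
qed

lemma close_C_lift:
  assumes "close_C s e f g" "is_lift F f"
  obtains G where "is_lift G g" "\<And>k x. k \<le> s \<Longrightarrow> \<bar>(deriv ^^ k) F x - (deriv ^^ k) G x\<bar> < e"
proof -
  obtain F' G' where F': "is_lift F' f" "is_lift G' g" "\<And>k x. k \<le> s \<Longrightarrow> \<bar>(deriv ^^ k) F' x - (deriv ^^ k) G' x\<bar> < e"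
    using assms(1) unfolding close_C_def by blast
  obtain k :: int where "\<And>x. F x = F' x + of_int k" using is_lift_unique[OF F'(1) assms(2)] by blast
  then have F: "F = (\<lambda>x. F' x + of_int k)" by auto
  show ?thesis
  proof (rule that)
    show "is_lift (\<lambda>x. G' x + of_int k) g" by (rule is_lift_add[OF F'(2)])
    show "\<bar>(deriv ^^ j) F x - (deriv ^^ j) (\<lambda>x. G' x + of_int k) x\<bar> < e" if "j \<le> s" for j x
      using F'(3)[OF that, of x] unfolding F derivs_add_const by simp
  qed
qed

lemma close_C_le: "close_C s e f g \<Longrightarrow> s' \<le> s \<Longrightarrow> close_C s' e f g"
  unfolding close_C_def by (meson order_trans)

lemma close_C_trans:
  assumes "close_C s d f g" "close_C s e g h"
  shows "close_C s (d + e) f h"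
proof -
  obtain F G where F: "is_lift F f" "is_lift G g" "\<And>k x. k \<le> s \<Longrightarrow> \<bar>(deriv ^^ k) F x - (deriv ^^ k) G x\<bar> < d"
    using assms(1) unfolding close_C_def by blast
  obtain H where H: "is_lift H h" "\<And>k x. k \<le> s \<Longrightarrow> \<bar>(deriv ^^ k) G x - (deriv ^^ k) H x\<bar> < e"
    using close_C_lift[OF assms(2) F(2)] by blast
  have "\<bar>(deriv ^^ k) F x - (deriv ^^ k) H x\<bar> < d + e" if "k \<le> s" for k x
    using F(3)[OF that, of x] H(2)[OF that, of x] by linarith
  then show ?thesis unfolding close_C_def using F(1) H(1) by blast
qed

text \<open>The union over smaller radii makes the ball open: \<^const>\<open>close_C\<close> bounds the derivatives
  pointwise, not their suprema.\<close>

definition C1_ball :: "(circle \<Rightarrow> circle) \<Rightarrow> real \<Rightarrow> (circle \<Rightarrow> circle) set" where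
  "C1_ball f e = {g. \<exists>d<e. close_C 1 d f g}"

lemma C1_ball_step:
  assumes "g \<in> C1_ball f e"
  obtains d where "d > 0" "\<And>h. close_C 1 d g h \<Longrightarrow> h \<in> C1_ball f e"
proof -
  obtain c where c: "c < e" "close_C 1 c f g" using assms unfolding C1_ball_def by blast
  show ?thesis
  proof (rule that)
    show "(e - c) / 2 > 0" using c by simp
    fix h assume "close_C 1 ((e - c) / 2) g h"
    then have "close_C 1 (c + (e - c) / 2) f h" by (rule close_C_trans[OF c(2)])
    moreover have "c + (e - c) / 2 < e" using c by (simp add: field_simps)
    ultimately show "h \<in> C1_ball f e" unfolding C1_ball_def by blast
  qed
qed

lemma openin_C1_ball_finite:
  assumes "1 \<le> s"
  shows "openin (C_topology s) (C1_ball f e \<inter> Diff (enat s))"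
  unfolding openin_C_topology
proof (intro conjI ballI)
  fix g assume "g \<in> C1_ball f e \<inter> Diff (enat s)"
  then obtain d where "d > 0" "\<And>h. close_C 1 d g h \<Longrightarrow> h \<in> C1_ball f e" using C1_ball_step by blast
  then show "\<exists>d>0. \<forall>h\<in>Diff (enat s). close_C s d g h \<longrightarrow> h \<in> C1_ball f e \<inter> Diff (enat s)"
    using close_C_le[OF _ assms] by blast
qed simp

lemma openin_C1_ball:
  assumes "1 \<le> r"
  shows "openin (Diff_topology r) (C1_ball f e \<inter> Diff r)"
proof (cases r)
  case (enat s)
  then show ?thesis using assms openin_C1_ball_finite[of s] by (simp add: Diff_topology_def one_enat_def)
next
  case infinity
  have sub: "Diff \<infinity> \<subseteq> Diff (enat 1)" by (rule Diff_infinity_subset)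
  have "openin (subtopology (C_topology 1) (Diff \<infinity>)) ((C1_ball f e \<inter> Diff (enat 1)) \<inter> Diff \<infinity>)"
    by (rule openin_subtopology_Int[OF openin_C1_ball_finite]) simp
  moreover have "(C1_ball f e \<inter> Diff (enat 1)) \<inter> Diff \<infinity> = C1_ball f e \<inter> Diff \<infinity>" using sub by blast
  ultimately have "openin (subtopology (C_topology 1) (Diff \<infinity>)) (C1_ball f e \<inter> Diff \<infinity>)" by simp
  then show ?thesis unfolding infinity Diff_topology_def
    by (auto simp: openin_topology_generated_by_iff intro!: generate_topology_on.Basis)
qed

text \<open>For \<open>r = \<infinity>\<close> by induction on the generation of the open set: an
  intersection takes the larger order and the smaller radius, so one finite order always
  suffices.\<close>

lemma openin_Diff_ball:
  assumes "openin (Diff_topology r) V" "f \<in> V"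
  shows "\<exists>s e. e > 0 \<and> enat s \<le> r \<and> (\<forall>g\<in>Diff r. close_C s e f g \<longrightarrow> g \<in> V)"
proof (cases r)
  case (enat s)
  then show ?thesis using assms by (auto simp: Diff_topology_def openin_C_topology intro!: exI[of _ s])
next
  case infinity
  define B where "B = (\<Union>s. {U. openin (subtopology (C_topology s) (Diff \<infinity>)) U})"
  have "generate_topology_on B V"
    using assms(1) by (simp add: infinity Diff_topology_def openin_topology_generated_by_iff B_def)
  then have "\<forall>f\<in>V. \<exists>s e. e > 0 \<and> (\<forall>g\<in>Diff \<infinity>. close_C s e f g \<longrightarrow> g \<in> V)"
  proof induction
    case Empty
    show ?case by simp
  next
    case (Int U W)
    show ?case
    proof
      fix f assume f: "f \<in> U \<inter> W"
      obtain s d where s: "d > 0" "\<forall>g\<in>Diff \<infinity>. close_C s d f g \<longrightarrow> g \<in> U" using Int f by blast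
      obtain t e where t: "e > 0" "\<forall>g\<in>Diff \<infinity>. close_C t e f g \<longrightarrow> g \<in> W" using Int f by blast
      have "g \<in> U \<inter> W" if "g \<in> Diff \<infinity>" "close_C (max s t) (min d e) f g" for g
        using s(2) t(2) that close_C_le[of "max s t" _ f g] close_C_mono[of _ "min d e" f g]
        by (meson IntI max.cobounded1 max.cobounded2 min.cobounded1 min.cobounded2)
      then show "\<exists>s e. e > 0 \<and> (\<forall>g\<in>Diff \<infinity>. close_C s e f g \<longrightarrow> g \<in> U \<inter> W)"
        using s(1) t(1) by (intro exI[of _ "max s t"] exI[of _ "min d e"]) auto
    qed
  next
    case (UN \<K>)
    then show ?case by blast
  next
    case (Basis U)
    then obtain s where "openin (subtopology (C_topology s) (Diff \<infinity>)) U" unfolding B_def by blast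
    then obtain W where W: "openin (C_topology s) W" "U = W \<inter> Diff \<infinity>" by (auto simp: openin_subtopology)
    show ?case
    proof
      fix f assume "f \<in> U"
      then obtain e where "e > 0" "\<forall>g\<in>Diff (enat s). close_C s e f g \<longrightarrow> g \<in> W"
        using W unfolding openin_C_topology by blast
      moreover have "Diff \<infinity> \<subseteq> Diff (enat s)" by (rule Diff_infinity_subset)
      ultimately show "\<exists>s e. e > 0 \<and> (\<forall>g\<in>Diff \<infinity>. close_C s e f g \<longrightarrow> g \<in> U)"
        unfolding W(2) by blast
    qed
  qed
  then show ?thesis using assms(2) infinity by auto
qed

lemma openin_Diff_omega_ball:
  assumes "openin Diff_omega_topology V" "f \<in> V"
  shows "\<exists>e>0. \<forall>g\<in>Diff_omega. close_omega 1 e f g \<longrightarrow> g \<in> V"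
  using assms unfolding openin_Diff_omega_topology by (meson zero_less_one)

text \<open>Cauchy's inequality on discs of radius \<open>\<rho> / 2\<close> bounds the derivative
  of the difference by \<open>2 * e / \<rho>\<close>; the factor 3 restores the strict inequality in
  \<open>close_C\<close>.\<close>

lemma close_omega_C1:
  assumes f: "f \<in> Diff_omega" and g: "g \<in> Diff_omega" and \<rho>: "\<rho> > 0" and c: "close_omega \<rho> e f g"
  shows "close_C 1 (max e (3 * e / \<rho>)) f g"
proof -
  obtain F G \<Phi> where F: "is_lift F f" "is_lift G g" and hol: "\<Phi> holomorphic_on strip \<rho>"
    and eq: "\<And>x. \<Phi> (of_real x) = of_real (G x - F x)" and le: "\<And>z. z \<in> strip \<rho> \<Longrightarrow> norm (\<Phi> z) < e"
    using c unfolding close_omega_def by blast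
  have DF: "(F has_real_derivative deriv F x) (at x)" and DG: "(G has_real_derivative deriv G x) (at x)" for x
    using lift_analytic[OF f F(1)] lift_analytic[OF g F(2)] real_analytic_DERIV by blast+
  have e: "e > 0" using le[of 0] \<rho> by (auto simp: strip_def intro: le_less_trans[OF norm_ge_zero])
  have sub: "ball (of_real x) \<rho> \<subseteq> strip \<rho>" for x
  proof
    fix z assume "z \<in> ball (complex_of_real x) \<rho>"
    then have "norm (z - of_real x) < \<rho>" by (simp add: dist_norm norm_minus_commute)
    then show "z \<in> strip \<rho>" using abs_Im_le_cmod[of "z - of_real x"] by (simp add: strip_def)
  qed
  have 0: "\<bar>F x - G x\<bar> < e" for x
    using le[of "of_real x"] \<rho> eq[of x] by (simp add: strip_def abs_minus_commute flip: of_real_diff)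
  have 1: "\<bar>deriv F x - deriv G x\<bar> < 3 * e / \<rho>" for x
  proof -
    have hb: "\<Phi> holomorphic_on ball (of_real x) \<rho>" using hol sub by (rule holomorphic_on_subset)
    have "((\<lambda>x. G x - F x) has_real_derivative deriv G x - deriv F x) (at x)" by (intro DERIV_diff DF DG)
    then have "deriv (\<lambda>x. G x - F x) x = deriv G x - deriv F x" by (rule DERIV_imp_deriv)
    then have d: "deriv \<Phi> (of_real x) = of_real (deriv G x - deriv F x)"
      using real_extension_deriv(2)[OF hb, of "\<lambda>x. G x - F x" x] eq \<rho> by simp
    have "norm ((deriv ^^ 1) \<Phi> (of_real x)) \<le> fact 1 * e / (\<rho> / 2) ^ 1"
    proof (rule Cauchy_inequality)
      have sub2: "cball (of_real x) (\<rho> / 2) \<subseteq> ball (complex_of_real x) \<rho>" using \<rho> by auto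
      show "\<Phi> holomorphic_on ball (of_real x) (\<rho> / 2)"
        using hb by (rule holomorphic_on_subset) (use sub2 in auto)
      show "continuous_on (cball (of_real x) (\<rho> / 2)) \<Phi>"
        using holomorphic_on_imp_continuous_on[OF hb] sub2 by (rule continuous_on_subset)
      show "norm (\<Phi> z) \<le> e" if "norm (of_real x - z) = \<rho> / 2" for z
      proof -
        have "z \<in> ball (of_real x) \<rho>" using that \<rho> by (simp add: dist_norm)
        then show ?thesis using le sub by (meson less_imp_le subsetD)
      qed
    qed (use \<rho> in simp)
    then have "\<bar>deriv G x - deriv F x\<bar> \<le> 2 * e / \<rho>" by (simp add: d mult.commute flip: of_real_diff)
    also have "\<dots> < 3 * e / \<rho>" using e \<rho> by (intro divide_strict_right_mono) auto
    finally show ?thesis by (simp add: abs_minus_commute)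
  qed
  have "\<bar>(deriv ^^ k) F x - (deriv ^^ k) G x\<bar> < max e (3 * e / \<rho>)" if "k \<le> 1" for k x
  proof (cases k)
    case 0
    then show ?thesis using \<open>\<bar>F x - G x\<bar> < e\<close> by simp
  next
    case (Suc k')
    then show ?thesis using 1[of x] that by simp
  qed
  then show ?thesis unfolding close_C_def using F by blast
qed

lemma openin_C1_ball_omega: "openin Diff_omega_topology (C1_ball f e \<inter> Diff_omega)"
  unfolding openin_Diff_omega_topology
proof (intro conjI ballI allI impI)
  fix g and \<rho> :: real assume g: "g \<in> C1_ball f e \<inter> Diff_omega" and \<rho>: "\<rho> > 0"
  then obtain d where d: "d > 0" "\<And>h. close_C 1 d g h \<Longrightarrow> h \<in> C1_ball f e" using C1_ball_step by blast
  \<comment> \<open>Both \<open>c\<close> and \<open>3 * c / \<rho>\<close> are then at most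
    \<open>d\<close>; the inductive limit topology lets the radius depend on
    \<open>\<rho>\<close>.\<close>
  define c where "c = d * min 1 (\<rho> / 3)"
  have c: "c > 0" "max c (3 * c / \<rho>) \<le> d"
  proof -
    show "c > 0" using d \<rho> by (simp add: c_def)
    have "c \<le> d * 1" "c \<le> d * (\<rho> / 3)" unfolding c_def using d by (intro mult_left_mono; simp)+
    then show "max c (3 * c / \<rho>) \<le> d" using \<rho> by (simp add: field_simps)
  qed
  have "h \<in> C1_ball f e \<inter> Diff_omega" if "h \<in> Diff_omega" "close_omega \<rho> c g h" for h
    using d(2)[OF close_C_mono[OF close_omega_C1[OF _ that(1) \<rho> that(2)] c(2)]] g that(1) by blast
  then show "\<exists>c>0. \<forall>h\<in>Diff_omega. close_omega \<rho> c g h \<longrightarrow> h \<in> C1_ball f e \<inter> Diff_omega"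
    using c(1) by blast
qed simp

section \<open>Analytic lifts and their perturbations in the various topologies\<close>

definition analytic_lift :: "(real \<Rightarrow> real) \<Rightarrow> bool" where
  "analytic_lift F \<longleftrightarrow> real_analytic F \<and> (\<forall>x. F (x + 1) = F x + 1) \<and> (\<forall>x. deriv F x > 0)"

lemma analytic_lift_D:
  assumes "analytic_lift F"
  shows "real_analytic F" "smooth F" "F (x + 1) = F x + 1" "deriv F x > 0" "cmap F \<in> Diff_omega" "cmap F \<in> Diff r"
    "is_lift F (cmap F)" "strict_mono F"
proof -
  show a: "real_analytic F" "F (x + 1) = F x + 1" "deriv F x > 0" for x
    using assms by (auto simp: analytic_lift_def)
  show s: "smooth F" using a(1) by (rule real_analytic_smooth)
  show "cmap F \<in> Diff_omega" "cmap F \<in> Diff r" using a s cmap_Diff_omega cmap_Diff by auto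
  show "is_lift F (cmap F)" using a s by (intro is_lift_cmap smooth_continuous)
  show "strict_mono F"
    by (rule strict_monoI, rule DERIV_pos_imp_increasing) (use smooth_DERIV[OF s] a(3) in blast)+
qed

lemma positive_periodic_bound:
  assumes "continuous_on UNIV u" "periodic u" "\<And>x. u x > 0"
  obtains m :: real where "m > 0" "\<And>x. u x \<ge> m"
proof -
  have "periodic (\<lambda>x. inverse (u x))" "continuous_on UNIV (\<lambda>x. inverse (u x))"
    using assms less_imp_neq[OF assms(3), symmetric] by (auto simp: periodic_def intro!: continuous_intros)
  then obtain z where z: "\<And>x. \<bar>inverse (u x)\<bar> \<le> \<bar>inverse (u z)\<bar>" using periodic_attains by blast
  have "u x \<ge> u z" for x using z[of x] assms(3)[of x] assms(3)[of z] by (simp add: abs_of_pos)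
  then show ?thesis using that assms(3) by blast
qed

lemma analytic_lift_perturb:
  assumes Y: "analytic_lift Y" and T: "trig T"
  obtains \<delta> where "\<delta> > 0" "\<And>s. \<bar>s\<bar> < \<delta> \<Longrightarrow> analytic_lift (\<lambda>x. Y x + s * T x)"
proof -
  have sY: "smooth Y" and sT: "smooth T" using analytic_lift_D(2)[OF Y] trig_smooth[OF T] .
  have pT: "periodic T" by (rule trig_periodic[OF T])
  have "periodic (deriv Y)"
    unfolding periodic_def using derivs_shift[OF sY, of 1 1] analytic_lift_D(3)[OF Y]
    by (simp add: deriv_add_const fun_eq_iff)
  then obtain m where m: "m > 0" "\<And>x. deriv Y x \<ge> m"
    using positive_periodic_bound[of "deriv Y"] analytic_lift_D(4)[OF Y] smooth_continuous[OF smooth_deriv[OF sY]] by blast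
  obtain P where P: "P \<ge> 0" "bd 1 T P 1" using periodic_bd[OF sT pT] by blast
  show ?thesis
  proof (rule that)
    show "m / (P + 1) > 0" using m P by simp
    fix s :: real assume "\<bar>s\<bar> < m / (P + 1)"
    then have "\<bar>s\<bar> * (P + 1) < m" using P by (simp add: field_simps)
    have "real_analytic (\<lambda>x. Y x + s * T x)"
      by (intro real_analytic_add analytic_lift_D(1)[OF Y] trig_analytic trig_cmult T)
    moreover have "deriv (\<lambda>x. Y x + s * T x) x > 0" for x
    proof -
      have "deriv (\<lambda>x. Y x + s * T x) x = deriv Y x + s * deriv T x"
        by (intro DERIV_imp_deriv DERIV_add DERIV_cmult smooth_DERIV sY sT)
      moreover have "\<bar>s * deriv T x\<bar> \<le> \<bar>s\<bar> * P"
        using bd_D[OF P(2), of 1 x] by (simp add: abs_mult mult_left_mono)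
      ultimately show ?thesis using m(2)[of x] \<open>\<bar>s\<bar> * (P + 1) < m\<close> by (simp add: distrib_left)
    qed
    ultimately show "analytic_lift (\<lambda>x. Y x + s * T x)"
      unfolding analytic_lift_def using analytic_lift_D(3)[OF Y] pT by (simp add: periodic_def)
  qed
qed

text \<open>What the density argument needs of the topology: the \<open>C\<^sup>r\<close> topologies, \<open>r \<ge> 1\<close>, and
  the analytic topology are treated at once.\<close>

definition admissible :: "(circle \<Rightarrow> circle) topology \<Rightarrow> bool" where
  "admissible X \<longleftrightarrow>
     (\<forall>F. analytic_lift F \<longrightarrow> cmap F \<in> topspace X) \<and>
     (\<forall>f e. openin X (C1_ball f e \<inter> topspace X)) \<and>
     (\<forall>V Y T. openin X V \<longrightarrow> analytic_lift Y \<longrightarrow> cmap Y \<in> V \<longrightarrow> trig T \<longrightarrow>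
        (\<exists>\<delta>>0. \<forall>s. \<bar>s\<bar> < \<delta> \<longrightarrow> analytic_lift (\<lambda>x. Y x + s * T x) \<and> cmap (\<lambda>x. Y x + s * T x) \<in> V)) \<and>
     (\<forall>V f F m. openin X V \<longrightarrow> f \<in> V \<longrightarrow> is_lift F f \<longrightarrow> (\<forall>x. F (x + 1) = F x + 1) \<longrightarrow> m > 0 \<longrightarrow>
        (\<forall>x. deriv F x \<ge> m) \<longrightarrow> (\<exists>G. analytic_lift G \<and> cmap G \<in> V))"

lemma admissible_Diff:
  assumes r: "1 \<le> r"
  shows "admissible (Diff_topology r)"
  unfolding admissible_def
proof (intro conjI allI impI)
  show "cmap F \<in> topspace (Diff_topology r)" if "analytic_lift F" for F
    using analytic_lift_D(6)[OF that] by (simp add: topspace_Diff_topology)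
  show "openin (Diff_topology r) (C1_ball f e \<inter> topspace (Diff_topology r))" for f e
    using openin_C1_ball[OF r] by (simp add: topspace_Diff_topology)
next
  fix V Y T assume V: "openin (Diff_topology r) V" and Y: "analytic_lift Y" "cmap Y \<in> V" and T: "trig T"
  obtain k e where k: "e > 0" "\<And>g. g \<in> Diff r \<Longrightarrow> close_C k e (cmap Y) g \<Longrightarrow> g \<in> V"
    using openin_Diff_ball[OF V Y(2)] by blast
  obtain \<delta> where \<delta>: "\<delta> > 0" "\<And>s. \<bar>s\<bar> < \<delta> \<Longrightarrow> analytic_lift (\<lambda>x. Y x + s * T x)"
    using analytic_lift_perturb[OF Y(1) T] by blast
  have sY: "smooth Y" and sT: "smooth T" using analytic_lift_D(2)[OF Y(1)] trig_smooth[OF T] .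
  obtain P where P: "P \<ge> 0" "bd k T P 1" using periodic_bd[OF sT trig_periodic[OF T]] by blast
  show "\<exists>\<delta>>0. \<forall>s. \<bar>s\<bar> < \<delta> \<longrightarrow> analytic_lift (\<lambda>x. Y x + s * T x) \<and> cmap (\<lambda>x. Y x + s * T x) \<in> V"
  proof (intro exI[of _ "min \<delta> (e / (P + 1))"] conjI allI impI)
    show "min \<delta> (e / (P + 1)) > 0" using \<delta> k P by simp
    fix s assume s: "\<bar>s\<bar> < min \<delta> (e / (P + 1))"
    then show A: "analytic_lift (\<lambda>x. Y x + s * T x)" using \<delta> by simp
    have "\<bar>s\<bar> * (P + 1) < e" using s P by (simp add: field_simps)
    have "close_C k e (cmap Y) (cmap (\<lambda>x. Y x + s * T x))"
      unfolding close_C_def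
    proof (intro exI conjI allI impI)
      show "is_lift Y (cmap Y)" "is_lift (\<lambda>x. Y x + s * T x) (cmap (\<lambda>x. Y x + s * T x))"
        using analytic_lift_D(7) Y A by blast+
      fix j x assume j: "j \<le> k"
      have "(deriv ^^ j) (\<lambda>x. Y x + s * T x) x = (deriv ^^ j) Y x + s * (deriv ^^ j) T x"
        using derivs_add[OF sY smooth_mult[OF smooth_const sT], of j s] derivs_cmult[OF sT, of j s] by (simp add: fun_eq_iff)
      moreover have "\<bar>s * (deriv ^^ j) T x\<bar> \<le> \<bar>s\<bar> * P"
        using bd_D[OF P(2) j, of x] by (simp add: abs_mult mult_left_mono)
      ultimately show "\<bar>(deriv ^^ j) Y x - (deriv ^^ j) (\<lambda>x. Y x + s * T x) x\<bar> < e"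
        using \<open>\<bar>s\<bar> * (P + 1) < e\<close> by (simp add: distrib_left)
    qed
    then show "cmap (\<lambda>x. Y x + s * T x) \<in> V" using k(2) analytic_lift_D(6)[OF A] by blast
  qed
next
  fix V f F m assume V: "openin (Diff_topology r) V" "f \<in> V" and F: "is_lift F f" "\<forall>x. F (x + 1) = F x + 1"
    and m: "0 < (m::real)" "\<forall>x. m \<le> deriv F x"
  obtain k e where k: "e > 0" "enat k \<le> r" "\<And>g. g \<in> Diff r \<Longrightarrow> close_C k e f g \<Longrightarrow> g \<in> V"
    using openin_Diff_ball[OF V] by blast
  \<comment> \<open>The first derivative has to be approximated even if \<open>k = 0\<close>, as the
    positivity of \<open>deriv G\<close> depends on it.\<close>
  define s where "s = max k 1"
  have "f \<in> Diff r" using openin_subset[OF V(1)] V(2) topspace_Diff_topology by blast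
  then have "class_C r F" using F(1) by (rule lift_class_C)
  moreover have "enat s \<le> r" using k(2) r by (auto simp: s_def max_def one_enat_def)
  ultimately have cF: "class_C (enat s) F" by (rule class_C_mono)
  define \<phi> where "\<phi> = (\<lambda>x. F x - x)"
  have "class_C (enat s) \<phi>" unfolding \<phi>_def by (rule class_C_diff[OF cF smooth_ident])
  moreover have "periodic \<phi>" using F(2) by (simp add: periodic_def \<phi>_def)
  \<comment> \<open>An error below \<open>m\<close> in the first derivative keeps \<open>G\<close>
    increasing.\<close>
  moreover have "min e m > 0" using k m by simp
  ultimately obtain T where T: "trig T" "\<And>j x. j \<le> s \<Longrightarrow> \<bar>(deriv ^^ j) \<phi> x - (deriv ^^ j) T x\<bar> < min e m"
    using trig_dense by meson
  define G where "G = (\<lambda>x. x + T x)"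
  have sT: "smooth T" by (rule trig_smooth[OF T(1)])
  have d: "\<bar>(deriv ^^ j) F x - (deriv ^^ j) G x\<bar> < min e m" if j: "j \<le> s" for j x
  proof -
    have "(deriv ^^ j) \<phi> x = (deriv ^^ j) F x - (deriv ^^ j) (\<lambda>x. x) x"
      unfolding \<phi>_def using derivs_diff_class[OF cF smooth_ident j] by metis
    moreover have "(deriv ^^ j) G x = (deriv ^^ j) (\<lambda>x. x) x + (deriv ^^ j) T x"
      unfolding G_def using derivs_add[OF smooth_ident sT, of j] by metis
    ultimately have "(deriv ^^ j) F x - (deriv ^^ j) G x = (deriv ^^ j) \<phi> x - (deriv ^^ j) T x" by linarith
    then show ?thesis using T(2)[OF j, of x] by (simp only:)
  qed
  have "analytic_lift G"
    unfolding analytic_lift_def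
  proof (intro conjI allI)
    have "real_analytic (\<lambda>x. x)" by (rule real_analytic_entire[of "\<lambda>z. z"]) auto
    then show "real_analytic G" unfolding G_def by (rule real_analytic_add[OF _ trig_analytic[OF T(1)]])
    show "G (x + 1) = G x + 1" for x using trig_periodic[OF T(1)] by (simp add: G_def periodic_def)
    show "deriv G x > 0" for x using d[of 1 x] m(2)[rule_format, of x] by (simp add: s_def abs_less_iff)
  qed
  moreover have "cmap G \<in> V"
  proof (rule k(3))
    show "cmap G \<in> Diff r" using calculation by (rule analytic_lift_D(6))
    show "close_C k e f (cmap G)"
      unfolding close_C_def using F(1) analytic_lift_D(7)[OF calculation] d
      by (intro exI[of _ F] exI[of _ G]) (auto simp: s_def)
  qed
  ultimately show "\<exists>G. analytic_lift G \<and> cmap G \<in> V" by blast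
qed

lemma admissible_omega: "admissible Diff_omega_topology"
  unfolding admissible_def
proof (intro conjI allI impI)
  show "cmap F \<in> topspace Diff_omega_topology" if "analytic_lift F" for F
    using analytic_lift_D(5)[OF that] by (simp add: topspace_Diff_omega_topology)
  show "openin Diff_omega_topology (C1_ball f e \<inter> topspace Diff_omega_topology)" for f e
    using openin_C1_ball_omega by (simp add: topspace_Diff_omega_topology)
next
  fix V Y T assume V: "openin Diff_omega_topology V" and Y: "analytic_lift Y" "cmap Y \<in> V" and T: "trig T"
  obtain e where e: "e > 0" "\<And>g. g \<in> Diff_omega \<Longrightarrow> close_omega 1 e (cmap Y) g \<Longrightarrow> g \<in> V"
    using openin_Diff_omega_ball[OF V Y(2)] by blast
  obtain \<delta> where \<delta>: "\<delta> > 0" "\<And>s. \<bar>s\<bar> < \<delta> \<Longrightarrow> analytic_lift (\<lambda>x. Y x + s * T x)"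
    using analytic_lift_perturb[OF Y(1) T] by blast
  obtain \<Phi> M where \<Phi>: "\<Phi> holomorphic_on UNIV" "\<And>x. \<Phi> (of_real x) = complex_of_real (T x)"
    "\<And>z. z \<in> strip 1 \<Longrightarrow> norm (\<Phi> z) \<le> M" by (rule trig_entire[OF T]) (rule that)
  have M: "M \<ge> 0" by (rule order_trans[OF norm_ge_zero \<Phi>(3)[of 0]]) (simp add: strip_def)
  show "\<exists>\<delta>>0. \<forall>s. \<bar>s\<bar> < \<delta> \<longrightarrow> analytic_lift (\<lambda>x. Y x + s * T x) \<and> cmap (\<lambda>x. Y x + s * T x) \<in> V"
  proof (intro exI[of _ "min \<delta> (e / (M + 1))"] conjI allI impI)
    show "min \<delta> (e / (M + 1)) > 0" using \<delta> e M by simp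
    fix s assume s: "\<bar>s\<bar> < min \<delta> (e / (M + 1))"
    then show A: "analytic_lift (\<lambda>x. Y x + s * T x)" using \<delta> by simp
    have s': "\<bar>s\<bar> * (M + 1) < e" using s M by (simp add: field_simps)
    have "close_omega 1 e (cmap Y) (cmap (\<lambda>x. Y x + s * T x))"
      unfolding close_omega_def
    proof (intro exI conjI allI ballI)
      show "is_lift Y (cmap Y)" "is_lift (\<lambda>x. Y x + s * T x) (cmap (\<lambda>x. Y x + s * T x))"
        using analytic_lift_D(7) Y A by blast+
      show "(\<lambda>z. of_real s * \<Phi> z) holomorphic_on strip 1"
        by (intro holomorphic_intros holomorphic_on_subset[OF \<Phi>(1)]) auto
      show "of_real s * \<Phi> (of_real x) = of_real (Y x + s * T x - Y x)" for x by (simp add: \<Phi>(2))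
      show "norm (of_real s * \<Phi> z) < e" if "z \<in> strip 1" for z
      proof -
        have "\<bar>s\<bar> * norm (\<Phi> z) \<le> \<bar>s\<bar> * M" using \<Phi>(3)[OF that] by (intro mult_left_mono) auto
        then show ?thesis using s' by (simp add: norm_mult distrib_left)
      qed
    qed
    then show "cmap (\<lambda>x. Y x + s * T x) \<in> V" using e(2) analytic_lift_D(5)[OF A] by blast
  qed
next
  fix V f F m assume V: "openin Diff_omega_topology V" "f \<in> V" and F: "is_lift F f" "\<forall>x. F (x + 1) = F x + 1"
    and m: "0 < (m::real)" "\<forall>x. m \<le> deriv F x"
  have f: "f \<in> Diff_omega" using openin_subset[OF V(1)] V(2) topspace_Diff_omega_topology by blast
  \<comment> \<open>In this topology \<open>f\<close> is analytic itself, so \<open>F\<close> serves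
    as \<open>G\<close> and nothing is approximated.\<close>
  have "analytic_lift F"
    unfolding analytic_lift_def using lift_analytic[OF f F(1)] F(2) m by (auto intro: less_le_trans)
  then show "\<exists>G. analytic_lift G \<and> cmap G \<in> V" using V(2) cmap_lift[OF F(1)] by auto
qed

section \<open>Words in the generators\<close>

definition smooth_lift :: "(real \<Rightarrow> real) \<Rightarrow> bool" where
  "smooth_lift F \<longleftrightarrow> smooth F \<and> (\<forall>x. F (x + 1) = F x + 1) \<and> (\<forall>x. deriv F x > 0)"

lemma smooth_liftD:
  assumes "smooth_lift F"
  shows "smooth F" "F (x + 1) = F x + 1" "deriv F x > 0"
  using assms by (auto simp: smooth_lift_def)

lemma smooth_lift_less: "smooth_lift F \<Longrightarrow> x < y \<Longrightarrow> F x < F y"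
  by (rule DERIV_pos_imp_increasing[of x y F]) (use smooth_DERIV smooth_liftD in blast)+

lemma smooth_lift_mono: "smooth_lift F \<Longrightarrow> mono F"
  by (rule strict_mono_mono, rule strict_monoI, rule smooth_lift_less)

lemma analytic_smooth_lift: "analytic_lift F \<Longrightarrow> smooth_lift F"
  by (simp add: smooth_lift_def analytic_lift_D)

lemma smooth_lift_id: "smooth_lift id"
  unfolding smooth_lift_def id_def by (simp add: smooth_ident)

lemma smooth_lift_comp:
  assumes "smooth_lift F" "smooth_lift G"
  shows "smooth_lift (F \<circ> G)"
proof -
  have "deriv (\<lambda>x. F (G x)) = (\<lambda>x. deriv F (G x) * deriv G x)"
    by (rule deriv_comp_smooth[OF smooth_liftD(1)[OF assms(1)] smooth_liftD(1)[OF assms(2)]])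
  moreover have "smooth (F \<circ> G)" by (rule smooth_o[OF smooth_liftD(1)[OF assms(1)] smooth_liftD(1)[OF assms(2)]])
  ultimately show ?thesis using assms by (simp add: smooth_lift_def comp_def)
qed

text \<open>The lifted form of the fold in \<open>semigroup_span\<close>: the head of the list acts
  first and the last letter is the outermost factor, so adding a constant to that letter translates
  the whole word if it occurs nowhere else.\<close>

definition wd :: "('i \<Rightarrow> real \<Rightarrow> real) \<Rightarrow> 'i list \<Rightarrow> real \<Rightarrow> real" where
  "wd Y ms = fold (\<lambda>a F. Y a \<circ> F) ms id"

lemma wd_Nil [simp]: "wd Y [] = id"
  and wd_snoc [simp]: "wd Y (ms @ [a]) = Y a \<circ> wd Y ms"
  by (simp_all add: wd_def)

lemma wd_append: "wd Y (ms @ ns) = wd Y ns \<circ> wd Y ms"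
proof (induction ns rule: rev_induct)
  case (snoc a ns)
  then show ?case using wd_snoc[of Y "ms @ ns" a] by (simp add: comp_assoc)
qed simp

lemma wd_replicate: "wd Y (replicate n a) = Y a ^^ n"
proof (induction n)
  case (Suc n)
  have "replicate (Suc n) a = replicate n a @ [a]" by (simp add: replicate_append_same)
  then show ?case using Suc by (simp only: wd_snoc funpow.simps)
qed simp

lemma wd_cong: "(\<And>a. a \<in> set ms \<Longrightarrow> Y a = Z a) \<Longrightarrow> wd Y ms = wd Z ms"
  by (induction ms rule: rev_induct) auto

lemma wd_smooth_lift: "(\<And>a. a \<in> set ms \<Longrightarrow> smooth_lift (Y a)) \<Longrightarrow> smooth_lift (wd Y ms)"
  by (induction ms rule: rev_induct) (simp_all add: smooth_lift_comp smooth_lift_id)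

lemma cmap_wd_span:
  assumes "ms \<in> lists A" "\<And>a. a \<in> A \<Longrightarrow> g a = cmap (Y a)" "\<And>a. a \<in> A \<Longrightarrow> smooth_lift (Y a)"
  shows "cmap (wd Y ms) \<in> semigroup_span A g"
proof -
  have "cmap (wd Y ms) = fold (\<lambda>a f. g a \<circ> f) ms id"
    using assms(1)
  proof (induction ms rule: rev_induct)
    case Nil
    show ?case by (simp only: wd_Nil fold_simps cmap_id)
  next
    case (snoc a ms)
    then have "cmap (wd Y (ms @ [a])) = cmap (Y a) \<circ> cmap (wd Y ms)"
      using cmap_comp[of "Y a" "wd Y ms"] smooth_liftD(2)[OF assms(3)] by simp
    then show ?case using snoc assms(2)[of a] by (simp add: comp_def)
  qed
  then show ?thesis using assms(1) unfolding semigroup_span_def by blast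
qed

section \<open>Smooth rotations and parabolic maps\<close>

lemma (in golden) smooth_rotation: "smooth_rotation (cmap f)" "cmap f \<noteq> id"
proof -
  obtain h \<alpha> where h: "smooth h" "\<And>x. h (x + 1) = h x + 1" "\<And>x. deriv h x > 0" "\<And>x. h (f x) = h x + \<alpha>"
    using linearization by blast
  have hD: "cmap h \<in> Diff \<infinity>" by (rule cmap_Diff) (rule h)+
  then have bij: "bij (cmap h)" by (simp add: Diff_def circle_diffeos_def)
  have "cmap h \<circ> cmap f = cmap (h \<circ> f)" by (rule cmap_comp[of h f, OF h(2)])
  also have "h \<circ> f = (\<lambda>x. x + \<alpha>) \<circ> h" by (simp add: fun_eq_iff h(4))
  also have "cmap ((\<lambda>x. x + \<alpha>) \<circ> h) = rotation \<alpha> \<circ> cmap h"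
    unfolding cmap_rotation by (rule cmap_comp[of "\<lambda>x. x + \<alpha>" h, symmetric]) simp
  finally have e: "cmap h \<circ> cmap f = rotation \<alpha> \<circ> cmap h" .
  have "cmap f = inv (cmap h) \<circ> (cmap h \<circ> cmap f)"
    using bij by (simp add: fun_eq_iff bij_is_inj)
  then have "cmap f = inv (cmap h) \<circ> rotation \<alpha> \<circ> inv (inv (cmap h))"
    using bij by (simp add: e inv_inv_eq comp_assoc)
  then show "smooth_rotation (cmap f)"
    unfolding smooth_rotation_def using Diff_inv[OF hD] by blast
  \<comment> \<open>Excludes the identity: \<open>alt\<close> for \<open>n = 0\<close> and
    \<open>n = 1\<close> puts \<open>f 0\<close> strictly between 0 and 1.\<close>
  have "cmap f (abs_circle 0) \<noteq> abs_circle 0"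
  proof
    assume "cmap f (abs_circle 0) = abs_circle 0"
    then have "f 0 \<in> \<int>" by (simp add: cmap_abs[of f, OF shift] abs_circle_eq)
    then obtain k where k: "f 0 = of_int k" by (rule Ints_cases)
    moreover have "0 < f 0" "f 0 < 1" using alt[of 0 0] alt[of 1 0] by auto
    ultimately have "0 < k" "k < 1" by simp_all
    then show False by simp
  qed
  then show "cmap f \<noteq> id" by auto
qed

lemma second_deriv_at_min:
  assumes g: "smooth g" and nn: "\<And>x. g x \<ge> 0" and c: "g c = 0"
  shows "deriv g c = 0" "deriv (deriv g) c \<ge> 0"
proof -
  show d: "deriv g c = 0"
    by (rule DERIV_local_min[OF smooth_DERIV[OF g] zero_less_one]) (simp add: nn c)
  show "deriv (deriv g) c \<ge> 0"
  proof (rule ccontr)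
    assume "\<not> deriv (deriv g) c \<ge> 0"
    then have "deriv (deriv g) c < 0" by simp
    from DERIV_neg_dec_right[OF smooth_DERIV[OF smooth_deriv[OF g]] this]
    obtain r where r: "r > 0" "\<And>h. 0 < h \<Longrightarrow> h < r \<Longrightarrow> deriv g (c + h) < deriv g c" by blast
    have "\<exists>z. c < z \<and> z < c + r / 2 \<and> g (c + r / 2) - g c = (c + r / 2 - c) * deriv g z"
      using r(1) by (intro MVT2 smooth_DERIV g) auto
    then obtain z where z: "c < z" "z < c + r / 2" "g (c + r / 2) = r / 2 * deriv g z" using c by auto
    have "deriv g z < 0" using r(2)[of "z - c"] z d r(1) by auto
    then have "r / 2 * deriv g z < 0" using r(1) by (simp add: mult_pos_neg)
    then show False using nn[of "c + r / 2"] z by linarith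
  qed
qed

text \<open>The bump vanishes only where \<open>B x\<close> and \<open>B c\<close> differ by an
  integer, and \<open>B\<close> is increasing of degree one, so strictly between \<open>c\<close>
  and \<open>c + 1\<close> the displacement of \<open>W\<close> is positive. At \<open>c\<close> the
  displacement of \<open>W0\<close> has a minimum, with nonnegative second derivative, to which the
  bump adds \<open>s * (2 * pi * deriv B c)\<^sup>2\<close>.\<close>

lemma parabolic_perturbation:
  assumes W0: "smooth_lift W0" and B: "smooth_lift B"
    and W: "W = (\<lambda>x. W0 x + s * (1 - cos (2 * pi * (B x - B c))))" "smooth_lift W" and s: "s > 0"
    and ge: "\<And>x. W0 x \<ge> x" and c: "W0 c = c"
  shows "parabolic (cmap W)"
proof -
  have Wc: "W c = c" by (simp add: W(1) c)
  have lift: "is_lift W (cmap W)"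
    by (intro is_lift_cmap smooth_continuous smooth_liftD W(2))
  have fix_c: "cmap W (abs_circle c) = abs_circle c"
    by (simp add: cmap_abs[of W, OF smooth_liftD(2)[OF W(2)]] Wc)
  have uniq: "c' = abs_circle c" if "cmap W c' = c'" for c'
  proof -
    obtain y where y: "c' = abs_circle y" by (rule abs_circle_cases)
    \<comment> \<open>The lift of the fixed point in the period starting at \<open>c\<close>; if it
      were not \<open>c\<close>, then \<open>W x - x\<close> would be an integer strictly between 0
      and 1.\<close>
    define x where "x = c + frac (y - c)"
    have yx: "abs_circle y = abs_circle x" by (simp add: abs_circle_eq x_def frac_def)
    have "abs_circle (W x) = abs_circle x"
      using that unfolding y yx by (simp add: cmap_abs[of W, OF smooth_liftD(2)[OF W(2)]])
    then have int: "W x - x \<in> \<int>" by (simp add: abs_circle_eq)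
    have "x = c"
    proof (rule ccontr)
      assume "x \<noteq> c"
      then have x: "c < x" "x < c + 1" using frac_ge_0[of "y - c"] frac_lt_1[of "y - c"] unfolding x_def by auto
      have "W x < c + 1" using smooth_lift_less[OF W(2) x(2)] smooth_liftD(2)[OF W(2), of c] Wc by simp
      then have lt: "W x - x < 1" using x by simp
      have Bx: "0 < B x - B c" "B x - B c < 1"
        using smooth_lift_less[OF B x(1)] smooth_lift_less[OF B x(2)] smooth_liftD(2)[OF B, of c] by auto
      have "cos (2 * pi * (B x - B c)) \<noteq> 1"
      proof
        assume "cos (2 * pi * (B x - B c)) = 1"
        then obtain n :: int where "2 * pi * (B x - B c) = real_of_int n * 2 * pi" unfolding cos_one_2pi_int by blast
        then have "B x - B c = of_int n" by simp
        then have "0 < n" "n < 1" using Bx by simp_all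
        then show False by simp
      qed
      then have "cos (2 * pi * (B x - B c)) < 1" using cos_le_one[of "2 * pi * (B x - B c)"] by linarith
      then have "0 < s * (1 - cos (2 * pi * (B x - B c)))" using s by simp
      then have gt: "0 < W x - x" using ge[of x] by (simp add: W(1))
      obtain k where k: "W x - x = of_int k" using int by (rule Ints_cases)
      then have "0 < k" "k < 1" using lt gt by simp_all
      then show False by simp
    qed
    then show ?thesis using y yx by simp
  qed
  define g where "g = (\<lambda>x. W0 x - x)"
  have sW0: "smooth W0" and sB: "smooth B" using W0 B by (simp_all add: smooth_lift_def)
  have sg: "smooth g" unfolding g_def by (intro smooth_diff sW0 smooth_ident)
  have g: "deriv g c = 0" "deriv (deriv g) c \<ge> 0"
    by (rule second_deriv_at_min[OF sg]; simp add: g_def ge c)+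
  have Weq: "W = (\<lambda>x. x + g x + s * (1 - cos (2 * pi * (B x - B c))))"
    by (auto simp: W(1) g_def)
  have d1: "deriv W = (\<lambda>x. 1 + deriv g x + s * (sin (2 * pi * (B x - B c)) * (2 * pi * deriv B x)))"
    unfolding Weq
    by (rule ext, rule DERIV_imp_deriv)
      (auto intro!: derivative_eq_intros smooth_DERIV[OF sg] smooth_DERIV[OF sB])
  have "((\<lambda>x. 1 + deriv g x + s * (sin (2 * pi * (B x - B c)) * (2 * pi * deriv B x)))
      has_real_derivative deriv (deriv g) c + s * (2 * pi * deriv B c)\<^sup>2) (at c)"
    by (auto intro!: derivative_eq_intros smooth_DERIV[OF smooth_deriv[OF sg]] smooth_DERIV[OF sB]
        smooth_DERIV[OF smooth_deriv[OF sB]] simp: power2_eq_square)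
  then have d2: "deriv (deriv W) c = deriv (deriv g) c + s * (2 * pi * deriv B c)\<^sup>2"
    unfolding d1 by (rule DERIV_imp_deriv)
  have "deriv B c > 0" by (rule smooth_liftD[OF B])
  then have "s * (2 * pi * deriv B c)\<^sup>2 > 0" using s by simp
  then have "deriv (deriv W) c \<noteq> 0" unfolding d2 using g(2) by linarith
  then have "(deriv ^^ 2) W c \<noteq> 0" by (simp add: numeral_2_eq_2)
  moreover have "deriv W c = 1" by (simp add: d1 g(1))
  moreover have "cmap W \<in> Diff 2" by (rule cmap_Diff) (rule smooth_liftD[OF W(2)])+
  ultimately show ?thesis unfolding parabolic_def using lift fix_c uniq by blast
qed

section \<open>The generators\<close>

text \<open>A north-south map: 0 is attracting with slope \<open>1 / 2\<close>, and
  \<open>1 / 2\<close> is repelling with slope \<open>3 / 2\<close>.\<close>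

definition ref0 :: "real \<Rightarrow> real" where "ref0 x = x - sin (2 * pi * x) / (4 * pi)"

text \<open>The letters 0, 1, 2 contract \<open>[- 1 / 18, 1 / 18]\<close> and their images cover it; the letters 3, 4
  carry this interval across the repelling fixed point \<open>1 / 2\<close> of the letter 0.\<close>

definition ref :: "nat \<Rightarrow> real \<Rightarrow> real" where
  "ref a = (if a = 0 then ref0 else if a = 1 then (\<lambda>x. ref0 x + 1 / 27)
     else if a = 2 then (\<lambda>x. ref0 x + - (1 / 27)) else (\<lambda>x. x + 1 / 2))"

lemma deriv_ref0: "deriv ref0 x = 1 - cos (2 * pi * x) / 2"
  unfolding ref0_def by (rule DERIV_imp_deriv) (auto intro!: derivative_eq_intros)

lemma deriv_ref: "deriv (ref a) = (if a < 3 then deriv ref0 else (\<lambda>x. 1))"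
  using deriv_add_const[of ref0 "1 / 27"] deriv_add_const[of ref0 "- (1 / 27)"] by (auto simp: ref_def)

lemma deriv_ref_ge: "deriv (ref a) x \<ge> 1 / 2"
  using cos_le_one[of "2 * pi * x"] by (simp add: deriv_ref deriv_ref0)

lemma ref0_analytic: "real_analytic ref0"
proof -
  have "trig (\<lambda>x. - 1 / (4 * pi) * sin (2 * pi * real_of_int 1 * x))" by (rule trig_sin_int)
  then have "real_analytic (\<lambda>x. - 1 / (4 * pi) * sin (2 * pi * real_of_int 1 * x))" by (rule trig_analytic)
  moreover have "real_analytic (\<lambda>x. x)" by (rule real_analytic_entire[of "\<lambda>z. z"]) auto
  ultimately have "real_analytic (\<lambda>x. x + - 1 / (4 * pi) * sin (2 * pi * real_of_int 1 * x))"
    by (intro real_analytic_add)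
  moreover have "(\<lambda>x. x + - 1 / (4 * pi) * sin (2 * pi * real_of_int 1 * x)) = ref0"
    by (auto simp: ref0_def)
  ultimately show ?thesis by simp
qed

lemma ref_analytic_lift: "analytic_lift (ref a)"
  unfolding analytic_lift_def
proof (intro conjI allI)
  have c: "real_analytic (\<lambda>x. c)" for c by (rule real_analytic_entire[of "\<lambda>z. of_real c"]) auto
  have "real_analytic (\<lambda>x. x)" by (rule real_analytic_entire[of "\<lambda>z. z"]) auto
  then show "real_analytic (ref a)"
    unfolding ref_def using real_analytic_add[OF ref0_analytic c] real_analytic_add[OF _ c] ref0_analytic
    by (simp only: split: if_split) blast
  have "ref0 (x + 1) = ref0 x + 1" for x
    using sin_periodic[of "2 * pi * x"] by (simp add: ref0_def distrib_left)
  then show "ref a (x + 1) = ref a x + 1" for x by (auto simp: ref_def)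
  show "deriv (ref a) x > 0" for x using deriv_ref_ge[of a x] by linarith
qed

lemma cos_ge_half: "\<bar>x\<bar> \<le> 1 / 6 \<Longrightarrow> cos (2 * pi * x) \<ge> 1 / 2"
proof -
  assume x: "\<bar>x\<bar> \<le> 1 / 6"
  have "cos (pi / 3) \<le> cos (2 * pi * \<bar>x\<bar>)"
    using x pi_gt_zero by (intro cos_monotone_0_pi_le) (auto simp: field_simps)
  moreover have "cos (2 * pi * \<bar>x\<bar>) = cos (2 * pi * x)" by (cases "x \<ge> 0") auto
  ultimately show ?thesis by (simp add: cos_60)
qed

section \<open>Monotone convergence of iterates to a fixed point\<close>

lemma iterates_decrease_to:
  fixes G :: "real \<Rightarrow> real"
  assumes c: "\<And>x. isCont G x" and m: "mono G" and P: "G P = P" and x: "P < x"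
    and lt: "\<And>z. P < z \<Longrightarrow> z \<le> x \<Longrightarrow> G z < z"
  shows "(\<lambda>n. (G ^^ n) x) \<longlonglongrightarrow> P"
proof -
  have b: "P \<le> (G ^^ n) x \<and> (G ^^ n) x \<le> x" for n
  proof (induction n)
    case (Suc n)
    have "P \<le> G ((G ^^ n) x)" using monoD[OF m, of P "(G ^^ n) x"] P Suc by simp
    moreover have "G ((G ^^ n) x) \<le> (G ^^ n) x"
      using lt[of "(G ^^ n) x"] Suc P by (cases "(G ^^ n) x = P") auto
    ultimately show ?case using Suc by auto
  qed (use x in auto)
  have dec: "(G ^^ Suc n) x \<le> (G ^^ n) x" for n
    using lt[of "(G ^^ n) x"] b[of n] P by (cases "(G ^^ n) x = P") auto
  then have "decseq (\<lambda>n. (G ^^ n) x)" by (rule decseq_SucI)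
  then obtain l where l: "(\<lambda>n. (G ^^ n) x) \<longlonglongrightarrow> l" "\<And>n. l \<le> (G ^^ n) x"
    using decseq_convergent[of "\<lambda>n. (G ^^ n) x" P] b by blast
  have "P \<le> l" using l(1) b by (intro LIMSEQ_le_const) auto
  have "(\<lambda>n. G ((G ^^ n) x)) \<longlonglongrightarrow> G l" by (rule isCont_tendsto_compose[OF c l(1)])
  moreover have "(\<lambda>n. G ((G ^^ n) x)) \<longlonglongrightarrow> l" using LIMSEQ_Suc[OF l(1)] by simp
  ultimately have "G l = l" by (rule LIMSEQ_unique)
  then have "l = P" using lt[of l] l(2)[of 0] \<open>P \<le> l\<close> by (cases "l = P") auto
  then show ?thesis using l(1) by simp
qed

lemma iterates_increase_to:
  fixes G :: "real \<Rightarrow> real"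
  assumes c: "\<And>x. isCont G x" and m: "mono G" and P: "G P = P" and x: "x < P"
    and lt: "\<And>z. x \<le> z \<Longrightarrow> z < P \<Longrightarrow> G z > z"
  shows "(\<lambda>n. (G ^^ n) x) \<longlonglongrightarrow> P"
proof -
  define H where "H = (\<lambda>x. - G (- x))"
  have "(\<lambda>n. (H ^^ n) (- x)) \<longlonglongrightarrow> - P"
  proof (rule iterates_decrease_to)
    show "isCont H y" for y
      unfolding H_def by (intro continuous_minus isCont_o2[where g = G and f = uminus] c) auto
    show "mono H" using m by (auto simp: H_def mono_def)
    show "H z < z" if "- P < z" "z \<le> - x" for z using lt[of "- z"] that by (simp add: H_def)
  qed (use P x in \<open>auto simp: H_def\<close>)
  moreover have "(H ^^ n) (- x) = - (G ^^ n) x" for n by (induction n) (auto simp: H_def)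
  ultimately show ?thesis using tendsto_minus_cancel by fastforce
qed

locale generators =
  fixes Y :: "nat \<Rightarrow> real \<Rightarrow> real"
  assumes lift: "\<And>a. a < 5 \<Longrightarrow> smooth_lift (Y a)"
    and near: "\<And>a x. a < 5 \<Longrightarrow> \<bar>ref a x - Y a x\<bar> < 1 / 1000"
    and near': "\<And>a x. a < 5 \<Longrightarrow> \<bar>deriv (ref a) x - deriv (Y a) x\<bar> < 1 / 1000"
begin

lemma DY: "a < 5 \<Longrightarrow> (Y a has_real_derivative deriv (Y a) x) (at x)"
  using smooth_DERIV smooth_liftD(1)[OF lift] by blast

lemma cont: "a < 5 \<Longrightarrow> continuous_on S (Y a)"
  using smooth_continuous smooth_liftD(1)[OF lift] by blast

text \<open>For \<open>\<bar>x\<bar> \<le> 1 / 6\<close> the cosine is at least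
  \<open>1 / 2\<close>, so the reference slopes are at most \<open>3 / 4\<close>; the constant
  \<open>4 / 5\<close> leaves room for the perturbation.\<close>

lemma contraction:
  assumes a: "a < 3" and x: "\<bar>x\<bar> \<le> 1 / 6" and y: "\<bar>y\<bar> \<le> 1 / 6"
  shows "\<bar>Y a x - Y a y\<bar> \<le> 4 / 5 * \<bar>x - y\<bar>"
proof -
  obtain z where z: "min y x \<le> z" "z \<le> max y x" "Y a x - Y a y = deriv (Y a) z * (x - y)"
    using MVT_seg[of "Y a" "deriv (Y a)" y x] DY a by auto
  have "\<bar>z\<bar> \<le> 1 / 6" using z(1,2) x y by linarith
  then have "deriv (ref a) z \<le> 3 / 4" using cos_ge_half[of z] a by (simp add: deriv_ref deriv_ref0)
  then have "deriv (Y a) z \<le> 4 / 5" "deriv (Y a) z \<ge> 0"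
    using near'[of a z] smooth_liftD(3)[OF lift, of a z] a by linarith+
  then show ?thesis unfolding z(3) abs_mult by (intro mult_right_mono) auto
qed

lemma ref0_ends: "ref0 (1 / 18) \<ge> 1 / 36" "ref0 (- (1 / 18)) \<le> - (1 / 36)"
proof -
  have "sin (2 * pi * (1 / 18)) \<le> 2 * pi * (1 / 18)" by (rule sin_x_le_x) simp
  then have "sin (2 * pi * (1 / 18)) / (4 * pi) \<le> 1 / 36" by (simp add: field_simps)
  then show 1: "ref0 (1 / 18) \<ge> 1 / 36" unfolding ref0_def by linarith
  have "ref0 (- (1 / 18)) = - ref0 (1 / 18)" by (simp add: ref0_def)
  then show "ref0 (- (1 / 18)) \<le> - (1 / 36)" using 1 by linarith
qed

lemma intermediate_value:
  assumes "a < 5" "Y a (- (1 / 18)) \<le> y" "y \<le> Y a (1 / 18)"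
  shows "\<exists>x. \<bar>x\<bar> \<le> 1 / 18 \<and> Y a x = y"
proof -
  obtain x where x: "- (1 / 18) \<le> x" "x \<le> 1 / 18" "Y a x = y"
    using IVT'[OF assms(2,3) _ cont[OF assms(1)]] by auto
  then have "\<bar>x\<bar> \<le> 1 / 18" by linarith
  then show ?thesis using x(3) by blast
qed

lemma covers:
  assumes "\<bar>y\<bar> \<le> 1 / 18"
  shows "\<exists>a<3. \<exists>x. \<bar>x\<bar> \<le> 1 / 18 \<and> Y a x = y"
proof -
  have ends: "\<exists>x. \<bar>x\<bar> \<le> 1 / 18 \<and> Y a x = y"
    if "a < 3" "ref a (- (1 / 18)) + 1 / 1000 \<le> y" "y \<le> ref a (1 / 18) - 1 / 1000" for a
  proof -
    have "Y a (- (1 / 18)) \<le> y" "y \<le> Y a (1 / 18)"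
      using near[of a "- (1 / 18)"] near[of a "1 / 18"] that by linarith+
    then show ?thesis using that(1) by (intro intermediate_value) simp_all
  qed
  \<comment> \<open>The image of the interval under \<open>ref0\<close> contains
    \<open>[- 1 / 36, 1 / 36]\<close>, and the letters 1 and 2 shift it by \<open>1 / 27\<close>
    either way. Switching letters at \<open>1 / 54\<close> leaves a margin of \<open>1 / 108\<close>
    at every end, well above the error \<open>1 / 1000\<close>.\<close>
  consider "y \<le> - (1 / 54)" | "\<bar>y\<bar> \<le> 1 / 54" | "y \<ge> 1 / 54" by linarith
  then show ?thesis
  proof cases
    case 1
    then show ?thesis using ends[of 2] ref0_ends assms by (intro exI[of _ 2]) (simp add: ref_def abs_le_iff)
  next
    case 2
    then show ?thesis using ends[of 0] ref0_ends by (intro exI[of _ 0]) (simp add: ref_def abs_le_iff)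
  next
    case 3
    then show ?thesis using ends[of 1] ref0_ends assms by (intro exI[of _ 1]) (simp add: ref_def abs_le_iff)
  qed
qed

text \<open>The word is built from its end: a preimage \<open>z\<close> of the target under a
  covering letter is approximated recursively, and applying the letter shrinks the error by
  \<open>4 / 5\<close>.\<close>

lemma dense_words:
  "\<bar>y\<bar> \<le> 1 / 18 \<Longrightarrow> \<exists>ms\<in>lists {..<3}. \<forall>x. \<bar>x\<bar> \<le> 1 / 18 \<longrightarrow> \<bar>wd Y ms x - y\<bar> \<le> (4 / 5) ^ n * (1 / 9)"
proof (induction n arbitrary: y)
  case 0
  have "\<bar>x - y\<bar> \<le> 1 / 9" if "\<bar>x\<bar> \<le> 1 / 18" for x using that 0 by linarith
  then show ?case by (intro bexI[of _ "[]"]) simp_all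
next
  case (Suc n)
  obtain a z where a: "a < 3" "\<bar>z\<bar> \<le> 1 / 18" "Y a z = y" using covers[OF Suc.prems] by blast
  obtain ms where ms: "ms \<in> lists {..<3}" "\<And>x. \<bar>x\<bar> \<le> 1 / 18 \<Longrightarrow> \<bar>wd Y ms x - z\<bar> \<le> (4 / 5) ^ n * (1 / 9)"
    using Suc.IH[OF a(2)] by blast
  have "\<bar>wd Y (ms @ [a]) x - y\<bar> \<le> (4 / 5) ^ Suc n * (1 / 9)" if x: "\<bar>x\<bar> \<le> 1 / 18" for x
  proof -
    \<comment> \<open>An error of at most \<open>1 / 9\<close> around a point of
      \<open>[- 1 / 18, 1 / 18]\<close> stays within \<open>1 / 6\<close>, where the letters
      contract; hence the larger domain in \<open>contraction\<close>.\<close>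
    have "(4 / 5 :: real) ^ n \<le> 1" by (intro power_le_one) auto
    then have "\<bar>wd Y ms x - z\<bar> \<le> 1 / 9" using ms(2)[OF x] by linarith
    then have "\<bar>wd Y ms x\<bar> \<le> 1 / 6" "\<bar>z\<bar> \<le> 1 / 6" using a(2) by linarith+
    then have "\<bar>Y a (wd Y ms x) - Y a z\<bar> \<le> 4 / 5 * \<bar>wd Y ms x - z\<bar>" using a(1) by (intro contraction)
    then show ?thesis using ms(2)[OF x] a(3) by simp
  qed
  then show ?case using ms(1) a(1) by (intro bexI[of _ "ms @ [a]"]) auto
qed

section \<open>The fixed points of the letter 0\<close>

lemma attracting: "\<exists>P. \<bar>P\<bar> \<le> 1 / 18 \<and> Y 0 P = P"
proof -
  have "\<bar>Y 0 0\<bar> < 1 / 1000" using near[of 0 0] by (simp add: ref_def ref0_def)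
  moreover have "\<bar>Y 0 (1 / 18) - Y 0 0\<bar> \<le> 4 / 5 * \<bar>1 / 18 - 0\<bar>" "\<bar>Y 0 (- (1 / 18)) - Y 0 0\<bar> \<le> 4 / 5 * \<bar>- (1 / 18) - 0\<bar>"
    by (intro contraction; simp)+
  ultimately have "Y 0 (1 / 18) - 1 / 18 \<le> 0" "Y 0 (- (1 / 18)) - (- (1 / 18)) \<ge> 0"
    unfolding abs_minus_cancel diff_0_right by linarith+
  moreover have "continuous_on {- (1 / 18)..1 / 18} (\<lambda>x. Y 0 x - x)" by (intro continuous_intros cont) simp
  ultimately obtain P where "- (1 / 18) \<le> P" "P \<le> 1 / 18" "Y 0 P - P = 0"
    using IVT2'[of "\<lambda>x. Y 0 x - x" "1 / 18" 0 "- (1 / 18)"] by fastforce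
  then show ?thesis by (intro exI[of _ P]) (simp add: abs_le_iff)
qed

lemma displacement_increasing:
  assumes "\<bar>x - 1 / 2\<bar> \<le> 1 / 6" "\<bar>y - 1 / 2\<bar> \<le> 1 / 6" "x \<le> y"
  shows "Y 0 y - y \<ge> Y 0 x - x + (y - x) / 5"
proof -
  obtain z where z: "min x y \<le> z" "z \<le> max x y" "Y 0 y - Y 0 x = deriv (Y 0) z * (y - x)"
    using MVT_seg[of "Y 0" "deriv (Y 0)" x y] DY[of 0] by auto
  have "\<bar>z - 1 / 2\<bar> \<le> 1 / 6" using z(1,2) assms by linarith
  then have "cos (2 * pi * (z - 1 / 2)) \<ge> 1 / 2" by (rule cos_ge_half)
  moreover have "cos (2 * pi * (z - 1 / 2)) = - cos (2 * pi * z)" by (simp add: right_diff_distrib cos_diff)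
  ultimately have "deriv (ref 0) z \<ge> 5 / 4" by (simp add: deriv_ref deriv_ref0)
  then have "deriv (Y 0) z \<ge> 6 / 5" using near'[of 0 z, simplified abs_less_iff] by simp
  then have "6 / 5 * (y - x) \<le> deriv (Y 0) z * (y - x)" using assms(3) by (intro mult_right_mono) auto
  then show ?thesis using z(3) by (simp add: field_simps)
qed

lemma repelling: "\<exists>R. \<bar>R - 1 / 2\<bar> \<le> 1 / 100 \<and> Y 0 R = R"
proof -
  have "\<bar>Y 0 (1 / 2) - 1 / 2\<bar> < 1 / 1000" using near[of 0 "1 / 2"] by (simp add: ref_def ref0_def abs_minus_commute)
  moreover have "Y 0 (51 / 100) - 51 / 100 \<ge> Y 0 (1 / 2) - 1 / 2 + (51 / 100 - 1 / 2) / 5"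
    "Y 0 (1 / 2) - 1 / 2 \<ge> Y 0 (49 / 100) - 49 / 100 + (1 / 2 - 49 / 100) / 5"
    by (intro displacement_increasing; simp)+
  ultimately have "Y 0 (51 / 100) - 51 / 100 \<ge> 0" "Y 0 (49 / 100) - 49 / 100 \<le> 0"
    unfolding abs_less_iff by simp_all
  moreover have "continuous_on {49 / 100..51 / 100} (\<lambda>x. Y 0 x - x)" by (intro continuous_intros cont) simp
  ultimately obtain R where "49 / 100 \<le> R" "R \<le> 51 / 100" "Y 0 R - R = 0"
    using IVT'[of "\<lambda>x. Y 0 x - x" "49 / 100" 0 "51 / 100"] by fastforce
  then show ?thesis by (intro exI[of _ R]) linarith+
qed

lemma displacement_middle:
  "\<bar>x - 1 / 4\<bar> \<le> 1 / 6 \<Longrightarrow> Y 0 x < x" "\<bar>x - 3 / 4\<bar> \<le> 1 / 6 \<Longrightarrow> Y 0 x > x"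
proof -
  have pi: "1 / 2 / (4 * pi) > 1 / 1000"
    using pi_less_4 pi_gt_zero by (simp add: field_simps)
  have n: "\<bar>(x - sin (2 * pi * x) / (4 * pi)) - Y 0 x\<bar> < 1 / 1000" using near[of 0 x] by (simp add: ref_def ref0_def)
  show "Y 0 x < x" if "\<bar>x - 1 / 4\<bar> \<le> 1 / 6"
  proof -
    have "cos (2 * pi * (x - 1 / 4)) = sin (2 * pi * x)" by (simp add: right_diff_distrib cos_diff)
    then have "sin (2 * pi * x) / (4 * pi) \<ge> 1 / 2 / (4 * pi)"
      using cos_ge_half[OF that] by (intro divide_right_mono) auto
    then show ?thesis using n pi by linarith
  qed
  show "Y 0 x > x" if "\<bar>x - 3 / 4\<bar> \<le> 1 / 6"
  proof -
    have "2 * pi * (x - 3 / 4) = (2 * pi * x - pi) - pi / 2" by (simp add: field_simps)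
    then have "cos (2 * pi * (x - 3 / 4)) = sin (2 * pi * x - pi)" by (simp only: cos_diff) simp
    also have "\<dots> = - sin (2 * pi * x)" by (simp add: sin_diff)
    finally have "(- sin (2 * pi * x)) / (4 * pi) \<ge> 1 / 2 / (4 * pi)"
      using cos_ge_half[OF that] by (intro divide_right_mono) auto
    then show ?thesis using n pi by linarith
  qed
qed

text \<open>Three ranges: contraction near \<open>P\<close>, expansion near \<open>R\<close>, and in
  between the sine term of the reference map outweighs the perturbation.\<close>

lemma displacement_signs:
  assumes P: "\<bar>P\<bar> \<le> 1 / 18" "Y 0 P = P" and R: "\<bar>R - 1 / 2\<bar> \<le> 1 / 100" "Y 0 R = R"
  shows "P < x \<Longrightarrow> x < R \<Longrightarrow> Y 0 x < x" "R < x \<Longrightarrow> x < P + 1 \<Longrightarrow> Y 0 x > x"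
proof -
  have near_P: "\<bar>Y 0 x - P\<bar> < \<bar>x - P\<bar>" if "\<bar>x\<bar> \<le> 1 / 6" "x \<noteq> P" for x
  proof -
    have "\<bar>P\<bar> \<le> 1 / 6" using P(1) by linarith
    then have "\<bar>Y 0 x - P\<bar> \<le> 4 / 5 * \<bar>x - P\<bar>" using contraction[of 0 x P] that(1) P(2) by simp
    also have "4 / 5 * \<bar>x - P\<bar> < \<bar>x - P\<bar>" using that(2) by simp
    finally show ?thesis .
  qed
  have Rb: "49 / 100 \<le> R" "R \<le> 51 / 100" and Pb: "- (1 / 18) \<le> P" "P \<le> 1 / 18"
    using R(1) P(1) by linarith+
  show "Y 0 x < x" if x: "P < x" "x < R"
  proof -
    consider "x \<le> 1 / 6" | "1 / 6 \<le> x" "x \<le> 1 / 3" | "1 / 3 \<le> x" by linarith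
    then show ?thesis
    proof cases
      case 1
      then have "\<bar>Y 0 x - P\<bar> < \<bar>x - P\<bar>" using x Pb by (intro near_P) linarith+
      then show ?thesis using x by linarith
    next
      case 2
      then show ?thesis by (intro displacement_middle(1)) linarith+
    next
      case 3
      then have "Y 0 R - R \<ge> Y 0 x - x + (R - x) / 5"
        using x Rb by (intro displacement_increasing) linarith+
      then show ?thesis using R(2) x by argo
    qed
  qed
  show "Y 0 x > x" if x: "R < x" "x < P + 1"
  proof -
    consider "x \<le> 2 / 3" | "2 / 3 \<le> x" "x \<le> 5 / 6" | "5 / 6 \<le> x" by linarith
    then show ?thesis
    proof cases
      case 1
      then have "Y 0 x - x \<ge> Y 0 R - R + (x - R) / 5"
        using x Rb by (intro displacement_increasing) linarith+
      then show ?thesis using R(2) x by argo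
    next
      case 2
      then show ?thesis by (intro displacement_middle(2)) linarith+
    next
      case 3
      then have "\<bar>Y 0 (x - 1) - P\<bar> < \<bar>x - 1 - P\<bar>" using x Pb by (intro near_P) linarith+
      then have "Y 0 (x - 1) > x - 1" using x by linarith
      then show ?thesis using smooth_liftD(2)[OF lift, of 0 "x - 1"] by simp
    qed
  qed
qed

text \<open>The letter \<open>z\<close> maps some \<open>y\<close> of the covered interval to the
  repelling point \<open>R\<close>, and a word \<open>ms\<close> sends the attracting point
  \<open>P\<close> near \<open>y\<close>, so \<open>q\<close> is near \<open>R\<close>. A high power
  of the letter 0 in front carries a left neighbour of \<open>R\<close> close to \<open>P\<close>
  and a right neighbour close to \<open>P + 1\<close>, which the other letters send close to
  \<open>q\<close> and \<open>q + 1\<close>: across a tiny interval at \<open>R\<close> the image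
  jumps by almost a full turn.\<close>

lemma crossing_word:
  assumes z: "z = 3 \<or> z = 4" and \<delta>: "\<delta> > 0"
  obtains ms t1 t2 x1 x2 where "ms \<in> lists {..<3}" "- \<delta> < t1" "t1 < t2" "t2 < \<delta>"
    "Y z (wd Y ms x1) + t1 < x1" "Y z (wd Y ms x2) + t2 > x2 + 1"
proof -
  obtain P where P: "\<bar>P\<bar> \<le> 1 / 18" "Y 0 P = P" using attracting by blast
  obtain R where R: "\<bar>R - 1 / 2\<bar> \<le> 1 / 100" "Y 0 R = R" using repelling by blast
  have z5: "z < 5" using z by auto
  have ref_rot: "ref z x = x + 1 / 2" for x using z by (auto simp: ref_def)
  have "Y z (- (1 / 18)) \<le> R" "R \<le> Y z (1 / 18)"
    using near[OF z5, of "- (1 / 18)"] near[OF z5, of "1 / 18"] R(1) unfolding ref_rot by linarith+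
  then obtain y where y: "\<bar>y\<bar> \<le> 1 / 18" "Y z y = R" using intermediate_value[OF z5] by blast
  \<comment> \<open>The cap \<open>1 / 10\<close> keeps \<open>x1\<close> above \<open>P\<close> and
    \<open>x2\<close> below \<open>P + 1\<close>.\<close>
  define d where "d = min \<delta> (1 / 10)"
  have d: "d > 0" "d \<le> \<delta>" "d \<le> 1 / 10" using \<delta> by (auto simp: d_def)
  have isC: "isCont (Y z) w" for w using cont[OF z5, of UNIV] by (simp add: continuous_on_eq_continuous_at)
  have "d / 8 > 0" using d by simp
  then obtain \<eta> where \<eta>: "\<eta> > 0" "\<And>w. dist w y < \<eta> \<Longrightarrow> dist (Y z w) (Y z y) < d / 8"
    using isC[of y] unfolding continuous_at_eps_delta by blast
  obtain n where n: "(4 / 5 :: real) ^ n < \<eta>" using real_arch_pow_inv[OF \<eta>(1), of "4 / 5"] by auto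
  obtain ms where ms: "ms \<in> lists {..<3}" "\<And>x. \<bar>x\<bar> \<le> 1 / 18 \<Longrightarrow> \<bar>wd Y ms x - y\<bar> \<le> (4 / 5) ^ n * (1 / 9)"
    using dense_words[OF y(1)] by blast
  define q where "q = Y z (wd Y ms P)"
  have "(4 / 5 :: real) ^ n * (1 / 9) < \<eta>" using n \<eta>(1) by linarith
  then have "\<bar>wd Y ms P - y\<bar> < \<eta>" using ms(2)[OF P(1)] by simp
  then have q: "\<bar>q - R\<bar> < d / 8" using \<eta>(2)[of "wd Y ms P"] y(2) by (simp add: q_def dist_real_def)
  have wl: "smooth_lift (wd Y ms)" using ms(1) lift by (intro wd_smooth_lift) auto
  define H where "H = Y z \<circ> wd Y ms"
  have Hl: "smooth_lift H" unfolding H_def by (rule smooth_lift_comp[OF lift[OF z5] wl])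
  have HC: "isCont H w" for w by (rule smooth_isCont[OF smooth_liftD(1)[OF Hl]])
  have HP: "H P = q" "H (P + 1) = q + 1" using smooth_liftD(2)[OF Hl, of P] by (simp_all add: H_def q_def)
  \<comment> \<open>The limits \<open>q + t1\<close> and \<open>q + 1 + t2\<close> are
    \<open>R - d / 4\<close> and \<open>R + 1 + d / 4\<close>, beyond \<open>x1\<close> and
    \<open>x2 + 1\<close>; since \<open>q\<close> is within \<open>d / 8\<close> of
    \<open>R\<close>, both translations are smaller than \<open>d\<close>.\<close>
  define x1 x2 t1 t2 where "x1 = R - d / 8" and "x2 = R + d / 8" and "t1 = R - q - d / 4" and "t2 = R - q + d / 4"
  have Rb: "49 / 100 \<le> R" "R \<le> 51 / 100" and Pb: "- (1 / 18) \<le> P" "P \<le> 1 / 18"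
    using R(1) P(1) by linarith+
  have l0: "smooth_lift (Y 0)" by (rule lift) simp
  have C0: "isCont (Y 0) w" for w by (rule smooth_isCont[OF smooth_liftD(1)[OF l0]])
  have "(\<lambda>n. (Y 0 ^^ n) x1) \<longlonglongrightarrow> P"
    using displacement_signs(1)[OF P R] Rb Pb d
    by (intro iterates_decrease_to C0 smooth_lift_mono l0 P) (auto simp: x1_def)
  then have "(\<lambda>n. H ((Y 0 ^^ n) x1) + t1) \<longlonglongrightarrow> q + t1"
    unfolding HP(1)[symmetric] by (intro tendsto_add tendsto_const isCont_tendsto_compose[OF HC])
  moreover have "q + t1 < x1" using d by (simp add: t1_def x1_def)
  ultimately have e1: "\<forall>\<^sub>F n in sequentially. H ((Y 0 ^^ n) x1) + t1 < x1" by (rule order_tendstoD)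
  have P1: "Y 0 (P + 1) = P + 1" using smooth_liftD(2)[OF l0, of P] P by simp
  have "(\<lambda>n. (Y 0 ^^ n) x2) \<longlonglongrightarrow> P + 1"
    using displacement_signs(2)[OF P R] Rb Pb d
    by (intro iterates_increase_to C0 smooth_lift_mono l0 P1) (auto simp: x2_def)
  then have "(\<lambda>n. H ((Y 0 ^^ n) x2) + t2) \<longlonglongrightarrow> (q + 1) + t2"
    unfolding HP(2)[symmetric] by (intro tendsto_add tendsto_const isCont_tendsto_compose[OF HC])
  moreover have "x2 + 1 < (q + 1) + t2" using d by (simp add: t2_def x2_def)
  ultimately have e2: "\<forall>\<^sub>F n in sequentially. x2 + 1 < H ((Y 0 ^^ n) x2) + t2" by (rule order_tendstoD)
  obtain N where N: "H ((Y 0 ^^ N) x1) + t1 < x1" "x2 + 1 < H ((Y 0 ^^ N) x2) + t2"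
    using eventually_happens[OF eventually_conj[OF e1 e2]] by auto
  show ?thesis
  proof (rule that)
    show "replicate N 0 @ ms \<in> lists {..<3}" using ms(1) by auto
    show "Y z (wd Y (replicate N 0 @ ms) x1) + t1 < x1" "x2 + 1 < Y z (wd Y (replicate N 0 @ ms) x2) + t2"
      using N by (simp_all add: wd_append wd_replicate H_def)
    show "- \<delta> < t1" "t1 < t2" "t2 < \<delta>" using q d unfolding t1_def t2_def by linarith+
  qed
qed

lemma golden_translation:
  assumes "\<delta> > 0"
  obtains ms t where "ms \<in> lists {..<3}" "\<bar>t\<bar> < \<delta>" "golden (\<lambda>x. Y 3 (wd Y ms x) + t)"
proof -
  obtain ms t1 t2 x1 x2 where ms: "ms \<in> lists {..<3}" and t: "- \<delta> < t1" "t1 < t2" "t2 < \<delta>"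
    and x: "Y 3 (wd Y ms x1) + t1 < x1" "Y 3 (wd Y ms x2) + t2 > x2 + 1"
    using crossing_word[of 3 \<delta>] assms by blast
  have "smooth_lift (wd Y ms)" using ms by (intro wd_smooth_lift lift) auto
  then have W: "smooth_lift (Y 3 \<circ> wd Y ms)" by (intro smooth_lift_comp lift) simp_all
  have "\<exists>t\<in>{t1..t2}. golden (\<lambda>x. (Y 3 \<circ> wd Y ms) x + t)"
    by (rule golden_parameter[OF smooth_liftD(1)[OF W] smooth_liftD(2)[OF W] smooth_liftD(3)[OF W],
          of t1 t2 x1 x2]) (use t x in simp_all)
  then obtain t where "t1 \<le> t" "t \<le> t2" "golden (\<lambda>x. Y 3 (wd Y ms x) + t)" by auto
  then show ?thesis using ms t by (intro that[of ms t]) auto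
qed

lemma tangent_translation:
  assumes "\<delta> > 0"
  obtains ms t c where "ms \<in> lists {..<3}" "\<bar>t\<bar> < \<delta>" "\<And>x. Y 4 (wd Y ms x) + t \<ge> x" "Y 4 (wd Y ms c) + t = c"
proof -
  obtain ms t1 t2 x1 x2 where ms: "ms \<in> lists {..<3}" and t: "- \<delta> < t1" "t1 < t2" "t2 < \<delta>"
    and x: "Y 4 (wd Y ms x1) + t1 < x1" "Y 4 (wd Y ms x2) + t2 > x2 + 1"
    using crossing_word[of 4 \<delta>] assms by blast
  have "smooth_lift (wd Y ms)" using ms by (intro wd_smooth_lift lift) auto
  then have W: "smooth_lift (Y 4 \<circ> wd Y ms)" by (intro smooth_lift_comp lift) simp_all
  define u where "u x = Y 4 (wd Y ms x) - x" for x
  have disp: "\<bar>u x - u y\<bar> \<le> 1" for x y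
    using mono_shift_dispersion[OF smooth_lift_mono[OF W] smooth_liftD(2)[OF W], of x y] by (simp add: u_def)
  \<comment> \<open>The dispersion bound makes this function nonnegative, so the point where its
    absolute value is largest is a minimum of \<open>u\<close>.\<close>
  have "periodic (\<lambda>x. u 0 + 1 - u x)"
    using smooth_liftD(2)[OF W] by (simp add: periodic_def u_def)
  moreover have "continuous_on UNIV (\<lambda>x. u 0 + 1 - u x)"
    using smooth_continuous[OF smooth_liftD(1)[OF W]] unfolding u_def comp_def by (intro continuous_intros)
  ultimately obtain c where c: "\<And>x. \<bar>u 0 + 1 - u x\<bar> \<le> \<bar>u 0 + 1 - u c\<bar>" using periodic_attains by blast
  have min: "u c \<le> u x" for x using c[of x] disp[of x 0] disp[of c 0] by linarith
  have "u c < - t1" using min[of x1] x(1) unfolding u_def by linarith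
  moreover have "u c > - t2" using disp[of x2 c] x(2) unfolding u_def by linarith
  ultimately have "\<bar>- u c\<bar> < \<delta>" using t by linarith
  moreover have "Y 4 (wd Y ms x) + - u c \<ge> x" for x using min[of x] unfolding u_def by linarith
  moreover have "Y 4 (wd Y ms c) + - u c = c" by (simp add: u_def)
  ultimately show ?thesis using ms that by blast
qed

end

section \<open>Density\<close>

lemma admissible_topspace: "admissible X \<Longrightarrow> analytic_lift F \<Longrightarrow> cmap F \<in> topspace X"
  and admissible_openin: "admissible X \<Longrightarrow> openin X (C1_ball f e \<inter> topspace X)"
  by (simp_all add: admissible_def)

lemma ball_lift:
  assumes X: "admissible X" and V: "openin X V" "f \<in> V" and f: "f \<in> C1_ball (cmap (ref a)) e" and e: "e \<le> 1 / 4"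
  obtains Y where "analytic_lift Y" "cmap Y \<in> V"
    "\<And>x. \<bar>ref a x - Y x\<bar> < e" "\<And>x. \<bar>deriv (ref a) x - deriv Y x\<bar> < e"
proof -
  have close: "\<exists>F. is_lift F g \<and> (\<forall>x. \<bar>ref a x - F x\<bar> < e) \<and> (\<forall>x. \<bar>deriv (ref a) x - deriv F x\<bar> < e)"
    if g: "g \<in> C1_ball (cmap (ref a)) e" for g
  proof -
    obtain d where d: "d < e" "close_C 1 d (cmap (ref a)) g" using g unfolding C1_ball_def by blast
    obtain F where F: "is_lift F g" "\<And>k x. k \<le> 1 \<Longrightarrow> \<bar>(deriv ^^ k) (ref a) x - (deriv ^^ k) F x\<bar> < d"
      using close_C_lift[OF d(2) analytic_lift_D(7)[OF ref_analytic_lift]] by blast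
    show ?thesis
    proof (intro exI conjI allI)
      show "\<bar>ref a x - F x\<bar> < e" "\<bar>deriv (ref a) x - deriv F x\<bar> < e" for x
        using F(2)[of 0 x] F(2)[of 1 x] d(1) by simp_all
    qed (rule F(1))
  qed
  obtain F where F: "is_lift F f" "\<And>x. \<bar>ref a x - F x\<bar> < e" "\<And>x. \<bar>deriv (ref a) x - deriv F x\<bar> < e"
    using close[OF f] by blast
  obtain k :: int where k: "\<And>x. F (x + 1) = F x + of_int k" using is_lift_degree[OF F(1)] by blast
  \<comment> \<open>Closeness at the points 0 and 1 puts \<open>k\<close> within
    \<open>2 * e \<le> 1 / 2\<close> of the degree 1 of the reference map.\<close>
  have "\<bar>of_int k - 1 :: real\<bar> < 1"
    using F(2)[of 0] F(2)[of 1] k[of 0] analytic_lift_D(3)[OF ref_analytic_lift, of a 0] e by simp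
  then have "k = 1" by linarith
  then have shift: "\<forall>x. F (x + 1) = F x + 1" using k by simp
  have D: "\<forall>x. deriv F x \<ge> 1 / 4"
  proof
    show "deriv F x \<ge> 1 / 4" for x using F(3)[of x] deriv_ref_ge[of a x] e by linarith
  qed
  define U where "U = V \<inter> (C1_ball (cmap (ref a)) e \<inter> topspace X)"
  have "openin X U" "f \<in> U"
    using openin_Int[OF V(1) admissible_openin[OF X]] V(2) f openin_subset[OF V(1)] by (auto simp: U_def)
  then obtain G where G: "analytic_lift G" "cmap G \<in> U"
    using X F(1) shift D unfolding admissible_def by (meson zero_less_divide_1_iff zero_less_numeral)
  obtain Y where Y: "is_lift Y (cmap G)" "\<And>x. \<bar>ref a x - Y x\<bar> < e" "\<And>x. \<bar>deriv (ref a) x - deriv Y x\<bar> < e"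
    using close[of "cmap G"] G(2) unfolding U_def by blast
  \<comment> \<open>The lift \<open>Y\<close> near the reference map and the analytic lift
    \<open>G\<close> of the same circle map may differ by an integer, which affects neither
    analyticity nor the derivative.\<close>
  obtain l :: int where l: "\<And>x. Y x = G x + of_int l"
    using is_lift_unique[OF analytic_lift_D(7)[OF G(1)] Y(1)] by blast
  have "real_analytic (\<lambda>x. of_int l)" by (rule real_analytic_entire[of "\<lambda>z. of_int l"]) auto
  then have "analytic_lift (\<lambda>x. G x + of_int l)"
    using G(1) by (simp add: analytic_lift_def deriv_add_const real_analytic_add)
  moreover have "(\<lambda>x. G x + of_int l) = Y" using l by auto
  moreover have "cmap Y \<in> V" using G(2) cmap_lift[OF Y(1)] by (simp add: U_def)
  ultimately show ?thesis using that Y(2,3) by simp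
qed

lemma trig_bump: "trig (\<lambda>x. 1 - cos (2 * pi * (x - \<theta>)))"
proof -
  have "trig (\<lambda>x. 1 + (- cos (2 * pi * \<theta>) * cos (2 * pi * real_of_int 1 * x)
      + - sin (2 * pi * \<theta>) * sin (2 * pi * real_of_int 1 * x)))"
    by (intro trig_add trig_const trig_cos_int trig_sin_int)
  moreover have "1 + (- cos (2 * pi * \<theta>) * cos (2 * pi * real_of_int 1 * x)
      + - sin (2 * pi * \<theta>) * sin (2 * pi * real_of_int 1 * x)) = 1 - cos (2 * pi * (x - \<theta>))" for x
    by (simp add: right_diff_distrib cos_diff)
  ultimately show ?thesis by simp
qed

text \<open>The empty word always gives the identity, which is itself a rotation; the clause
  \<open>f \<noteq> id\<close> keeps the condition on smooth rotations from being void.\<close>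

definition good_tuples :: "(nat \<Rightarrow> circle \<Rightarrow> circle) set" where
  "good_tuples = {g \<in> PiE {..<5} (\<lambda>_. Diff_omega).
     (\<exists>f\<in>semigroup_span {..<5} g. parabolic f) \<and>
     (\<exists>f\<in>semigroup_span {..<5} g. smooth_rotation f \<and> f \<noteq> id)}"

text \<open>The words \<open>m3\<close> and \<open>m4\<close> use the letters 0, 1, 2 only, so
  changing the letters 3 and 4 leaves them intact (\<open>wdZ\<close>). The letter 4 is changed
  twice within its open set: a translation creates a tangency, then a bump reduces it to a single
  nondegenerate fixed point.\<close>

lemma good_tuple_in_box:
  assumes X: "admissible X" and V: "\<And>a. a < 5 \<Longrightarrow> openin X (V a)" and f: "\<And>a. a < 5 \<Longrightarrow> f a \<in> V a"
    and near: "\<And>a. a < 5 \<Longrightarrow> f a \<in> C1_ball (cmap (ref a)) (1 / 1000)"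
  shows "\<exists>g\<in>good_tuples. g \<in> PiE {..<5} V"
proof -
  have "\<exists>Y. analytic_lift Y \<and> cmap Y \<in> V a \<and> (\<forall>x. \<bar>ref a x - Y x\<bar> < 1 / 1000)
      \<and> (\<forall>x. \<bar>deriv (ref a) x - deriv Y x\<bar> < 1 / 1000)" if a: "a < 5" for a
    by (rule ball_lift[OF X V[OF a] f[OF a] near[OF a]]) auto
  then obtain Y where Y: "\<And>a. a < 5 \<Longrightarrow> analytic_lift (Y a)" "\<And>a. a < 5 \<Longrightarrow> cmap (Y a) \<in> V a"
    "\<And>a x. a < 5 \<Longrightarrow> \<bar>ref a x - Y a x\<bar> < 1 / 1000"
    "\<And>a x. a < 5 \<Longrightarrow> \<bar>deriv (ref a) x - deriv (Y a) x\<bar> < 1 / 1000" by metis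
  interpret generators Y
    by unfold_locales (rule analytic_smooth_lift[OF Y(1)] Y(3) Y(4), assumption)+
  have perturb: "\<exists>\<delta>>0. \<forall>s. \<bar>s\<bar> < \<delta> \<longrightarrow> analytic_lift (\<lambda>x. Z x + s * T x) \<and> cmap (\<lambda>x. Z x + s * T x) \<in> V a"
    if "a < 5" "analytic_lift Z" "cmap Z \<in> V a" "trig T" for a Z T
    using X V[OF that(1)] that(2-) unfolding admissible_def by blast
  obtain d3 where d3: "d3 > 0" "\<And>s. \<bar>s\<bar> < d3 \<Longrightarrow> analytic_lift (\<lambda>x. Y 3 x + s * 1) \<and> cmap (\<lambda>x. Y 3 x + s * 1) \<in> V 3"
    using perturb[of 3 "Y 3", OF _ Y(1,2) trig_const[of 1]] by auto
  obtain m3 t3 where m3: "m3 \<in> lists {..<3}" "\<bar>t3\<bar> < d3" "golden (\<lambda>x. Y 3 (wd Y m3 x) + t3)"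
    by (rule golden_translation[OF d3(1)])
  obtain d4 where d4: "d4 > 0" "\<And>s. \<bar>s\<bar> < d4 \<Longrightarrow> analytic_lift (\<lambda>x. Y 4 x + s * 1) \<and> cmap (\<lambda>x. Y 4 x + s * 1) \<in> V 4"
    using perturb[of 4 "Y 4", OF _ Y(1,2) trig_const[of 1]] by auto
  obtain m4 t4 c where m4: "m4 \<in> lists {..<3}" "\<bar>t4\<bar> < d4" "\<And>x. Y 4 (wd Y m4 x) + t4 \<ge> x" "Y 4 (wd Y m4 c) + t4 = c"
    by (rule tangent_translation[OF d4(1)]) (rule that)
  \<comment> \<open>The bump is centred at the argument that the last letter receives when the word
    is evaluated at \<open>c\<close>; in the word it becomes a function of
    \<open>wd Y m4 x - wd Y m4 c\<close>.\<close>
  define \<theta> where "\<theta> = wd Y m4 c"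
  have Y4: "analytic_lift (\<lambda>x. Y 4 x + t4)" "cmap (\<lambda>x. Y 4 x + t4) \<in> V 4" using d4(2)[OF m4(2)] by simp_all
  obtain d5 where d5: "d5 > 0" "\<And>s. \<bar>s\<bar> < d5 \<Longrightarrow> analytic_lift (\<lambda>x. Y 4 x + t4 + s * (1 - cos (2 * pi * (x - \<theta>))))
      \<and> cmap (\<lambda>x. Y 4 x + t4 + s * (1 - cos (2 * pi * (x - \<theta>)))) \<in> V 4"
    using perturb[OF _ Y4 trig_bump[of \<theta>]] by auto
  define s where "s = d5 / 2"
  have s: "s > 0" "\<bar>s\<bar> < d5" using d5(1) by (simp_all add: s_def)
  define Z where "Z = Y(3 := (\<lambda>x. Y 3 x + t3), 4 := (\<lambda>x. Y 4 x + t4 + s * (1 - cos (2 * pi * (x - \<theta>)))))"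
  have Z: "analytic_lift (Z a)" "cmap (Z a) \<in> V a" if "a < 5" for a
    using Y(1,2)[OF that] d3(2)[OF m3(2)] d5(2)[OF s(2)] by (auto simp: Z_def)
  have wdZ: "wd Z m = wd Y m" if "m \<in> lists {..<3}" for m
    using that by (intro wd_cong) (auto simp: Z_def)
  have lift_wd: "smooth_lift (wd Z m)" if "m \<in> lists {..<5}" for m
    using that Z(1) by (intro wd_smooth_lift analytic_smooth_lift) auto
  define g where "g = restrict (\<lambda>a. cmap (Z a)) {..<5}"
  have span: "cmap (wd Z m) \<in> semigroup_span {..<5} g" if "m \<in> lists {..<5}" for m
    using that by (rule cmap_wd_span) (simp_all add: g_def Z(1) analytic_smooth_lift)
  have m: "m3 @ [3] \<in> lists {..<5}" "m4 @ [4] \<in> lists {..<5}" "m4 \<in> lists {..<5}" using m3(1) m4(1) by auto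
  have "golden (wd Z (m3 @ [3]))"
    using m3(3) by (simp add: wdZ[OF m3(1)] comp_def) (simp add: Z_def)
  then have rot: "smooth_rotation (cmap (wd Z (m3 @ [3])))" "cmap (wd Z (m3 @ [3])) \<noteq> id"
    by (rule golden.smooth_rotation)+
  have B: "smooth_lift (wd Y m4)" using lift_wd[OF m(3)] by (simp add: wdZ[OF m4(1)])
  have "smooth_lift ((\<lambda>x. Y 4 x + t4) \<circ> wd Y m4)"
    by (rule smooth_lift_comp[OF analytic_smooth_lift[OF Y4(1)] B])
  then have W0: "smooth_lift (\<lambda>x. Y 4 (wd Y m4 x) + t4)" by (simp add: comp_def)
  have W: "wd Z (m4 @ [4]) = (\<lambda>x. Y 4 (wd Y m4 x) + t4 + s * (1 - cos (2 * pi * (wd Y m4 x - wd Y m4 c))))"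
    by (simp add: wdZ[OF m4(1)] comp_def) (simp add: Z_def \<theta>_def)
  have par: "parabolic (cmap (wd Z (m4 @ [4])))"
    by (rule parabolic_perturbation[OF W0 B W lift_wd[OF m(2)] s(1) m4(3,4)])
  have "g \<in> PiE {..<5} (\<lambda>_. Diff_omega)" using analytic_lift_D(5)[OF Z(1)] by (auto simp: g_def)
  then have "g \<in> good_tuples" unfolding good_tuples_def using par rot span[OF m(1)] span[OF m(2)] by blast
  moreover have "g \<in> PiE {..<5} V" using Z(2) by (auto simp: g_def)
  ultimately show ?thesis by blast
qed

lemma locally_dense_good_tuples:
  assumes X: "admissible X"
  shows "locally_dense (product_topology (\<lambda>_. X) {..<5}) good_tuples"
proof -
  let ?P = "product_topology (\<lambda>_. X) {..<5::nat}"
  define B where "B a = C1_ball (cmap (ref a)) (1 / 1000) \<inter> topspace X" for a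
  have oB: "openin X (B a)" for a unfolding B_def by (rule admissible_openin[OF X])
  have "openin ?P (PiE {..<5} B)" by (simp add: openin_PiE_gen oB)
  moreover have "PiE {..<5} B \<subseteq> ?P closure_of good_tuples"
  proof
    fix x assume x: "x \<in> PiE {..<5} B"
    have "\<exists>g. g \<in> good_tuples \<and> g \<in> T" if T: "x \<in> T" "openin ?P T" for T
    proof -
      have "\<exists>V. finite {a \<in> {..<5}. V a \<noteq> topspace X} \<and> (\<forall>a\<in>{..<5}. openin X (V a)) \<and> x \<in> PiE {..<5} V \<and> PiE {..<5} V \<subseteq> T"
        using T(2)[unfolded openin_product_topology_alt] T(1) by (rule bspec)
      then obtain V where V': "\<forall>a\<in>{..<5}. openin X (V a)" "x \<in> PiE {..<5} V" "PiE {..<5} V \<subseteq> T" by (elim exE conjE)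
      have V: "\<And>a. a < 5 \<Longrightarrow> openin X (V a)" using V'(1) by simp
      have "\<exists>g\<in>good_tuples. g \<in> PiE {..<5} V"
        by (rule good_tuple_in_box[where f = x, OF X V]) (use V'(2) x in \<open>auto simp: B_def PiE_iff\<close>)
      then show ?thesis using V'(3) by blast
    qed
    moreover have "x \<in> topspace ?P" using x by (auto simp: B_def PiE_iff)
    ultimately show "x \<in> ?P closure_of good_tuples" unfolding in_closure_of by blast
  qed
  ultimately have "PiE {..<5} B \<subseteq> ?P interior_of (?P closure_of good_tuples)" by (simp add: interior_of_maximal)
  moreover have "cmap (ref a) \<in> B a" for a
  proof -
    \<comment> \<open>\<open>C1_ball\<close> asks for closeness at a radius strictly below its own;
      any such positive value serves.\<close>
    have "close_C 1 (1 / 2000) (cmap (ref a)) (cmap (ref a))"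
      unfolding close_C_def using analytic_lift_D(7)[OF ref_analytic_lift] by (intro exI[of _ "ref a"]) auto
    then have "cmap (ref a) \<in> C1_ball (cmap (ref a)) (1 / 1000)"
      unfolding C1_ball_def by (intro CollectI exI[of _ "1 / 2000"]) simp
    then show ?thesis using admissible_topspace[OF X ref_analytic_lift] by (simp add: B_def)
  qed
  then have "restrict (\<lambda>a. cmap (ref a)) {..<5} \<in> PiE {..<5} B" by simp
  ultimately show ?thesis unfolding locally_dense_def by blast
qed

theorem corollaryA:
  "\<exists>(A :: nat set) (D :: (nat \<Rightarrow> circle \<Rightarrow> circle) set).
     finite A \<and> D \<subseteq> PiE A (\<lambda>_. Diff_omega) \<and>
     (\<forall>g\<in>D. (\<exists>f\<in>semigroup_span A g. parabolic f) \<and>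
             (\<exists>f\<in>semigroup_span A g. smooth_rotation f \<and> f \<noteq> id)) \<and>
     (\<forall>r::enat. 2 \<le> r \<longrightarrow> locally_dense (product_topology (\<lambda>_. Diff_topology r) A) D) \<and>
     locally_dense (product_topology (\<lambda>_. Diff_omega_topology) A) D"
proof (intro exI conjI allI impI)
  show "finite {..<5::nat}" by simp
  show "good_tuples \<subseteq> PiE {..<5} (\<lambda>_. Diff_omega)"
    "\<forall>g\<in>good_tuples. (\<exists>f\<in>semigroup_span {..<5} g. parabolic f) \<and>
       (\<exists>f\<in>semigroup_span {..<5} g. smooth_rotation f \<and> f \<noteq> id)"
    by (auto simp: good_tuples_def)
  show "locally_dense (product_topology (\<lambda>_. Diff_topology r) {..<5}) good_tuples" if "2 \<le> r" for r :: enat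
  proof -
    have "(1::enat) \<le> 2" by simp
    then show ?thesis using that by (intro locally_dense_good_tuples admissible_Diff) (rule order_trans)
  qed
  show "locally_dense (product_topology (\<lambda>_. Diff_omega_topology) {..<5}) good_tuples"
    by (rule locally_dense_good_tuples[OF admissible_omega])
qed

end
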